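(* Let $\Sigma\subset\mathbb{R}$ be the set of all $\lambda\in\mathbb{R}$ for which the problem $$ \begin{cases} -\mathrm{div}(a(x,\nabla u)) = \lambda \rho(x) |u|^{p-2}u & \text{in } \Omega,\\ u=0 & \text{on } \partial\Omega \end{cases} $$ has a nontrivial weak solution $u\in W^{1,p}_0(\Omega)$. Then $\Sigma$ is a closed subset of $\mathbb{R}$ and, moreover, $\Sigma\subset(0,\infty)$.
   Context: Standing assumptions. $1<p<\infty$; $\Omega\subset\mathbb{R}^N$, $N\ge 1$, is a bounded domain; $\rho$ is measurable with $0<\rho^-\le\rho(x)\le\rho^+<\infty$ for a.e. $x\in\Omega$, for constants $\rho^\pm$. A weak solution of the problem is $u\in W^{1,p}_0(\Omega)$ with $\int_\Omega a(x,\nabla u)\cdot\nabla v\,dx=\lambda\int_\Omega\rho|u|^{p-2}uv\,dx$ for all $v\in W^{1,p}_0(\Omega)$. The function $a:\Omega\times\mathbb{R}^N\to\mathbb{R}^N$ satisfies, with positive constants $\alpha,\beta,c$, for all $\xi,\xi_1,\xi_2,\dots\in\mathbb{R}^N$ and a.e. $x\in\Omega$: (H0) $a(x,\cdot)$ is continuous for a.e. $x$ and $a(\cdot,\xi)$ is measurable for every $\xi$; (H1) $0\le (a(x,\xi_1)-a(x,\xi_2))\cdot(\xi_1-\xi_2)$; (H2) $\alpha|\xi|^p\le a(x,\xi)\cdot\xi$; (H3) $|a(x,\xi)|\le\beta|\xi|^{p-1}$; (H4) $a(x,t\xi)=t^{p-1}a(x,\xi)$ for every $t>0$; (H5) $a(x,-\xi)=-a(x,\xi)$;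 (H6) with $\Psi(x,\xi_1,\xi_2)=a(x,\xi_1)\cdot\xi_1+a(x,\xi_2)\cdot\xi_2$ and $\delta=\min\{p/2,p-1\}$, $|a(x,\xi_1)-a(x,\xi_2)|\le c\,\Psi(x,\xi_1,\xi_2)^{(p-1-\delta)/p}\big[(a(x,\xi_1)-a(x,\xi_2))\cdot(\xi_1-\xi_2)\big]^{\delta/p}$; (H7) $\sum_{i=1}^k a(x,\xi_i)\cdot(\xi_{i+1}-\xi_i)\le 0$ for all $k\ge1$ and $\xi_1,\dots,\xi_{k+1}$ with $\xi_{k+1}=\xi_1$; (H8) with $\gamma=\max(2,p)$, $\alpha|\xi_1-\xi_2|^{\gamma}\Psi(x,\xi_1,\xi_2)^{1-\gamma/p}\le(a(x,\xi_1)-a(x,\xi_2))\cdot(\xi_1-\xi_2)$ (for $(\xi_1,\xi_2)\neq(0,0)$). *)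

theory Defs
  imports "HOL-Analysis.Analysis"
begin

text \<open>
  Functions on \<open>\<Omega>\<close> are total functions on \<open>real^'n\<close> of which only the values on \<open>\<Omega>\<close> matter;
  measurability and integrals are with respect to Lebesgue measure on \<open>\<Omega>\<close>. Elements of the
  function spaces are functions, not equivalence classes, so ``zero in the space'' means
  ``zero almost everywhere''.
\<close>

subsection \<open>Test functions\<close>

definition partial_deriv :: "'n \<Rightarrow> (real^'n \<Rightarrow> real) \<Rightarrow> real^'n \<Rightarrow> real" where
  "partial_deriv i f x = frechet_derivative f (at x) (axis i 1)"

primrec iter_partial :: "'n list \<Rightarrow> (real^'n \<Rightarrow> real) \<Rightarrow> real^'n \<Rightarrow> real" where
  "iter_partial [] f = f"
| "iter_partial (i # js) f = partial_deriv i (iter_partial js f)"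

text \<open>
  All iterated partial derivatives exist and are (totally) differentiable, hence continuous;
  this is the class \<open>C\<^sup>\<infinity>\<close> on the whole space.
\<close>
definition smooth :: "(real^'n \<Rightarrow> real) \<Rightarrow> bool" where
  "smooth f \<longleftrightarrow> (\<forall>js x. iter_partial js f differentiable (at x))"

text \<open>\<open>C\<^sub>c\<^sup>\<infinity>(\<Omega>)\<close>, each function being extended by zero outside \<open>\<Omega>\<close>.\<close>
definition test_functions :: "(real^'n) set \<Rightarrow> (real^'n \<Rightarrow> real) set" where
  "test_functions \<Omega> =
     {\<phi>. smooth \<phi> \<and> compact (closure {x. \<phi> x \<noteq> 0}) \<and> closure {x. \<phi> x \<noteq> 0} \<subseteq> \<Omega>}"

subsection \<open>Sobolev spaces\<close>

definition Lp :: "real \<Rightarrow> (real^'n) set \<Rightarrow> (real^'n \<Rightarrow> 'b::euclidean_space) set" where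
  "Lp p \<Omega> = {f \<in> borel_measurable (lebesgue_on \<Omega>).
                integrable (lebesgue_on \<Omega>) (\<lambda>x. norm (f x) powr p)}"

definition locally_integrable :: "(real^'n) set \<Rightarrow> (real^'n \<Rightarrow> 'b::euclidean_space) \<Rightarrow> bool" where
  "locally_integrable \<Omega> f \<longleftrightarrow> (\<forall>K. compact K \<and> K \<subseteq> \<Omega> \<longrightarrow> integrable (lebesgue_on K) f)"

definition has_weak_gradient ::
    "(real^'n) set \<Rightarrow> (real^'n \<Rightarrow> real) \<Rightarrow> (real^'n \<Rightarrow> real^'n) \<Rightarrow> bool" where
  "has_weak_gradient \<Omega> u G \<longleftrightarrow>
     locally_integrable \<Omega> u \<and> locally_integrable \<Omega> G \<and>
     (\<forall>i. \<forall>\<phi>\<in>test_functions \<Omega>.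
        (\<integral>x. u x * partial_deriv i \<phi> x \<partial>lebesgue_on \<Omega>) = - (\<integral>x. G x $ i * \<phi> x \<partial>lebesgue_on \<Omega>))"

text \<open>
  A weak gradient is unique only up to null sets, so this picks a representative; it is
  unspecified if no weak gradient exists, and is only used for functions in \<open>W1p\<close>.
\<close>
definition wgrad :: "(real^'n) set \<Rightarrow> (real^'n \<Rightarrow> real) \<Rightarrow> real^'n \<Rightarrow> real^'n" where
  "wgrad \<Omega> u = (SOME G. has_weak_gradient \<Omega> u G)"

definition W1p :: "real \<Rightarrow> (real^'n) set \<Rightarrow> (real^'n \<Rightarrow> real) set" where
  "W1p p \<Omega> = {u \<in> Lp p \<Omega>. \<exists>G\<in>Lp p \<Omega>. has_weak_gradient \<Omega> u G}"

definition W1p_norm :: "real \<Rightarrow> (real^'n) set \<Rightarrow> (real^'n \<Rightarrow> real) \<Rightarrow> real" where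
  "W1p_norm p \<Omega> u =
     ((\<integral>x. \<bar>u x\<bar> powr p \<partial>lebesgue_on \<Omega>) + (\<integral>x. norm (wgrad \<Omega> u x) powr p \<partial>lebesgue_on \<Omega>)) powr (1 / p)"

text \<open>The closure of \<open>C\<^sub>c\<^sup>\<infinity>(\<Omega>)\<close> in \<open>W\<^sup>1\<^sup>,\<^sup>p(\<Omega>)\<close>.\<close>
definition W1p_0 :: "real \<Rightarrow> (real^'n) set \<Rightarrow> (real^'n \<Rightarrow> real) set" where
  "W1p_0 p \<Omega> =
     {u \<in> W1p p \<Omega>. \<exists>\<phi>. (\<forall>k::nat. \<phi> k \<in> test_functions \<Omega>) \<and>
        (\<lambda>k. W1p_norm p \<Omega> (\<lambda>x. \<phi> k x - u x)) \<longlonglongrightarrow> 0}"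

subsection \<open>The eigenvalue problem\<close>

text \<open>
  For \<open>p < 2\<close> the factor \<open>\<bar>u x\<bar> powr (p - 2)\<close> is \<open>0\<close> where \<open>u x = 0\<close>, so the product
  \<open>\<bar>u\<bar>\<^sup>p\<^sup>-\<^sup>2 u\<close> has its usual value \<open>0\<close> there.
\<close>
definition weak_solution ::
    "real \<Rightarrow> (real^'n) set \<Rightarrow> (real^'n \<Rightarrow> real^'n \<Rightarrow> real^'n) \<Rightarrow> (real^'n \<Rightarrow> real) \<Rightarrow>
     real \<Rightarrow> (real^'n \<Rightarrow> real) \<Rightarrow> bool" where
  "weak_solution p \<Omega> a \<rho> l u \<longleftrightarrow>
     u \<in> W1p_0 p \<Omega> \<and>
     (\<forall>v\<in>W1p_0 p \<Omega>.
        (\<integral>x. a x (wgrad \<Omega> u x) \<bullet> wgrad \<Omega> v x \<partial>lebesgue_on \<Omega>) =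
        l * (\<integral>x. \<rho> x * \<bar>u x\<bar> powr (p - 2) * u x * v x \<partial>lebesgue_on \<Omega>))"

definition eigenvalues ::
    "real \<Rightarrow> (real^'n) set \<Rightarrow> (real^'n \<Rightarrow> real^'n \<Rightarrow> real^'n) \<Rightarrow> (real^'n \<Rightarrow> real) \<Rightarrow> real set" where
  "eigenvalues p \<Omega> a \<rho> =
     {l. \<exists>u. weak_solution p \<Omega> a \<rho> l u \<and> \<not> (AE x in lebesgue_on \<Omega>. u x = 0)}"

definition Psi :: "(real^'n \<Rightarrow> real^'n \<Rightarrow> real^'n) \<Rightarrow> real^'n \<Rightarrow> real^'n \<Rightarrow> real^'n \<Rightarrow> real" where
  "Psi a x \<xi>1 \<xi>2 = a x \<xi>1 \<bullet> \<xi>1 + a x \<xi>2 \<bullet> \<xi>2"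

end

theory Submission
  imports Defs "HOL-Complex_Analysis.Great_Picard"
begin

text \<open>
Testing the equation of an eigenfunction \<open>u\<close> with \<open>u\<close> itself gives
\<open>\<integral> a(x, \<nabla>u) \<bullet> \<nabla>u = \<lambda> \<integral> \<rho> \<bar>u\<bar>\<^sup>p\<close>. By coercivity the left side is at least
\<open>\<alpha> \<integral> \<bar>\<nabla>u\<bar>\<^sup>p\<close>, which the Poincare inequality makes positive, so \<open>\<lambda> > 0\<close>
(\<open>eigenvalues_positive\<close>).

For closedness, let \<open>\<lambda>\<^sub>n\<close> be eigenvalues tending to \<open>\<lambda>\<close>. By homogeneity there are eigenfunctions
\<open>u\<^sub>n\<close> with \<open>\<integral> \<bar>u\<^sub>n\<bar>\<^sup>p = 1\<close>, and the identity above bounds their gradients in \<open>L\<^sup>p\<close>. Rellich's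
theorem gives a subsequence that is Cauchy in \<open>L\<^sup>p\<close>. Then the gradients are Cauchy in \<open>L\<^sup>p\<close> too
(\<open>gradients_Cauchy\<close>): the equations for \<open>u\<^sub>m\<close> and \<open>u\<^sub>n\<close>, both tested with \<open>u\<^sub>m - u\<^sub>n\<close>, show that
\<open>\<integral> (a(x, \<nabla>u\<^sub>m) - a(x, \<nabla>u\<^sub>n)) \<bullet> (\<nabla>u\<^sub>m - \<nabla>u\<^sub>n)\<close> is controlled by \<open>u\<^sub>m - u\<^sub>n\<close>, and the strong
monotonicity of \<open>a\<close> turns this into control of \<open>\<nabla>u\<^sub>m - \<nabla>u\<^sub>n\<close>. Strong convergence thus
comes for free, without weak compactness. Along a further subsequence functions and gradients converge
almost everywhere under a dominating function (\<open>Riesz_Fischer\<close>), and dominated convergence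
carries the equation and the normalisation to the limit (\<open>weak_form_limit\<close>, \<open>eigenvalues_limit\<close>).

The Sobolev space enters only through pairs \<open>(u, G)\<close> that are \<open>L\<^sup>p\<close> limits of
\<open>(\<phi>\<^sub>k, \<nabla>\<phi>\<^sub>k)\<close> with test functions \<open>\<phi>\<^sub>k\<close> (\<open>W0_pair\<close>). That \<open>G\<close> then agrees with the chosen weak gradient
is the uniqueness of weak gradients (\<open>has_weak_gradient_unique\<close>), which needs enough test
functions: products of the flat functions \<open>exp(-1/t)\<close>. The Poincare inequality and Rellich's
theorem are proved for continuously differentiable functions of compact support, both from the estimate
\<open>\<integral> \<bar>f(x + h) - f(x)\<bar>\<^sup>p dx \<le> 2\<^sup>p \<bar>h\<bar>\<^sup>p \<integral> \<bar>\<nabla>f\<bar>\<^sup>p\<close> (\<open>translation_estimate\<close>), and pass to pairs by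
approximation. Constants never matter, so crude elementary inequalities do the work of those
of Hoelder, Minkowski and Jensen.
\<close>

section \<open>Integrals of p-th powers\<close>

lemma norm_add_powr_le:
  fixes x y :: "'a::real_normed_vector"
  assumes "0 \<le> p"
  shows "norm (x + y) powr p \<le> 2 powr p * (norm x powr p + norm y powr p)"
proof -
  have "norm (x + y) \<le> 2 * max (norm x) (norm y)"
    using norm_triangle_ineq[of x y] by linarith
  then have "norm (x + y) powr p \<le> (2 * max (norm x) (norm y)) powr p"
    using assms by (intro powr_mono2) auto
  also have "\<dots> = 2 powr p * max (norm x) (norm y) powr p"
    by (simp add: powr_mult)
  also have "\<dots> \<le> 2 powr p * (norm x powr p + norm y powr p)"
    by (intro mult_left_mono) (auto simp: max_def)
  finally show ?thesis .
qed

text \<open>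
A form of Young's inequality without sharp constants: either \<open>t \<le> e s\<close>, and the first
summand dominates, or \<open>s < t / e\<close>, and the second one does. The free parameter \<open>e\<close> lets a product
be small as soon as one factor is small, which is what Hoelder's inequality would otherwise provide.
\<close>
lemma Young_powr_eps:
  fixes s t e p :: real
  assumes "0 \<le> s" "0 \<le> t" "0 < e" "1 \<le> p"
  shows "s powr (p - 1) * t \<le> e * s powr p + e powr (1 - p) * t powr p"
proof (cases "t \<le> e * s")
  case True
  have "s powr (p - 1) * t \<le> s powr (p - 1) * (e * s)"
    using True by (intro mult_left_mono) auto
  also have "\<dots> = e * s powr p"
    using assms by (cases "s = 0") (auto simp: powr_diff)
  also have "\<dots> \<le> \<dots> + e powr (1 - p) * t powr p"
    by simp
  finally show ?thesis .
next
  case False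
  then have t: "s \<le> t / e" "0 < t"
    using assms by (auto simp: field_simps) (smt (verit) mult_nonneg_nonneg)
  have "s powr (p - 1) * t \<le> (t / e) powr (p - 1) * t"
    using t assms by (intro mult_right_mono powr_mono2) auto
  also have "\<dots> = e powr (1 - p) * t powr p"
    using assms t by (simp add: powr_divide powr_diff field_simps)
  also have "\<dots> \<le> e * s powr p + e powr (1 - p) * t powr p"
    using assms by simp
  finally show ?thesis .
qed

lemma Young_powr:
  fixes s t p :: real
  assumes "0 \<le> s" "0 \<le> t" "1 < p"
  shows "s powr (p - 1) * t \<le> s powr p + t powr p"
  using Young_powr_eps[OF assms(1,2) zero_less_one, of p] assms by simp

text \<open>
Membership in \<open>L\<^sup>p\<close> over an arbitrary measure, with functions rather than classes.
\<close>
definition p_integrable :: "'a measure \<Rightarrow> real \<Rightarrow> ('a \<Rightarrow> 'b::euclidean_space) \<Rightarrow> bool" where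
  "p_integrable M p f \<longleftrightarrow> f \<in> borel_measurable M \<and> integrable M (\<lambda>x. norm (f x) powr p)"

lemma p_integrable_measurable: "p_integrable M p f \<Longrightarrow> f \<in> borel_measurable M"
  and p_integrable_integrable: "p_integrable M p f \<Longrightarrow> integrable M (\<lambda>x. norm (f x) powr p)"
  by (auto simp: p_integrable_def)

lemma p_integrable_dominated:
  assumes "p_integrable M p g" "f \<in> borel_measurable M" "AE x in M. norm (f x) \<le> norm (g x)" "0 \<le> p"
  shows "p_integrable M p f"
  unfolding p_integrable_def
proof
  have [measurable]: "f \<in> borel_measurable M" by fact
  show "integrable M (\<lambda>x. norm (f x) powr p)"
  proof (rule Bochner_Integration.integrable_bound)
    show "integrable M (\<lambda>x. norm (g x) powr p)"
      using assms by (simp add: p_integrable_def)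
    show "AE x in M. norm (norm (f x) powr p) \<le> norm (norm (g x) powr p)"
      using assms(3) by eventually_elim (use assms in \<open>auto intro!: powr_mono2\<close>)
  qed measurable
qed fact

lemma p_integrable_add:
  assumes "p_integrable M p f" "p_integrable M p g" "0 \<le> p"
  shows "p_integrable M p (\<lambda>x. f x + g x)"
  unfolding p_integrable_def
proof
  have [measurable]: "f \<in> borel_measurable M" "g \<in> borel_measurable M"
    using assms by (auto simp: p_integrable_def)
  show "(\<lambda>x. f x + g x) \<in> borel_measurable M" by measurable
  show "integrable M (\<lambda>x. norm (f x + g x) powr p)"
  proof (rule Bochner_Integration.integrable_bound)
    show "integrable M (\<lambda>x. 2 powr p * (norm (f x) powr p + norm (g x) powr p))"
      using assms by (auto simp: p_integrable_def)
    show "AE x in M. norm (norm (f x + g x) powr p) \<le> norm (2 powr p * (norm (f x) powr p + norm (g x) powr p))"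
      using norm_add_powr_le[OF assms(3)] by auto
  qed measurable
qed

lemma p_integrable_scaleR:
  assumes "p_integrable M p f"
  shows "p_integrable M p (\<lambda>x. c *\<^sub>R f x)"
  using assms by (auto simp: p_integrable_def powr_mult)

lemma p_integrable_diff:
  assumes "p_integrable M p f" "p_integrable M p g" "0 \<le> p"
  shows "p_integrable M p (\<lambda>x. f x - g x)"
  using p_integrable_add[OF assms(1) p_integrable_scaleR[OF assms(2), of "-1"] assms(3)] by simp

lemma p_integral_add_le:
  assumes "p_integrable M p f" "p_integrable M p g" "0 \<le> p"
  shows "(\<integral>x. norm (f x + g x) powr p \<partial>M) \<le>
         2 powr p * ((\<integral>x. norm (f x) powr p \<partial>M) + (\<integral>x. norm (g x) powr p \<partial>M))"
proof -
  have "(\<integral>x. norm (f x + g x) powr p \<partial>M) \<le> (\<integral>x. 2 powr p * (norm (f x) powr p + norm (g x) powr p) \<partial>M)"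
    using p_integrable_add[OF assms] assms norm_add_powr_le[OF assms(3)]
    by (intro integral_mono) (auto simp: p_integrable_def)
  then show ?thesis
    using assms by (auto simp: p_integrable_def)
qed

text \<open>
The \<open>p\<close>-th power of the \<open>L\<^sup>p\<close> distance satisfies the triangle inequality up to a constant, so
convergence arguments can avoid roots and Minkowski's inequality.
\<close>
lemma p_integral_triangle:
  assumes "p_integrable M p f" "p_integrable M p g" "p_integrable M p h" "0 \<le> p"
  shows "(\<integral>x. norm (f x - h x) powr p \<partial>M) \<le>
         2 powr p * ((\<integral>x. norm (f x - g x) powr p \<partial>M) + (\<integral>x. norm (g x - h x) powr p \<partial>M))"
  using p_integral_add_le[OF p_integrable_diff[OF assms(1,2,4)] p_integrable_diff[OF assms(2,3,4)] assms(4)]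
  by simp

lemma fast_subsequence:
  fixes d :: "nat \<Rightarrow> nat \<Rightarrow> real"
  assumes "\<And>e. 0 < e \<Longrightarrow> \<exists>N. \<forall>m\<ge>N. \<forall>n\<ge>N. d m n < e" and "\<And>n. 0 < b n"
  obtains r where "strict_mono r" "\<And>n. d (r (Suc n)) (r n) < b n"
proof -
  have "\<exists>N. \<forall>m\<ge>N. \<forall>n\<ge>N. d m n < b k" for k
    using assms by blast
  then obtain N where N: "\<And>k m n. m \<ge> N k \<Longrightarrow> n \<ge> N k \<Longrightarrow> d m n < b k"
    by metis
  define r where "r = rec_nat (N 0) (\<lambda>n rn. max (Suc rn) (N (Suc n)))"
  have rS: "r (Suc n) = max (Suc (r n)) (N (Suc n))" for n
    by (simp add: r_def)
  have rN: "r n \<ge> N n" for n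
    by (cases n) (auto simp: r_def)
  have "strict_mono r"
    by (rule strict_mono_Suc_iff[THEN iffD2]) (auto simp: rS)
  moreover have "d (r (Suc n)) (r n) < b n" for n
    using N[of n "r (Suc n)" "r n"] rN[of n] rS[of n] by linarith
  ultimately show ?thesis
    using that by blast
qed

text \<open>
Along a fast subsequence the increments \<open>D n\<close> have \<open>\<integral> D n\<^sup>p\<close> so small that
\<open>H = \<Sum>n. 2\<^sup>n\<^sup>p D n\<^sup>p\<close> is integrable. Then \<open>D n \<le> 2\<^sup>-\<^sup>n \<bar>H\<bar> powr (1 / p)\<close> almost everywhere, so the telescoping series
converges and \<open>2 \<bar>H\<bar> powr (1 / p)\<close> bounds the distance to its first term. Besides
completeness this yields the dominating function \<open>g\<close> that dominated convergence needs later.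
\<close>
theorem Riesz_Fischer:
  fixes f :: "nat \<Rightarrow> 'a \<Rightarrow> 'b::euclidean_space"
  assumes p: "1 < p"
    and f: "\<And>n. p_integrable M p (f n)"
    and Cauchy: "\<And>e. 0 < e \<Longrightarrow> \<exists>N. \<forall>m\<ge>N. \<forall>n\<ge>N. (\<integral>x. norm (f m x - f n x) powr p \<partial>M) < e"
  obtains r F g where "strict_mono r" "p_integrable M p F" "p_integrable M p (g :: 'a \<Rightarrow> real)"
    "\<And>x. 0 \<le> g x"
    "AE x in M. (\<lambda>n. f (r n) x) \<longlonglongrightarrow> F x"
    "AE x in M. \<forall>n. norm (f (r n) x) \<le> g x"
    "(\<lambda>n. \<integral>x. norm (f (r n) x - F x) powr p \<partial>M) \<longlonglongrightarrow> 0"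
proof -
  \<comment> \<open>The weight \<open>w n\<close> is \<open>2\<^sup>n\<^sup>p\<close>; increments with \<open>\<integral> D n\<^sup>p < 2\<^sup>-\<^sup>n / w n\<close> keep \<open>\<Sum>n. w n D n\<^sup>p\<close> integrable.\<close>
  define w :: "nat \<Rightarrow> real" where "w n = 2 powr (real n * p)" for n
  obtain r where r: "strict_mono r"
    and d: "\<And>n. (\<integral>x. norm (f (r (Suc n)) x - f (r n) x) powr p \<partial>M) < (1/2) ^ n / w n"
    using fast_subsequence[OF Cauchy, of "\<lambda>n. (1/2) ^ n / w n"] by (auto simp: w_def)
  define D where "D n x = norm (f (r (Suc n)) x - f (r n) x)" for n x
  have [measurable]: "f n \<in> borel_measurable M" for n
    using f by (rule p_integrable_measurable)
  have D[measurable]: "D n \<in> borel_measurable M" for n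
    unfolding D_def by measurable
  have D0: "0 \<le> D n x" for n x
    by (simp add: D_def)
  have Di: "integrable M (\<lambda>x. D n x powr p)" for n
    using p_integrable_diff[OF f[of "r (Suc n)"] f[of "r n"]] p by (auto simp: p_integrable_def D_def)
  define h where "h n x = w n * D n x powr p" for n x
  have w0: "0 < w n" for n by (simp add: w_def)
  have h0: "0 \<le> h n x" for n x
    using w0[of n] by (simp add: h_def)
  have hi: "integrable M (h n)" for n
    unfolding h_def using Di by auto
  have hb: "(\<integral>x. norm (h n x) \<partial>M) \<le> (1/2) ^ n" for n
  proof -
    have "(\<integral>x. norm (h n x) \<partial>M) = w n * (\<integral>x. D n x powr p \<partial>M)"
      using h0 by (simp add: h_def)
    also have "\<dots> \<le> w n * ((1/2)^n / w n)"
      using d[of n] w0[of n] by (intro mult_left_mono) (auto simp: D_def)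
    finally show ?thesis using w0[of n] by simp
  qed
  have sumh: "summable (\<lambda>n. \<integral>x. norm (h n x) \<partial>M)"
    by (rule summable_comparison_test'[of "\<lambda>n. (1/2)^n" 0]) (use hb in auto)
  have "(\<integral>\<^sup>+x. (\<Sum>n. ennreal (h n x)) \<partial>M) = (\<Sum>n. \<integral>\<^sup>+x. ennreal (h n x) \<partial>M)"
    unfolding h_def by (intro nn_integral_suminf) auto
  also have "\<dots> = (\<Sum>n. ennreal (\<integral>x. h n x \<partial>M))"
    using hi h0 by (auto simp: nn_integral_eq_integral)
  also have "\<dots> < \<infinity>"
    using sumh h0 by (simp add: ennreal_suminf_neq_top less_top)
  finally have "AE x in M. (\<Sum>n. ennreal (h n x)) \<noteq> \<infinity>"
    unfolding h_def by (intro nn_integral_PInf_AE) auto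
  then have AEs: "AE x in M. summable (\<lambda>n. h n x)"
    by eventually_elim (use h0 in \<open>auto simp: summable_suminf_not_top\<close>)
  define H where "H x = (\<Sum>n. h n x)" for x
  have Hi: "integrable M H"
    unfolding H_def
    by (rule integrable_suminf) (use hi sumh AEs h0 in auto)
  then have Hm[measurable]: "H \<in> borel_measurable M" by auto
  have AED: "AE x in M. \<forall>n. D n x \<le> (1/2)^n * \<bar>H x\<bar> powr (1/p)"
    using AEs
  proof eventually_elim
    case (elim x)
    show ?case
    proof
      fix n
      have "h n x \<le> H x"
        unfolding H_def using sum_le_suminf[OF elim, of "{n}"] h0 by auto
      then have "D n x powr p \<le> \<bar>H x\<bar> / w n"
        using w0[of n] by (simp add: h_def field_simps)
      then have "(D n x powr p) powr (1/p) \<le> (\<bar>H x\<bar> / w n) powr (1/p)"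
        using p by (intro powr_mono2) auto
      also have "(\<bar>H x\<bar> / w n) powr (1/p) = (1/2)^n * \<bar>H x\<bar> powr (1/p)"
        using p by (simp add: powr_divide w_def powr_powr power_one_over powr_realpow field_simps)
      finally show "D n x \<le> (1/2)^n * \<bar>H x\<bar> powr (1/p)"
        using p D0[of n x] by (simp add: powr_powr)
    qed
  qed
  define g where "g x = norm (f (r 0) x) + 2 * \<bar>H x\<bar> powr (1/p)" for x
  have g0: "0 \<le> g x" for x by (simp add: g_def)
  have gp: "p_integrable M p g"
  proof -
    have "p_integrable M p (\<lambda>x. norm (f (r 0) x))"
      using f by (auto simp: p_integrable_def)
    moreover have "p_integrable M p (\<lambda>x. 2 * \<bar>H x\<bar> powr (1/p))"
      using Hi p by (auto simp: p_integrable_def powr_mult powr_powr intro!: integrable_abs)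
    ultimately show ?thesis
      unfolding g_def[abs_def] using p by (intro p_integrable_add) auto
  qed
  have AEb: "AE x in M. convergent (\<lambda>n. f (r n) x) \<and> (\<forall>n. norm (f (r n) x) \<le> g x)"
    using AED
  proof eventually_elim
    case (elim x)
    let ?c = "\<bar>H x\<bar> powr (1/p)"
    have s: "summable (\<lambda>n. (1/2)^n * ?c)"
      by (intro summable_mult2 summable_geometric) auto
    have sD: "summable (\<lambda>n. f (r (Suc n)) x - f (r n) x)"
      by (rule summable_norm_cancel, rule summable_comparison_test'[OF s])
         (use elim in \<open>auto simp: D_def\<close>)
    have eq: "(\<Sum>k<n. f (r (Suc k)) x - f (r k) x) = f (r n) x - f (r 0) x" for n
      by (rule sum_lessThan_telescope)
    have "convergent (\<lambda>n. f (r n) x - f (r 0) x)"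
      using sD unfolding summable_iff_convergent eq .
    then have "convergent (\<lambda>n. f (r n) x)"
      using convergent_add_const_iff[of "- f (r 0) x" "\<lambda>n. f (r n) x"] by simp
    moreover have "norm (f (r n) x) \<le> g x" for n
    proof -
      have "norm (f (r n) x - f (r 0) x) \<le> (\<Sum>k<n. norm (f (r (Suc k)) x - f (r k) x))"
        unfolding eq[symmetric] by (rule norm_sum)
      also have "\<dots> \<le> (\<Sum>k<n. (1/2)^k * ?c)"
        using elim by (intro sum_mono) (auto simp: D_def)
      also have "\<dots> \<le> (\<Sum>k. (1/2)^k * ?c)"
        by (rule sum_le_suminf[OF s]) auto
      also have "\<dots> = 2 * ?c"
        using suminf_mult2[OF summable_geometric[of "1/2::real"], of ?c] by (simp add: suminf_geometric)
      finally show ?thesis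
        unfolding g_def using norm_triangle_ineq2[of "f (r n) x" "f (r 0) x"] by linarith
    qed
    ultimately show ?case by blast
  qed
  define F where "F x = lim (\<lambda>n. f (r n) x)" for x
  have Fm[measurable]: "F \<in> borel_measurable M"
    unfolding F_def by (rule borel_measurable_lim_metric) measurable
  have AEc: "AE x in M. (\<lambda>n. f (r n) x) \<longlonglongrightarrow> F x"
    using AEb by eventually_elim (auto simp: F_def convergent_LIMSEQ_iff)
  have AEd: "AE x in M. \<forall>n. norm (f (r n) x) \<le> g x"
    using AEb by eventually_elim auto
  have AEF: "AE x in M. norm (F x) \<le> g x"
    using AEc AEd by eventually_elim (rule LIMSEQ_le_const2[OF tendsto_norm], auto)
  have Fp: "p_integrable M p F"
    by (rule p_integrable_dominated[OF gp]) (use AEF g0 p in auto)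
  have "(\<lambda>n. \<integral>x. norm (f (r n) x - F x) powr p \<partial>M) \<longlonglongrightarrow> (\<integral>x. 0 \<partial>M)"
  proof (rule integral_dominated_convergence)
    show "integrable M (\<lambda>x. (2 * g x) powr p)"
      using p_integrable_integrable[OF p_integrable_scaleR[OF gp, of 2]] g0 by simp
    show "AE x in M. (\<lambda>n. norm (f (r n) x - F x) powr p) \<longlonglongrightarrow> 0"
      using AEc
    proof eventually_elim
      case (elim x)
      then have "(\<lambda>n. norm (f (r n) x - F x)) \<longlonglongrightarrow> 0"
        by (simp add: LIM_zero_iff tendsto_norm_zero_iff)
      then show ?case
        using tendsto_powr'[OF _ tendsto_const[of p], of "\<lambda>n. norm (f (r n) x - F x)" 0 sequentially] p by simp
    qed
    show "AE x in M. norm (norm (f (r n) x - F x) powr p) \<le> (2 * g x) powr p" for n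
      using AEd AEF
    proof eventually_elim
      case (elim x)
      have "norm (f (r n) x - F x) \<le> norm (f (r n) x) + norm (F x)"
        by (rule norm_triangle_ineq4)
      also have "\<dots> \<le> 2 * g x"
        using elim by (smt (verit))
      finally show ?case
        using p by (auto intro!: powr_mono2)
    qed
  qed measurable
  then show ?thesis
    using that[OF r Fp gp g0 AEc AEd] by simp
qed

section \<open>Smooth bump functions\<close>

lemma partial_deriv_eq:
  assumes "(f has_derivative f') (at x)"
  shows "partial_deriv i f x = f' (axis i 1)"
  using frechet_derivative_at[OF assms] by (simp add: partial_deriv_def)

lemma iter_partial_snoc: "iter_partial (js @ [i]) f = iter_partial js (partial_deriv i f)"
  by (induction js) auto

text \<open>
Smoothness quantifies over all lists of directions at once; a bound on their length makes the Leibniz rule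
accessible to induction.
\<close>
definition k_times_differentiable :: "nat \<Rightarrow> (real^'n \<Rightarrow> real) \<Rightarrow> bool" where
  "k_times_differentiable k f \<longleftrightarrow>
     (\<forall>js x. length js \<le> k \<longrightarrow> iter_partial js f differentiable (at x))"

lemma smooth_iff: "smooth f \<longleftrightarrow> (\<forall>k. k_times_differentiable k f)"
  by (auto simp: smooth_def k_times_differentiable_def)

lemma k_times_differentiable_0: "k_times_differentiable 0 f \<longleftrightarrow> (\<forall>x. f differentiable (at x))"
  by (simp add: k_times_differentiable_def)

lemma k_times_differentiable_Suc:
  "k_times_differentiable (Suc k) f \<longleftrightarrow>
     (\<forall>x. f differentiable (at x)) \<and> (\<forall>i. k_times_differentiable k (partial_deriv i f))"
proof
  assume L: "k_times_differentiable (Suc k) f"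
  show "(\<forall>x. f differentiable (at x)) \<and> (\<forall>i. k_times_differentiable k (partial_deriv i f))"
  proof (intro conjI allI)
    show "f differentiable (at x)" for x
      using L[unfolded k_times_differentiable_def, rule_format, of "[]"] by simp
    show "k_times_differentiable k (partial_deriv i f)" for i
      unfolding k_times_differentiable_def
      using L[unfolded k_times_differentiable_def, rule_format, of "_ @ [i]"]
      by (auto simp: iter_partial_snoc)
  qed
next
  assume R: "(\<forall>x. f differentiable (at x)) \<and> (\<forall>i. k_times_differentiable k (partial_deriv i f))"
  show "k_times_differentiable (Suc k) f"
    unfolding k_times_differentiable_def
  proof (intro allI impI)
    fix js :: "'a list" and x
    assume "length js \<le> Suc k"
    then show "iter_partial js f differentiable (at x)"
      using R by (cases js rule: rev_cases) (auto simp: iter_partial_snoc k_times_differentiable_def)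
  qed
qed

lemma k_times_differentiable_SucD: "k_times_differentiable (Suc k) f \<Longrightarrow> k_times_differentiable k f"
  by (simp add: k_times_differentiable_def)

lemma partial_deriv_add:
  assumes "\<And>x. f differentiable (at x)" "\<And>x. g differentiable (at x)"
  shows "partial_deriv i (\<lambda>x. f x + g x) = (\<lambda>x. partial_deriv i f x + partial_deriv i g x)"
proof
  fix x
  show "partial_deriv i (\<lambda>x. f x + g x) x = partial_deriv i f x + partial_deriv i g x"
    using partial_deriv_eq[OF has_derivative_add[OF assms(1)[of x, unfolded frechet_derivative_works]
          assms(2)[of x, unfolded frechet_derivative_works]], of i]
    by (simp add: partial_deriv_def)
qed

lemma partial_deriv_mult:
  assumes "\<And>x. f differentiable (at x)" "\<And>x. g differentiable (at x)"
  shows "partial_deriv i (\<lambda>x. f x * g x) = (\<lambda>x. f x * partial_deriv i g x + partial_deriv i f x * g x)"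
proof
  fix x
  show "partial_deriv i (\<lambda>x. f x * g x) x = f x * partial_deriv i g x + partial_deriv i f x * g x"
    using partial_deriv_eq[OF has_derivative_mult[OF assms(1)[of x, unfolded frechet_derivative_works]
          assms(2)[of x, unfolded frechet_derivative_works]], of i]
    by (simp add: partial_deriv_def)
qed

lemma k_times_differentiable_add:
  "k_times_differentiable k f \<Longrightarrow> k_times_differentiable k g \<Longrightarrow> k_times_differentiable k (\<lambda>x. f x + g x)"
proof (induction k arbitrary: f g)
  case (Suc k)
  then show ?case
    by (auto simp: k_times_differentiable_Suc partial_deriv_add intro!: differentiable_add)
qed (auto simp: k_times_differentiable_0 intro!: differentiable_add)

lemma k_times_differentiable_mult:
  "k_times_differentiable k f \<Longrightarrow> k_times_differentiable k g \<Longrightarrow> k_times_differentiable k (\<lambda>x. f x * g x)"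
proof (induction k arbitrary: f g)
  case (Suc k)
  then show ?case
    using k_times_differentiable_SucD[OF Suc.prems(1)] k_times_differentiable_SucD[OF Suc.prems(2)]
    by (auto simp: k_times_differentiable_Suc partial_deriv_mult
             intro!: differentiable_mult k_times_differentiable_add Suc.IH)
qed (auto simp: k_times_differentiable_0 intro!: differentiable_mult)

lemma k_times_differentiable_const: "k_times_differentiable k (\<lambda>x. c)"
proof (induction k arbitrary: c)
  case (Suc k)
  have "partial_deriv i (\<lambda>x::real^'a. c) = (\<lambda>x. 0)" for i
    using partial_deriv_eq[OF has_derivative_const] by auto
  with Suc show ?case by (simp add: k_times_differentiable_Suc)
qed (simp add: k_times_differentiable_0)

lemma smooth_mult: "smooth f \<Longrightarrow> smooth g \<Longrightarrow> smooth (\<lambda>x. f x * g x)"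
  by (simp add: smooth_iff k_times_differentiable_mult)

lemma smooth_prod: "(\<And>i. i \<in> I \<Longrightarrow> smooth (f i)) \<Longrightarrow> smooth (\<lambda>x. \<Prod>i\<in>I. f i x)"
  by (induction I rule: infinite_finite_induct)
     (auto simp: smooth_mult, auto simp: smooth_iff k_times_differentiable_const)

text \<open>
The sequence \<open>D\<close> supplies all derivatives of \<open>D 0\<close>, so each partial derivative of a
function of one coordinate is again of this form or zero.
\<close>
lemma smooth_of_coordinate:
  fixes D :: "nat \<Rightarrow> real \<Rightarrow> real"
  assumes D: "\<And>n t. (D n has_real_derivative D (Suc n) t) (at t)"
  shows "smooth (\<lambda>x::real^'n. D 0 (x $ i))"
proof -
  have d: "((\<lambda>x::real^'n. D m (x $ i)) has_derivative (\<lambda>h. D (Suc m) (x $ i) * h $ i)) (at x)" for m x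
    using has_derivative_compose[OF bounded_linear.has_derivative[OF bounded_linear_vec_nth has_derivative_ident]
        D[of m, unfolded has_field_derivative_def]]
    by (auto simp: o_def)
  have "k_times_differentiable k (\<lambda>x::real^'n. D m (x $ i))" for k m
  proof (induction k arbitrary: m)
    case 0
    then show ?case using d by (auto simp: k_times_differentiable_0 differentiable_def)
  next
    case (Suc k)
    have "partial_deriv j (\<lambda>x::real^'n. D m (x $ i)) = (\<lambda>x. D (Suc m) (x $ i) * (if i = j then 1 else 0))" for j
      using partial_deriv_eq[OF d, of j] by (auto simp: axis_def)
    moreover have "k_times_differentiable k (\<lambda>x. D (Suc m) (x $ i) * (if i = j then 1 else 0))" for j
      by (intro k_times_differentiable_mult Suc.IH k_times_differentiable_const)
    moreover have "(\<lambda>x::real^'n. D m (x $ i)) differentiable (at x)" for x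
      using d unfolding differentiable_def by blast
    ultimately show ?case
      by (simp add: k_times_differentiable_Suc)
  qed
  then show ?thesis by (simp add: smooth_iff)
qed

text \<open>
The functions \<open>q(1/t) exp(-1/t)\<close>, extended by zero to \<open>t \<le> 0\<close>. With an arbitrary polynomial \<open>q\<close> the
family is closed under differentiation; the case \<open>q = 1\<close> is the one of interest.
\<close>
definition flat_exp :: "real poly \<Rightarrow> real \<Rightarrow> real" where
  "flat_exp q t = (if t \<le> 0 then 0 else poly q (1 / t) * exp (- (1 / t)))"

lemma poly_div_exp_tendsto_0: "((\<lambda>s. poly q s * exp (- s)) \<longlongrightarrow> (0::real)) at_top"
proof -
  have "((\<lambda>s. \<Sum>i\<le>degree q. coeff q i * (s ^ i / exp s)) \<longlongrightarrow> (\<Sum>i\<le>degree q. coeff q i * (0::real))) at_top"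
    by (intro tendsto_intros tendsto_power_div_exp_0)
  then show ?thesis
    by (simp add: poly_altdef sum_distrib_right exp_minus divide_inverse mult.assoc)
qed

lemma flat_exp_at_right_0: "(flat_exp q \<longlongrightarrow> 0) (at_right 0)"
proof -
  have "((\<lambda>t. poly q (1 / t) * exp (- (1 / t))) \<longlongrightarrow> 0) (at_right 0)"
    using filterlim_compose[OF poly_div_exp_tendsto_0 filterlim_inverse_at_top_right, of q]
    by (simp add: inverse_eq_divide)
  moreover have "eventually (\<lambda>t. poly q (1 / t) * exp (- (1 / t)) = flat_exp q t) (at_right 0)"
    using eventually_at_right_less[of "0::real"] by eventually_elim (auto simp: flat_exp_def)
  ultimately show ?thesis
    by (rule Lim_transform_eventually)
qed

text \<open>
For \<open>t > 0\<close> this is the product rule, with \<open>t\<^sup>-\<^sup>2\<close> written as the value of \<open>[:0, 0, 1:]\<close> at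
\<open>1 / t\<close>. At \<open>t = 0\<close> the difference quotient is the member of the family with \<open>q\<close> multiplied by
the variable, which tends to zero.
\<close>
lemma flat_exp_deriv:
  "(flat_exp q has_real_derivative flat_exp ((q - pderiv q) * [:0, 0, 1:]) t) (at t)"
proof -
  consider "t < 0" | "t = 0" | "0 < t" by linarith
  then show ?thesis
  proof cases
    case 1
    have "((\<lambda>t. 0) has_real_derivative 0) (at t)" by simp
    moreover have "eventually (\<lambda>s. (0::real) = flat_exp q s) (nhds t)"
      using eventually_nhds_in_open[of "{..<0::real}" t] 1
      by (auto elim!: eventually_mono simp: flat_exp_def)
    ultimately show ?thesis
      using 1 by (subst (asm) DERIV_cong_ev[OF refl _ refl]) (auto simp: flat_exp_def)
  next
    case 2
    have "((\<lambda>h. flat_exp q h / h) \<longlongrightarrow> 0) (at_left 0)"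
      by (rule tendsto_eventually) (auto simp: eventually_at_filter flat_exp_def)
    moreover have "((\<lambda>h. flat_exp q h / h) \<longlongrightarrow> 0) (at_right 0)"
      using flat_exp_at_right_0[of "q * [:0, 1:]"]
      by (rule Lim_transform_eventually) (auto simp: eventually_at_filter flat_exp_def)
    ultimately have "((\<lambda>h. flat_exp q h / h) \<longlongrightarrow> 0) (at 0)"
      by (rule filterlim_split_at)
    then show ?thesis
      using 2 by (simp add: DERIV_def flat_exp_def)
  next
    case 3
    have "((\<lambda>t. poly q (1 / t) * exp (- (1 / t))) has_real_derivative
            poly ((q - pderiv q) * [:0, 0, 1:]) (1 / t) * exp (- (1 / t))) (at t)"
      using 3 by (auto intro!: derivative_eq_intros simp: field_simps power2_eq_square)
    moreover have "eventually (\<lambda>s. poly q (1 / s) * exp (- (1 / s)) = flat_exp q s) (nhds t)"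
      using eventually_nhds_in_open[of "{0<..}" t] 3
      by (auto elim!: eventually_mono simp: flat_exp_def)
    ultimately show ?thesis
      using 3 by (subst (asm) DERIV_cong_ev[OF refl _ refl]) (auto simp: flat_exp_def)
  qed
qed

lemma smooth_flat_exp: "smooth (\<lambda>x::real^'n. flat_exp 1 (c * x $ i + d))"
proof -
  define Q where "Q n = ((\<lambda>q. (q - pderiv q) * [:0, 0, 1::real:]) ^^ n) 1" for n
  define D where "D n t = c ^ n * flat_exp (Q n) (c * t + d)" for n t
  have "(D n has_real_derivative D (Suc n) t) (at t)" for n t
  proof -
    have "((\<lambda>t. flat_exp (Q n) (c * t + d)) has_real_derivative flat_exp (Q (Suc n)) (c * t + d) * c) (at t)"
      by (rule DERIV_chain2[of "flat_exp (Q n)"])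
         (auto intro!: derivative_eq_intros flat_exp_deriv[THEN DERIV_cong] simp: Q_def)
    then show ?thesis
      unfolding D_def by (auto intro!: derivative_eq_intros)
  qed
  from smooth_of_coordinate[of D i, OF this] show ?thesis
    by (simp add: D_def Q_def)
qed

text \<open>
The factor \<open>Suc k\<close> steepens the profile: since \<open>exp(-1/(k s))\<close> tends to \<open>1\<close> for \<open>s > 0\<close>, the bumps converge
pointwise to the indicator of the box, and they stay bounded by \<open>1\<close>.
\<close>
definition bump :: "real^'n \<Rightarrow> real^'n \<Rightarrow> nat \<Rightarrow> real^'n \<Rightarrow> real" where
  "bump a b k x =
     (\<Prod>i\<in>UNIV. flat_exp 1 (real (Suc k) * (x $ i - a $ i)) * flat_exp 1 (real (Suc k) * (b $ i - x $ i)))"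

lemma flat_exp_1_bounds: "0 \<le> flat_exp 1 t" "flat_exp 1 t \<le> 1" "flat_exp 1 t \<noteq> 0 \<longleftrightarrow> 0 < t"
  by (auto simp: flat_exp_def)

lemma bump_bounds: "0 \<le> bump a b k x" "bump a b k x \<le> 1"
  unfolding bump_def
  by (intro prod_nonneg prod_le_1 conjI mult_nonneg_nonneg mult_le_one flat_exp_1_bounds ballI)+

lemma bump_nonzero_iff: "bump a b k x \<noteq> 0 \<longleftrightarrow> x \<in> box a b"
proof -
  have "0 < real (Suc k) * s \<longleftrightarrow> 0 < s" for s :: real
    by (simp add: zero_less_mult_iff)
  then show ?thesis
    unfolding bump_def mem_box_cart using flat_exp_1_bounds(3) by simp
qed

lemma bump_tendsto: "(\<lambda>k. bump a b k x) \<longlonglongrightarrow> indicator (box a b) x"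
proof (cases "x \<in> box a b")
  case False
  then have "bump a b k x = 0" for k
    using bump_nonzero_iff by blast
  then show ?thesis using False by simp
next
  case True
  have 1: "(\<lambda>k. flat_exp 1 (real (Suc k) * s)) \<longlonglongrightarrow> 1" if "0 < s" for s
  proof -
    have "(\<lambda>k. exp (- (1 / s * inverse (real (Suc k))))) \<longlonglongrightarrow> exp (- (1 / s * 0))"
      by (intro tendsto_intros LIMSEQ_inverse_real_of_nat)
    moreover have "flat_exp 1 (real (Suc k) * s) = exp (- (1 / s * inverse (real (Suc k))))" for k
    proof -
      have "0 < real (Suc k) * s" using that by simp
      then show ?thesis using that by (simp only: flat_exp_def) (simp add: field_simps)
    qed
    ultimately show ?thesis by simp
  qed
  have "(\<lambda>k. bump a b k x) \<longlonglongrightarrow> (\<Prod>i\<in>(UNIV::'a set). 1 * 1)"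
    unfolding bump_def by (intro tendsto_prod tendsto_mult 1) (use True in \<open>auto simp: mem_box_cart\<close>)
  with True show ?thesis by simp
qed

lemma bump_test_function:
  assumes "cbox a b \<subseteq> \<Omega>"
  shows "bump a b k \<in> test_functions \<Omega>"
proof -
  have sm: "smooth (bump a b k)"
    unfolding bump_def[abs_def]
  proof (intro smooth_prod smooth_mult)
    fix i
    show "smooth (\<lambda>x. flat_exp 1 (real (Suc k) * (x $ i - a $ i)))"
      using smooth_flat_exp[of "real (Suc k)" i "- real (Suc k) * a $ i"] by (simp add: algebra_simps)
    show "smooth (\<lambda>x. flat_exp 1 (real (Suc k) * (b $ i - x $ i)))"
      using smooth_flat_exp[of "- real (Suc k)" i "real (Suc k) * b $ i"] by (simp add: algebra_simps)
  qed
  have eq: "{x. bump a b k x \<noteq> 0} = box a b"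
    using bump_nonzero_iff by blast
  have sub: "closure (box a b) \<subseteq> cbox a b"
    by (simp add: closure_minimal box_subset_cbox closed_cbox)
  then have "compact (closure (box a b))"
    by (metis bounded_box compact_closure)
  then show ?thesis
    using sm sub assms by (auto simp: test_functions_def eq)
qed

section \<open>Weak gradients are unique\<close>

definition grad :: "(real^'n \<Rightarrow> real) \<Rightarrow> real^'n \<Rightarrow> real^'n" where
  "grad f x = (\<chi> i. partial_deriv i f x)"

lemma grad_nth [simp]: "grad f x $ i = partial_deriv i f x"
  by (simp add: grad_def)

text \<open>
The class for which the analytic estimates are proved. It contains the test functions and is closed under
differences; \<open>K\<close> is allowed to be larger than the support, so that one compact set can serve a whole sequence.
\<close>
definition C1_supported :: "(real^'n) set \<Rightarrow> (real^'n \<Rightarrow> real) \<Rightarrow> (real^'n \<Rightarrow> real^'n) \<Rightarrow> bool" where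
  "C1_supported K f F \<longleftrightarrow> compact K \<and> (\<forall>x. (f has_derivative (\<lambda>h. F x \<bullet> h)) (at x)) \<and>
     continuous_on UNIV F \<and> (\<forall>x. x \<notin> K \<longrightarrow> f x = 0)"

lemma test_functions_C1_supported:
  assumes "\<phi> \<in> test_functions \<Omega>"
  shows "C1_supported (closure {x. \<phi> x \<noteq> 0}) \<phi> (grad \<phi>)"
  unfolding C1_supported_def
proof (intro conjI allI impI)
  have sm: "iter_partial js \<phi> differentiable (at x)" for js x
    using assms by (auto simp: test_functions_def smooth_def)
  show "compact (closure {x. \<phi> x \<noteq> 0})"
    using assms by (simp add: test_functions_def)
  show "(\<phi> has_derivative (\<lambda>h. grad \<phi> x \<bullet> h)) (at x)" for x
  proof -
    have d: "(\<phi> has_derivative frechet_derivative \<phi> (at x)) (at x)"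
      using sm[of "[]" x] by (simp add: frechet_derivative_works)
    then have lin: "linear (frechet_derivative \<phi> (at x))"
      by (rule has_derivative_linear)
    have "frechet_derivative \<phi> (at x) h = grad \<phi> x \<bullet> h" for h
    proof -
      have "frechet_derivative \<phi> (at x) h = frechet_derivative \<phi> (at x) (\<Sum>i\<in>UNIV. h $ i *\<^sub>R axis i 1)"
        using basis_expansion[of h] by (simp add: scalar_mult_eq_scaleR)
      also have "\<dots> = (\<Sum>i\<in>UNIV. h $ i * partial_deriv i \<phi> x)"
        by (simp add: linear_sum[OF lin] linear_cmul[OF lin] partial_deriv_def)
      finally show ?thesis by (simp add: inner_vec_def mult.commute)
    qed
    then show ?thesis using d by presburger
  qed
  have "continuous_on UNIV (\<lambda>x. grad \<phi> x $ i)" for i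
    using sm[of "[i]"] by (auto intro!: continuous_at_imp_continuous_on differentiable_imp_continuous_within)
  then have "continuous_on UNIV (\<lambda>x. \<chi> i. grad \<phi> x $ i)"
    by (rule continuous_on_vec_lambda)
  then show "continuous_on UNIV (grad \<phi>)"
    by (simp add: grad_def[abs_def])
  show "\<phi> x = 0" if "x \<notin> closure {x. \<phi> x \<noteq> 0}" for x
    using that closure_subset[of "{x. \<phi> x \<noteq> 0}"] by blast
qed

lemma C1_supported_compact: "C1_supported K f F \<Longrightarrow> compact K"
  and C1_supported_deriv: "C1_supported K f F \<Longrightarrow> (f has_derivative (\<lambda>h. F x \<bullet> h)) (at x)"
  and C1_supported_zero: "C1_supported K f F \<Longrightarrow> x \<notin> K \<Longrightarrow> f x = 0"
  and C1_supported_continuous_grad: "C1_supported K f F \<Longrightarrow> continuous_on UNIV F"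
  unfolding C1_supported_def by blast+

lemma C1_supported_continuous:
  assumes "C1_supported K f F"
  shows "continuous_on UNIV f"
  using has_derivative_continuous[OF C1_supported_deriv[OF assms]]
  by (simp add: continuous_at_imp_continuous_on)

lemma C1_supported_grad_zero:
  assumes "C1_supported K f F" "x \<notin> K"
  shows "F x = 0"
proof -
  have "open (- K)"
    using C1_supported_compact[OF assms(1)] by (simp add: compact_imp_closed open_Compl)
  then have "(f has_derivative (\<lambda>h. 0)) (at x)"
    by (rule has_derivative_transform_within_open[of "\<lambda>x. 0" "\<lambda>h. 0" x UNIV "- K", OF has_derivative_const])
       (use assms C1_supported_zero[OF assms(1)] in auto)
  then have "(\<lambda>h. F x \<bullet> h) = (\<lambda>h. 0)"
    by (rule has_derivative_unique[OF C1_supported_deriv[OF assms(1)]])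
  then have "F x \<bullet> F x = 0" by meson
  then show ?thesis by simp
qed

lemma C1_supported_mono: "C1_supported K f F \<Longrightarrow> K \<subseteq> K' \<Longrightarrow> compact K' \<Longrightarrow> C1_supported K' f F"
  by (auto simp: C1_supported_def)

lemma C1_supported_diff:
  assumes "C1_supported K f F" "C1_supported K g G"
  shows "C1_supported K (\<lambda>x. f x - g x) (\<lambda>x. F x - G x)"
  unfolding C1_supported_def inner_diff_left
  using assms by (auto simp: C1_supported_def intro!: has_derivative_diff continuous_on_diff)

lemma C1_supported_mult:
  assumes "C1_supported K f F" "C1_supported L g G"
  shows "C1_supported K (\<lambda>x. f x * g x) (\<lambda>x. f x *\<^sub>R G x + g x *\<^sub>R F x)"
  unfolding C1_supported_def
proof (intro conjI allI impI)
  show "compact K" by (rule C1_supported_compact[OF assms(1)])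
  show "((\<lambda>x. f x * g x) has_derivative (\<lambda>h. (f x *\<^sub>R G x + g x *\<^sub>R F x) \<bullet> h)) (at x)" for x
    using has_derivative_mult[OF C1_supported_deriv[OF assms(1)] C1_supported_deriv[OF assms(2)], of x]
    by (simp add: inner_add_left mult.commute)
  show "continuous_on UNIV (\<lambda>x. f x *\<^sub>R G x + g x *\<^sub>R F x)"
    by (intro continuous_on_add continuous_on_scaleR C1_supported_continuous[OF assms(1)]
        C1_supported_continuous[OF assms(2)] C1_supported_continuous_grad[OF assms(1)]
        C1_supported_continuous_grad[OF assms(2)])
  show "f x * g x = 0" if "x \<notin> K" for x
    using C1_supported_zero[OF assms(1) that] by simp
qed

lemma integrable_continuous_supported:
  fixes f :: "'a::euclidean_space \<Rightarrow> 'b::{banach, second_countable_topology}"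
  assumes "compact K" "continuous_on UNIV f" "\<And>x. x \<notin> K \<Longrightarrow> f x = 0"
  shows "integrable lborel f"
proof -
  have "integrable lborel (\<lambda>x. indicator K x *\<^sub>R f x)"
    by (rule borel_integrable_compact[OF assms(1) continuous_on_subset[OF assms(2)]]) simp
  moreover have "(\<lambda>x. indicator K x *\<^sub>R f x) = f"
    using assms(3) by (auto simp: indicator_def)
  ultimately show ?thesis by simp
qed

lemma continuous_supported_bounded:
  fixes f :: "'a::euclidean_space \<Rightarrow> 'b::real_normed_vector"
  assumes "compact K" "continuous_on UNIV f" "\<And>x. x \<notin> K \<Longrightarrow> f x = 0"
  obtains B where "0 < B" "\<And>x. norm (f x) \<le> B"
proof -
  have "bounded (f ` K)"
    using assms by (meson compact_continuous_image compact_imp_bounded continuous_on_subset subset_UNIV)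
  then obtain B where "0 < B" "\<forall>y\<in>f ` K. norm y \<le> B"
    by (auto simp: bounded_pos)
  then show ?thesis
    using that[of B] assms(3) by (metis image_eqI less_imp_le norm_zero)
qed

lemma lebesgue_on_integral_eq_lborel:
  fixes f :: "'a::euclidean_space \<Rightarrow> 'b::{banach, second_countable_topology}"
  assumes "S \<in> sets lebesgue" "f \<in> borel_measurable borel" "\<And>x. x \<notin> S \<Longrightarrow> f x = 0"
  shows "integrable (lebesgue_on S) f \<longleftrightarrow> integrable lborel f"
    and "(\<integral>x. f x \<partial>lebesgue_on S) = (LBINT x. f x)"
proof -
  have "(\<lambda>x. indicator S x *\<^sub>R f x) = f"
    using assms(3) by (auto simp: indicator_def)
  moreover have "f \<in> borel_measurable lborel" using assms by simp
  ultimately show "integrable (lebesgue_on S) f \<longleftrightarrow> integrable lborel f"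
    "(\<integral>x. f x \<partial>lebesgue_on S) = (LBINT x. f x)"
    using assms(1) by (simp_all add: integrable_restrict_space integral_restrict_space
        integrable_completion integral_completion)
qed

lemma lebesgue_on_integral_restrict:
  fixes f :: "'a::euclidean_space \<Rightarrow> real"
  assumes "S \<in> sets lebesgue" "K \<in> sets lebesgue" "K \<subseteq> S" "\<And>x. x \<notin> K \<Longrightarrow> \<phi> x = 0"
  shows "integrable (lebesgue_on S) (\<lambda>x. f x * \<phi> x) \<longleftrightarrow> integrable lebesgue (\<lambda>x. (indicator K x * f x) * \<phi> x)"
    and "(\<integral>x. f x * \<phi> x \<partial>lebesgue_on S) = (\<integral>x. (indicator K x * f x) * \<phi> x \<partial>lebesgue)"
proof -
  have "(\<lambda>x. indicator S x *\<^sub>R (f x * \<phi> x)) = (\<lambda>x. (indicator K x * f x) * \<phi> x)"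
    using assms(3,4) by (auto simp: indicator_def fun_eq_iff)
  then show "integrable (lebesgue_on S) (\<lambda>x. f x * \<phi> x) \<longleftrightarrow> integrable lebesgue (\<lambda>x. (indicator K x * f x) * \<phi> x)"
    "(\<integral>x. f x * \<phi> x \<partial>lebesgue_on S) = (\<integral>x. (indicator K x * f x) * \<phi> x \<partial>lebesgue)"
    using assms(1) by (simp_all add: integrable_restrict_space integral_restrict_space)
qed

lemma locally_integrable_compact:
  fixes f :: "real^'n \<Rightarrow> real"
  assumes "locally_integrable \<Omega> f" "compact K" "K \<subseteq> \<Omega>"
  shows "integrable lebesgue (\<lambda>x. indicator K x * f x)"
proof -
  have "integrable (lebesgue_on K) f"
    using assms by (auto simp: locally_integrable_def)
  moreover have "K \<in> sets lebesgue"
    using assms(2) by (simp add: borel_compact)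
  ultimately show ?thesis
    by (simp add: integrable_restrict_space)
qed

lemma locally_integrable_test_integrable:
  fixes f :: "real^'n \<Rightarrow> real"
  assumes f: "locally_integrable \<Omega> f" and \<phi>: "\<phi> \<in> test_functions \<Omega>" and \<Omega>: "open \<Omega>"
  shows "integrable (lebesgue_on \<Omega>) (\<lambda>x. f x * \<phi> x)"
proof -
  let ?K = "closure {x. \<phi> x \<noteq> 0}"
  note C = test_functions_C1_supported[OF \<phi>]
  have K: "compact ?K" "?K \<subseteq> \<Omega>"
    using \<phi> by (auto simp: test_functions_def)
  obtain B where B: "0 < B" "\<And>x. norm (\<phi> x) \<le> B"
    using continuous_supported_bounded[OF K(1) C1_supported_continuous[OF C] C1_supported_zero[OF C]] by blast
  have [measurable]: "\<phi> \<in> borel_measurable lebesgue"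
    using C1_supported_continuous[OF C]
    by (intro measurable_completion) (auto intro: borel_measurable_continuous_onI)
  have i: "integrable lebesgue (\<lambda>x. indicator ?K x * f x)"
    by (rule locally_integrable_compact[OF f K])
  then have [measurable]: "(\<lambda>x. indicator ?K x * f x) \<in> borel_measurable lebesgue"
    by auto
  have "integrable lebesgue (\<lambda>x. (indicator ?K x * f x) * \<phi> x)"
  proof (rule Bochner_Integration.integrable_bound)
    show "integrable lebesgue (\<lambda>x. B * (indicator ?K x * f x))"
      using i by simp
    show "AE x in lebesgue. norm ((indicator ?K x * f x) * \<phi> x) \<le> norm (B * (indicator ?K x * f x))"
      using B by (auto simp: abs_mult mult.commute[of B] intro!: mult_left_mono)
  qed measurable
  moreover have "\<Omega> \<in> sets lebesgue" "?K \<in> sets lebesgue"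
    using \<Omega> by (auto simp: borel_open borel_compact)
  ultimately show ?thesis
    using lebesgue_on_integral_restrict(1)[of \<Omega> ?K \<phi> f] K(2) C1_supported_zero[OF C] by blast
qed

text \<open>
After replacing \<open>f\<close> by a Borel function \<open>g\<close>, the Borel sets over which the integral of \<open>g\<close>
vanishes form a Dynkin system containing the boxes, an intersection-stable generator.
\<close>
lemma integrable_zero_of_boxes:
  fixes f :: "'a::euclidean_space \<Rightarrow> real"
  assumes f: "integrable lebesgue f" and box: "\<And>a b. (\<integral>x. f x * indicator (box a b) x \<partial>lebesgue) = 0"
  shows "AE x in lebesgue. f x = 0"
proof -
  obtain g where g[measurable]: "g \<in> borel_measurable lborel" and fg: "AE x in lborel. f x = g x"
    using completion_ex_borel_measurable_real[of f lborel] f by auto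
  have AEl: "AE x in lebesgue. f x = g x"
    by (rule AE_completion[OF fg])
  have gl: "g \<in> borel_measurable lebesgue"
    by (rule measurable_completion[OF g])
  have "integrable lebesgue g"
    using f AEl gl integrable_cong_AE[of f lebesgue g] by auto
  then have gi: "integrable lborel g"
    using g by (simp add: integrable_completion)
  have boxg: "(LBINT x. indicator (box a b) x * g x) = 0" for a b
  proof -
    have "(LBINT x. indicator (box a b) x * g x) = (\<integral>x. indicator (box a b) x * g x \<partial>lebesgue)"
      by (rule integral_completion[symmetric]) measurable
    also have "\<dots> = (\<integral>x. f x * indicator (box a b) x \<partial>lebesgue)"
    proof (rule integral_cong_AE)
      have [measurable]: "f \<in> borel_measurable lebesgue" "box a b \<in> sets lebesgue" "g \<in> borel_measurable lebesgue"
        using f gl by auto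
      show "(\<lambda>x. indicator (box a b) x * g x) \<in> borel_measurable lebesgue"
        "(\<lambda>x. f x * indicator (box a b) x) \<in> borel_measurable lebesgue"
        by measurable
      show "AE x in lebesgue. indicator (box a b) x * g x = f x * indicator (box a b) x"
        using AEl by eventually_elim simp
    qed
    finally show ?thesis using box by simp
  qed
  have indi: "integrable lborel (\<lambda>x. indicator A x * g x)" if "A \<in> sets borel" for A
    using integrable_mult_indicator[OF _ gi, of A] that by simp
  \<comment> \<open>The whole space is an increasing union of boxes; this settles complements in the induction below.\<close>
  have gtot: "(LBINT x. g x) = 0"
  proof -
    define B where "B n = box (- (real n *\<^sub>R One)) (real n *\<^sub>R One :: 'a)" for n
    have "(\<lambda>n. LBINT x. indicator (B n) x * g x) \<longlonglongrightarrow> (LBINT x. g x)"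
    proof (rule integral_dominated_convergence)
      show "integrable lborel (\<lambda>x. \<bar>g x\<bar>)" using gi by auto
      show "AE x in lborel. (\<lambda>n. indicator (B n) x * g x) \<longlonglongrightarrow> g x"
      proof (rule AE_I2)
        fix x :: 'a
        obtain N where N: "x \<in> B N"
          unfolding B_def using UN_box_eq_UNIV[where 'a='a] by blast
        have "B N \<subseteq> B n" if "N \<le> n" for n
          using that unfolding B_def by (auto simp: mem_box intro: less_le_trans le_less_trans)
             (smt (verit) of_nat_mono)+
        then have "eventually (\<lambda>n. indicator (B n) x * g x = g x) sequentially"
          using N by (intro eventually_sequentiallyI[of N]) (auto simp: indicator_def)
        then show "(\<lambda>n. indicator (B n) x * g x) \<longlonglongrightarrow> g x"
          by (rule tendsto_eventually)
      qed
    qed (auto simp: indicator_def B_def)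
    moreover have "(LBINT x. indicator (B n) x * g x) = 0" for n
      unfolding B_def by (rule boxg)
    ultimately show ?thesis
      by (simp add: LIMSEQ_const_iff)
  qed
  let ?G = "range (\<lambda>(a, b). box a b :: 'a set)"
  have ss: "sets borel = sigma_sets UNIV ?G"
    by (subst borel_eq_box) simp
  have all: "(LBINT x. indicator A x * g x) = 0" if "A \<in> sets borel" for A
  proof -
    have "Int_stable ?G"
      by (auto simp: Int_stable_def box_Int_box)
    moreover have "?G \<subseteq> Pow UNIV" by simp
    moreover have "A \<in> sigma_sets UNIV ?G" using that ss by simp
    ultimately show ?thesis
    proof (induction rule: sigma_sets_induct_disjoint)
      case (basic A)
      then show ?case using boxg by auto
    next
      case empty
      then show ?case by simp
    next
      case (compl A)
      then have A: "A \<in> sets borel" using ss by simp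
      have "(LBINT x. indicator (UNIV - A) x * g x) = (LBINT x. g x - indicator A x * g x)"
        by (rule Bochner_Integration.integral_cong) (auto simp: indicator_def)
      also have "\<dots> = 0"
        using gi indi[OF A] compl gtot by simp
      finally show ?case .
    next
      case (union A)
      then have A: "A i \<in> sets borel" for i using ss by auto
      have "(\<lambda>n. LBINT x. indicator (\<Union>i<n. A i) x * g x) \<longlonglongrightarrow> (LBINT x. indicator (\<Union>i. A i) x * g x)"
      proof (rule integral_dominated_convergence)
        show "integrable lborel (\<lambda>x. \<bar>g x\<bar>)" using gi by auto
        show "AE x in lborel. (\<lambda>n. indicator (\<Union>i<n. A i) x * g x) \<longlonglongrightarrow> indicator (\<Union>i. A i) x * g x"
          by (intro AE_I2 tendsto_mult tendsto_const LIMSEQ_indicator_UN)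
      qed (use A in \<open>auto simp: indicator_def\<close>)
      moreover have "(LBINT x. indicator (\<Union>i<n. A i) x * g x) = 0" for n
      proof -
        have "(LBINT x. indicator (\<Union>i<n. A i) x * g x) = (LBINT x. (\<Sum>i<n. indicator (A i) x * g x))"
        proof (rule Bochner_Integration.integral_cong)
          fix x
          have "indicator (\<Union>i<n. A i) x = (\<Sum>i<n. indicator (A i) x :: real)"
            using union(1) by (intro indicator_UN_disjoint) (auto intro: disjoint_family_on_mono)
          then show "indicator (\<Union>i<n. A i) x * g x = (\<Sum>i<n. indicator (A i) x * g x)"
            by (simp add: sum_distrib_right)
        qed simp
        also have "\<dots> = (\<Sum>i<n. LBINT x. indicator (A i) x * g x)"
          using A indi by (intro Bochner_Integration.integral_sum) auto
        finally show ?thesis using union by simp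
      qed
      ultimately show ?case
        by (simp add: LIMSEQ_const_iff)
    qed
  qed
  have "AE x in lborel. g x = 0"
    by (rule sigma_finite_measure.density_zero[OF sigma_finite_lborel gi]) (use all in \<open>auto simp: set_lebesgue_integral_def\<close>)
  then have "AE x in lebesgue. g x = 0"
    by (rule AE_completion)
  with AEl show ?thesis by eventually_elim auto
qed

text \<open>
Testing with bumps that converge to the indicator of a box shows that \<open>f\<close> has integral zero over each box
whose closure lies in \<open>\<Omega>\<close>; hence \<open>f\<close> vanishes on each closed box in \<open>\<Omega>\<close>, and countably many of these cover \<open>\<Omega>\<close>.
\<close>
theorem fundamental_lemma:
  fixes f :: "real^'n \<Rightarrow> real"
  assumes \<Omega>: "open \<Omega>" and f: "locally_integrable \<Omega> f"
    and test: "\<And>\<phi>. \<phi> \<in> test_functions \<Omega> \<Longrightarrow> (\<integral>x. f x * \<phi> x \<partial>lebesgue_on \<Omega>) = 0"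
  shows "AE x in lebesgue_on \<Omega>. f x = 0"
proof -
  have \<Omega>l: "\<Omega> \<in> sets lebesgue" using \<Omega> by (simp add: borel_open)
  have boxes: "(\<integral>x. f x * indicator (box a b) x \<partial>lebesgue) = 0" if sub: "cbox a b \<subseteq> \<Omega>" for a b
  proof -
    define h where "h x = indicator (cbox a b) x * f x" for x
    have i: "integrable lebesgue h"
      unfolding h_def by (rule locally_integrable_compact[OF f compact_cbox sub])
    have [measurable]: "box a b \<in> sets lebesgue" by simp
    from i have [measurable]: "h \<in> borel_measurable lebesgue" by auto
    have bt: "bump a b k \<in> test_functions \<Omega>" for k
      by (rule bump_test_function[OF sub])
    have [measurable]: "bump a b k \<in> borel_measurable lebesgue" for k
      using C1_supported_continuous[OF test_functions_C1_supported[OF bt]]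
      by (intro measurable_completion) (auto intro: borel_measurable_continuous_onI)
    have "(\<lambda>k. \<integral>x. h x * bump a b k x \<partial>lebesgue) \<longlonglongrightarrow> (\<integral>x. h x * indicator (box a b) x \<partial>lebesgue)"
    proof (rule integral_dominated_convergence)
      show "integrable lebesgue (\<lambda>x. \<bar>h x\<bar>)" using i by (rule integrable_abs)
      show "AE x in lebesgue. (\<lambda>k. h x * bump a b k x) \<longlonglongrightarrow> h x * indicator (box a b) x"
        by (intro AE_I2 tendsto_mult tendsto_const bump_tendsto)
      show "AE x in lebesgue. norm (h x * bump a b k x) \<le> \<bar>h x\<bar>" for k
        using bump_bounds[of a b k] by (auto simp: abs_mult intro!: mult_left_le)
    qed measurable
    moreover have "(\<integral>x. h x * bump a b k x \<partial>lebesgue) = 0" for k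
    proof -
      have "(\<integral>x. h x * bump a b k x \<partial>lebesgue) = (\<integral>x. f x * bump a b k x \<partial>lebesgue_on \<Omega>)"
        unfolding h_def using sub \<Omega>l bump_nonzero_iff[of a b k] box_subset_cbox[of a b]
        by (intro lebesgue_on_integral_restrict(2)[symmetric]) auto
      then show ?thesis using test[OF bt] by simp
    qed
    ultimately have "(\<integral>x. h x * indicator (box a b) x \<partial>lebesgue) = 0"
      by (simp add: LIMSEQ_const_iff)
    moreover have "(\<lambda>x. h x * indicator (box a b) x) = (\<lambda>x. f x * indicator (box a b) x)"
      using box_subset_cbox[of a b] by (auto simp: indicator_def h_def fun_eq_iff)
    ultimately show ?thesis by simp
  qed
  \<comment> \<open>Intersecting with another box gives a box whose closure still lies in \<open>\<Omega>\<close>; the boundary of the box is a null set.\<close>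
  have AEbox: "AE x in lebesgue. x \<in> cbox a b \<longrightarrow> f x = 0" if sub: "cbox a b \<subseteq> \<Omega>" for a b
  proof -
    define h where "h x = indicator (cbox a b) x * f x" for x
    have "AE x in lebesgue. h x = 0"
    proof (rule integrable_zero_of_boxes)
      show gi: "integrable lebesgue h"
        unfolding h_def by (rule locally_integrable_compact[OF f compact_cbox sub])
      fix c d :: "real^'n"
      obtain u v where uv: "box a b \<inter> box c d = box u v" "cbox a b \<inter> cbox c d = cbox u v"
        using box_Int_box[of a b c d] Int_interval[of a b c d] by blast
      have "(\<integral>x. h x * indicator (box c d) x \<partial>lebesgue) = (\<integral>x. f x * indicator (box u v) x \<partial>lebesgue)"
      proof (rule integral_cong_AE)
        show m: "(\<lambda>x. h x * indicator (box c d) x) \<in> borel_measurable lebesgue"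
          using gi by (intro borel_measurable_times borel_measurable_indicator) auto
        have "cbox a b - box a b \<in> null_sets lebesgue"
          using negligible_frontier_interval negligible_iff_null_sets by blast
        then have "AE x in lebesgue. x \<notin> cbox a b - box a b"
          by (rule AE_not_in)
        then show ae: "AE x in lebesgue. h x * indicator (box c d) x = f x * indicator (box u v) x"
          by eventually_elim (use uv(1) box_subset_cbox[of a b] in \<open>auto simp: indicator_def h_def\<close>)
        show "(\<lambda>x. f x * indicator (box u v) x) \<in> borel_measurable lebesgue"
          by (rule borel_measurable_AE[OF m ae])
      qed
      also have "\<dots> = 0"
        using boxes[of u v] uv(2) sub by blast
      finally show "(\<integral>x. h x * indicator (box c d) x \<partial>lebesgue) = 0" .
    qed
    then show ?thesis by eventually_elim (auto simp: h_def)
  qed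
  obtain D where D: "countable D" "D \<subseteq> Pow \<Omega>" "\<And>X. X \<in> D \<Longrightarrow> \<exists>a b. X = cbox a b" "\<Union>D = \<Omega>"
    using open_countable_Union_open_cbox[OF \<Omega>] by metis
  have "AE x in lebesgue. \<forall>X\<in>D. x \<in> X \<longrightarrow> f x = 0"
    unfolding AE_ball_countable[OF D(1)] using D(2,3) AEbox by (metis PowD subsetD)
  then have "AE x in lebesgue. x \<in> \<Omega> \<longrightarrow> f x = 0"
    by eventually_elim (use D(4) in blast)
  then show ?thesis
    using \<Omega>l by (simp add: AE_restrict_space_iff)
qed

lemma locally_integrable_component:
  assumes "locally_integrable \<Omega> G"
  shows "locally_integrable \<Omega> (\<lambda>x. G x $ i :: real)"
  using assms integrable_bounded_linear[OF bounded_linear_vec_nth]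
  by (auto simp: locally_integrable_def)

theorem has_weak_gradient_unique:
  assumes \<Omega>: "open \<Omega>" and G: "has_weak_gradient \<Omega> u G" and H: "has_weak_gradient \<Omega> u H"
  shows "AE x in lebesgue_on \<Omega>. G x = H x"
proof -
  have "AE x in lebesgue_on \<Omega>. G x $ i - H x $ i = 0" for i
  proof (rule fundamental_lemma[OF \<Omega>])
    have l: "locally_integrable \<Omega> (\<lambda>x. G x $ i)" "locally_integrable \<Omega> (\<lambda>x. H x $ i)"
      using G H by (auto simp: has_weak_gradient_def intro: locally_integrable_component)
    then show "locally_integrable \<Omega> (\<lambda>x. G x $ i - H x $ i)"
      by (auto simp: locally_integrable_def)
    fix \<phi> assume \<phi>: "\<phi> \<in> test_functions \<Omega>"
    have "(\<integral>x. (G x $ i - H x $ i) * \<phi> x \<partial>lebesgue_on \<Omega>) =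
          (\<integral>x. G x $ i * \<phi> x \<partial>lebesgue_on \<Omega>) - (\<integral>x. H x $ i * \<phi> x \<partial>lebesgue_on \<Omega>)"
      using l[THEN locally_integrable_test_integrable, OF \<phi> \<Omega>] by (simp add: left_diff_distrib)
    also have "\<dots> = 0"
      using G H \<phi> by (simp add: has_weak_gradient_def)
    finally show "(\<integral>x. (G x $ i - H x $ i) * \<phi> x \<partial>lebesgue_on \<Omega>) = 0" .
  qed
  then have "AE x in lebesgue_on \<Omega>. \<forall>i. G x $ i = H x $ i"
    by (simp add: AE_all_countable)
  then show ?thesis
    by (simp add: vec_eq_iff)
qed

section \<open>Translation estimate and Poincare inequality for continuously differentiable functions\<close>

lemma lborel_integral_translation:
  fixes f :: "'a::euclidean_space \<Rightarrow> 'b::{banach, second_countable_topology}"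
  assumes [measurable]: "f \<in> borel_measurable borel"
  shows "(LBINT x. f (x + h)) = (LBINT x. f x)"
    and "integrable lborel (\<lambda>x. f (x + h)) \<longleftrightarrow> integrable lborel f"
proof -
  have "(\<integral>x. f x \<partial>distr lborel borel ((+) h)) = (LBINT x. f (h + x))"
    by (intro integral_distr) auto
  then show "(LBINT x. f (x + h)) = (LBINT x. f x)"
    by (simp add: lborel_distr_plus add.commute)
  have "integrable (distr lborel borel ((+) h)) f \<longleftrightarrow> integrable lborel (\<lambda>x. f (h + x))"
    by (intro integrable_distr_eq) auto
  then show "integrable lborel (\<lambda>x. f (x + h)) \<longleftrightarrow> integrable lborel f"
    by (simp add: lborel_distr_plus add.commute)
qed

text \<open>
The power mean inequality up to the factor \<open>2\<^sup>p\<close>. With \<open>A\<close> the mean of \<open>s\<close>, integrate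
\<open>A\<^sup>p\<^sup>-\<^sup>1 s \<le> A\<^sup>p / 2 + 2\<^sup>p\<^sup>-\<^sup>1 s\<^sup>p\<close> and absorb the term \<open>A\<^sup>p / 2\<close>. It is used both for counting measure on
finite sets and for Lebesgue measure on balls.
\<close>
lemma power_mean_le:
  fixes s :: "'a \<Rightarrow> real"
  assumes p: "1 \<le> p" and fin: "finite_measure M" and m: "0 < measure M (space M)"
    and i: "integrable M s" "integrable M (\<lambda>x. s x powr p)" and s: "\<And>x. 0 \<le> s x"
  shows "(\<integral>x. s x \<partial>M) powr p \<le> 2 powr p * measure M (space M) powr (p - 1) * (\<integral>x. s x powr p \<partial>M)"
proof -
  interpret finite_measure M by fact
  define V where "V = measure M (space M)"
  define A where "A = (\<integral>x. s x \<partial>M) / V"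
  have V: "0 < V" using m by (simp add: V_def)
  have A0: "0 \<le> A" using s V by (simp add: A_def)
  have "(\<integral>x. A powr (p - 1) * s x \<partial>M) \<le> (\<integral>x. (1/2) * A powr p + (1/2) powr (1 - p) * s x powr p \<partial>M)"
    using i Young_powr_eps[OF A0 s, of "1/2" p] p by (intro integral_mono) auto
  then have a: "A powr (p - 1) * (V * A) \<le> (1/2) * A powr p * V + (1/2) powr (1 - p) * (\<integral>x. s x powr p \<partial>M)"
    using i V by (simp add: A_def V_def mult.commute)
  have b: "A powr (p - 1) * (V * A) = V * A powr p"
    using A0 by (cases "A = 0") (auto simp: powr_diff)
  have c: "(1/2::real) powr (1 - p) = 2 powr p / 2"
    by (simp add: powr_divide powr_diff)
  have "V * A powr p \<le> 2 powr p * (\<integral>x. s x powr p \<partial>M)"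
    using a unfolding b c by (simp add: field_simps)
  then have "V powr (p - 1) * (V * A powr p) \<le> V powr (p - 1) * (2 powr p * (\<integral>x. s x powr p \<partial>M))"
    by (intro mult_left_mono) auto
  moreover have "V powr (p - 1) * (V * A powr p) = (V * A) powr p"
    using V A0 by (simp add: powr_mult powr_diff)
  moreover have "V * A = (\<integral>x. s x \<partial>M)"
    using V by (simp add: A_def)
  ultimately show ?thesis
    by (simp add: V_def mult_ac)
qed

lemma C1_supported_Lipschitz:
  assumes C: "C1_supported K f F"
  obtains B where "0 < B" "\<And>x. norm (F x) \<le> B" "\<And>x y. \<bar>f y - f x\<bar> \<le> B * norm (y - x)"
proof -
  obtain B where B: "0 < B" "\<And>x. norm (F x) \<le> B"
    using continuous_supported_bounded[OF C1_supported_compact[OF C] C1_supported_continuous_grad[OF C]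
        C1_supported_grad_zero[OF C]] by blast
  have "norm (f y - f x) \<le> B * norm (y - x)" for x y
  proof (rule differentiable_bound[of UNIV f "\<lambda>x h. F x \<bullet> h"])
    show "onorm (\<lambda>h. F z \<bullet> h) \<le> B" for z
    proof (rule onorm_le)
      fix h
      have "norm (F z \<bullet> h) \<le> norm (F z) * norm h"
        using Cauchy_Schwarz_ineq2 by auto
      also have "\<dots> \<le> B * norm h"
        using B(2) by (intro mult_right_mono) auto
      finally show "norm (F z \<bullet> h) \<le> B * norm h" .
    qed
  qed (use C1_supported_deriv[OF C] in auto)
  with B show ?thesis using that[of B] by simp
qed

text \<open>
Translating a function supported in \<open>K\<close> by at most \<open>r\<close> keeps its support in this set.
\<close>
definition thicken :: "'a::real_normed_vector set \<Rightarrow> real \<Rightarrow> 'a set" where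
  "thicken K r = {x + y | x y. x \<in> K \<and> y \<in> cball 0 r}"

lemma compact_thicken: "compact K \<Longrightarrow> compact (thicken K r)" for K :: "'a::euclidean_space set"
  unfolding thicken_def by (intro compact_sums compact_cball)

lemma not_in_thicken:
  assumes "x \<notin> thicken K r" "norm h \<le> r"
  shows "x + h \<notin> K"
proof
  assume "x + h \<in> K"
  then have "(x + h) + (- h) \<in> thicken K r"
    unfolding thicken_def using assms(2) by (intro CollectI exI[of _ "x + h"] exI[of _ "- h"]) auto
  then show False using assms(1) by simp
qed

lemma difference_quotient:
  assumes C: "C1_supported K f F"
  obtains B where "0 < B"
    "\<And>n x. \<bar>real (Suc n) * (f (x + (1 / real (Suc n)) *\<^sub>R h) - f x)\<bar> \<le> B * indicator (thicken K (norm h)) x"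
    "\<And>x. (\<lambda>n. real (Suc n) * (f (x + (1 / real (Suc n)) *\<^sub>R h) - f x)) \<longlonglongrightarrow> F x \<bullet> h"
proof -
  obtain B where B: "0 < B" "\<And>x. norm (F x) \<le> B" "\<And>x y. \<bar>f y - f x\<bar> \<le> B * norm (y - x)"
    using C1_supported_Lipschitz[OF C] by blast
  have b: "\<bar>real (Suc n) * (f (x + (1 / real (Suc n)) *\<^sub>R h) - f x)\<bar> \<le> (B * norm h + 1) * indicator (thicken K (norm h)) x" for n x
  proof (cases "x \<in> thicken K (norm h)")
    case True
    have "\<bar>real (Suc n) * (f (x + (1 / real (Suc n)) *\<^sub>R h) - f x)\<bar>
       = real (Suc n) * \<bar>f (x + (1 / real (Suc n)) *\<^sub>R h) - f x\<bar>"
      by (simp add: abs_mult)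
    also have "\<dots> \<le> real (Suc n) * (B * norm ((x + (1 / real (Suc n)) *\<^sub>R h) - x))"
      by (intro mult_left_mono B) auto
    also have "\<dots> = B * norm h" by simp
    finally show ?thesis using True by simp
  next
    case False
    have "norm ((1 / real (Suc n)) *\<^sub>R h) \<le> norm h"
      by (simp add: mult_left_le_one_le divide_le_eq mult_left_mono field_simps)
    then have "x + (1 / real (Suc n)) *\<^sub>R h \<notin> K"
      by (rule not_in_thicken[OF False])
    moreover have "x \<notin> K"
      using not_in_thicken[OF False, of 0] by simp
    ultimately show ?thesis
      using False C1_supported_zero[OF C] by simp
  qed
  have l: "(\<lambda>n. real (Suc n) * (f (x + (1 / real (Suc n)) *\<^sub>R h) - f x)) \<longlonglongrightarrow> F x \<bullet> h" for x
  proof -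
    have "((\<lambda>t. f (x + t *\<^sub>R h)) has_derivative (\<lambda>t. F x \<bullet> (t *\<^sub>R h))) (at 0)"
      by (rule has_derivative_compose[of "\<lambda>t. x + t *\<^sub>R h" "\<lambda>t. t *\<^sub>R h" 0 UNIV f])
         (use C1_supported_deriv[OF C, of x] in \<open>auto intro!: derivative_eq_intros\<close>)
    then have "((\<lambda>t. f (x + t *\<^sub>R h)) has_real_derivative (F x \<bullet> h)) (at 0)"
      by (simp add: has_field_derivative_def mult.commute[of _ "F x \<bullet> h"])
    then have "((\<lambda>t. (f (x + t *\<^sub>R h) - f x) / t) \<longlongrightarrow> F x \<bullet> h) (at 0)"
      by (simp add: DERIV_def)
    moreover have "filterlim (\<lambda>n. inverse (real (Suc n))) (at 0) sequentially"
      using LIMSEQ_inverse_real_of_nat by (auto simp: filterlim_at)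
    ultimately have "(\<lambda>n. (f (x + inverse (real (Suc n)) *\<^sub>R h) - f x) / inverse (real (Suc n))) \<longlonglongrightarrow> F x \<bullet> h"
      by (rule filterlim_compose)
    then show ?thesis by (simp add: inverse_eq_divide mult.commute)
  qed
  show ?thesis
    by (rule that[OF _ b l]) (use B in \<open>auto intro: add_nonneg_pos\<close>)
qed

lemma integrable_indicator_compact: "compact K \<Longrightarrow> integrable lborel (\<lambda>x. B * indicator K x :: real)"
  using emeasure_compact_finite[of K]
  by (intro integrable_mult_right integrable_real_indicator) (auto simp: borel_compact)

lemma C1_supported_measurable:
  assumes "C1_supported K f F"
  shows "f \<in> borel_measurable borel" "F \<in> borel_measurable borel"
  using C1_supported_continuous[OF assms] C1_supported_continuous_grad[OF assms]
  by (auto intro: borel_measurable_continuous_onI)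

lemma C1_supported_integrable:
  assumes "C1_supported K f F"
  shows "integrable lborel f" "integrable lborel F"
  using integrable_continuous_supported[OF C1_supported_compact[OF assms]] C1_supported_continuous[OF assms]
    C1_supported_continuous_grad[OF assms] C1_supported_zero[OF assms] C1_supported_grad_zero[OF assms]
  by blast+

lemma continuous_on_norm_powr:
  fixes f :: "'a::topological_space \<Rightarrow> 'b::real_normed_vector"
  assumes "continuous_on S f" "0 < p"
  shows "continuous_on S (\<lambda>x. norm (f x) powr p)"
  using assms by (intro continuous_on_powr' continuous_intros) auto

lemma integrable_norm_powr_supported:
  fixes f :: "'a::euclidean_space \<Rightarrow> 'b::real_normed_vector"
  assumes "compact K" "continuous_on UNIV f" "\<And>x. x \<notin> K \<Longrightarrow> f x = 0" "0 < p"
  shows "integrable lborel (\<lambda>x. norm (f x) powr p)"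
  by (rule integrable_continuous_supported[OF assms(1) continuous_on_norm_powr[OF assms(2,4)]])
     (use assms in auto)

lemma C1_supported_powr_integrable:
  assumes "C1_supported K f F" "0 < p"
  shows "integrable lborel (\<lambda>x. \<bar>f x\<bar> powr p)" "integrable lborel (\<lambda>x. norm (F x) powr p)"
  using integrable_norm_powr_supported[OF C1_supported_compact[OF assms(1)] C1_supported_continuous[OF assms(1)]
      C1_supported_zero[OF assms(1)] assms(2)]
    integrable_norm_powr_supported[OF C1_supported_compact[OF assms(1)] C1_supported_continuous_grad[OF assms(1)]
      C1_supported_grad_zero[OF assms(1)] assms(2)]
  by auto

text \<open>
By translation invariance the difference quotients have integral zero, and they converge boundedly on a compact set.
\<close>
lemma C1_supported_integral_grad:
  assumes C: "C1_supported K f F"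
  shows "(LBINT x. F x \<bullet> h) = 0"
proof -
  note [measurable] = C1_supported_measurable[OF C]
  obtain B where B: "0 < B"
    "\<And>n x. \<bar>real (Suc n) * (f (x + (1 / real (Suc n)) *\<^sub>R h) - f x)\<bar> \<le> B * indicator (thicken K (norm h)) x"
    "\<And>x. (\<lambda>n. real (Suc n) * (f (x + (1 / real (Suc n)) *\<^sub>R h) - f x)) \<longlonglongrightarrow> F x \<bullet> h"
    using difference_quotient[OF C] by metis
  have "(\<lambda>n. LBINT x. real (Suc n) * (f (x + (1 / real (Suc n)) *\<^sub>R h) - f x)) \<longlonglongrightarrow> (LBINT x. F x \<bullet> h)"
  proof (rule integral_dominated_convergence)
    show "integrable lborel (\<lambda>x. B * indicator (thicken K (norm h)) x)"
      by (intro integrable_indicator_compact compact_thicken C1_supported_compact[OF C])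
  qed (use B in auto)
  moreover have "(LBINT x. real (Suc n) * (f (x + (1 / real (Suc n)) *\<^sub>R h) - f x)) = 0" for n
    using lborel_integral_translation[OF C1_supported_measurable(1)[OF C]] C1_supported_integrable(1)[OF C]
    by simp
  ultimately show ?thesis
    by (simp add: LIMSEQ_const_iff)
qed

lemma integrable_difference_powr:
  assumes C: "C1_supported K f F" and "0 < p"
  shows "integrable lborel (\<lambda>x. \<bar>f (x + h) - f (x + g)\<bar> powr p)"
proof -
  let ?r = "norm h + norm g"
  have "integrable lborel (\<lambda>x. norm (f (x + h) - f (x + g)) powr p)"
  proof (rule integrable_norm_powr_supported[of "thicken K ?r"])
    show "compact (thicken K ?r)"
      by (rule compact_thicken[OF C1_supported_compact[OF C]])
    have "continuous_on UNIV (\<lambda>x. f (x + v))" for v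
      by (rule continuous_on_compose2[OF C1_supported_continuous[OF C]]) (auto intro: continuous_intros)
    then show "continuous_on UNIV (\<lambda>x. f (x + h) - f (x + g))"
      by (intro continuous_on_diff)
    show "f (x + h) - f (x + g) = 0" if "x \<notin> thicken K ?r" for x
      using not_in_thicken[OF that, of h] not_in_thicken[OF that, of g] C1_supported_zero[OF C] by simp
  qed fact
  then show ?thesis by simp
qed

text \<open>
Split the translation by \<open>h\<close> into \<open>N\<close> steps of length \<open>h / N\<close>. By the power mean inequality
and translation invariance the left side is at most
\<open>2\<^sup>p N\<^sup>p \<integral> \<bar>f(x + h/N) - f(x)\<bar>\<^sup>p dx\<close>, the integral of the \<open>p\<close>-th power of a difference quotient, and
\<open>N\<close> tends to infinity. No integration along segments is needed.
\<close>
lemma translation_estimate: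
  assumes C: "C1_supported K f F" and p: "1 \<le> p"
  shows "(LBINT x. \<bar>f (x + h) - f x\<bar> powr p) \<le> 2 powr p * norm h powr p * (LBINT x. norm (F x) powr p)"
proof -
  note [measurable] = C1_supported_measurable[OF C]
  define q where "q n x = real (Suc n) * (f (x + (1 / real (Suc n)) *\<^sub>R h) - f x)" for n x
  obtain B where B: "0 < B" "\<And>n x. \<bar>q n x\<bar> \<le> B * indicator (thicken K (norm h)) x"
    "\<And>x. (\<lambda>n. q n x) \<longlonglongrightarrow> F x \<bullet> h"
    using difference_quotient[OF C] unfolding q_def by metis
  have [measurable]: "q n \<in> borel_measurable borel" for n
    unfolding q_def by measurable
  have iF: "integrable lborel (\<lambda>x. norm (F x) powr p)"
    using C1_supported_powr_integrable[OF C] p by simp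
  have lim: "(\<lambda>n. LBINT x. \<bar>q n x\<bar> powr p) \<longlonglongrightarrow> (LBINT x. \<bar>F x \<bullet> h\<bar> powr p)"
  proof (rule integral_dominated_convergence)
    show "integrable lborel (\<lambda>x. B powr p * indicator (thicken K (norm h)) x)"
      by (intro integrable_indicator_compact compact_thicken C1_supported_compact[OF C])
    show "AE x in lborel. norm (\<bar>q n x\<bar> powr p) \<le> B powr p * indicator (thicken K (norm h)) x" for n
    proof (rule AE_I2)
      fix x
      have "\<bar>q n x\<bar> powr p \<le> (B * indicator (thicken K (norm h)) x) powr p"
        using B p by (intro powr_mono2) auto
      also have "\<dots> = B powr p * indicator (thicken K (norm h)) x"
        using B p by (auto simp: indicator_def)
      finally show "norm (\<bar>q n x\<bar> powr p) \<le> B powr p * indicator (thicken K (norm h)) x"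
        by simp
    qed
    show "AE x in lborel. (\<lambda>n. \<bar>q n x\<bar> powr p) \<longlonglongrightarrow> \<bar>F x \<bullet> h\<bar> powr p"
      using B(3) p by (intro AE_I2 tendsto_powr' tendsto_rabs tendsto_const) auto
  qed measurable
  have step: "(LBINT x. \<bar>f (x + h) - f x\<bar> powr p) \<le> 2 powr p * (LBINT x. \<bar>q n x\<bar> powr p)" for n
  proof -
    define N where "N = Suc n"
    define d where "d k x = \<bar>f (x + (real (Suc k) / real N) *\<^sub>R h) - f (x + (real k / real N) *\<^sub>R h)\<bar>" for k x
    have N: "0 < real N" by (simp add: N_def)
    have di: "integrable lborel (\<lambda>x. d k x powr p)" for k
      unfolding d_def using integrable_difference_powr[OF C] p by simp
    have ds: "(LBINT x. d k x powr p) = (LBINT x. \<bar>f (x + (1 / real N) *\<^sub>R h) - f x\<bar> powr p)" for k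
    proof -
      have "(LBINT x. d k x powr p) = 
        (LBINT x. \<bar>f ((x + (real k / real N) *\<^sub>R h) + (1 / real N) *\<^sub>R h) - f (x + (real k / real N) *\<^sub>R h)\<bar> powr p)"
      proof -
        have "x + (real (Suc k) / real N) *\<^sub>R h = (x + (real k / real N) *\<^sub>R h) + (1 / real N) *\<^sub>R h" for x
          by (simp add: add_divide_distrib scaleR_add_left)
        then show ?thesis unfolding d_def by presburger
      qed
      also have "\<dots> = (LBINT x. \<bar>f (x + (1 / real N) *\<^sub>R h) - f x\<bar> powr p)"
        by (rule lborel_integral_translation(1)[where f="\<lambda>x. \<bar>f (x + (1 / real N) *\<^sub>R h) - f x\<bar> powr p"]) measurable
      finally show ?thesis .
    qed
    have pw: "\<bar>f (x + h) - f x\<bar> powr p \<le> 2 powr p * real N powr (p - 1) * (\<Sum>k<N. d k x powr p)" for x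
    proof -
      have "f (x + h) - f x = (\<Sum>k<N. f (x + (real (Suc k) / real N) *\<^sub>R h) - f (x + (real k / real N) *\<^sub>R h))"
        using sum_lessThan_telescope[of "\<lambda>k. f (x + (real k / real N) *\<^sub>R h)" N] N by simp
      also have "\<bar>\<dots>\<bar> \<le> (\<Sum>k<N. d k x)"
        unfolding d_def by (rule sum_abs)
      finally have "\<bar>f (x + h) - f x\<bar> powr p \<le> (\<Sum>k<N. d k x) powr p"
        using p by (intro powr_mono2) auto
      also have "\<dots> \<le> 2 powr p * real N powr (p - 1) * (\<Sum>k<N. d k x powr p)"
        using power_mean_le[OF p, of "count_space {..<N}" "\<lambda>k. d k x"] N
        by (simp add: lebesgue_integral_count_space_finite integrable_count_space finite_measure_count_space
            d_def measure_count_space)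
      finally show ?thesis .
    qed
    have "(LBINT x. \<bar>f (x + h) - f x\<bar> powr p) \<le> (LBINT x. 2 powr p * real N powr (p - 1) * (\<Sum>k<N. d k x powr p))"
      using pw di integrable_difference_powr[OF C, of p h 0] p by (intro integral_mono) auto
    also have "\<dots> = 2 powr p * real N powr (p - 1) * (real N * (LBINT x. \<bar>f (x + (1 / real N) *\<^sub>R h) - f x\<bar> powr p))"
      using di by (simp add: ds)
    also have "\<dots> = 2 powr p * (real N powr p * (LBINT x. \<bar>f (x + (1 / real N) *\<^sub>R h) - f x\<bar> powr p))"
      using N by (simp add: powr_diff)
    also have "real N powr p * (LBINT x. \<bar>f (x + (1 / real N) *\<^sub>R h) - f x\<bar> powr p) = (LBINT x. \<bar>q n x\<bar> powr p)"
      unfolding q_def N_def by (simp add: abs_mult powr_mult)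
    finally show ?thesis .
  qed
  have "(LBINT x. \<bar>f (x + h) - f x\<bar> powr p) \<le> 2 powr p * (LBINT x. \<bar>F x \<bullet> h\<bar> powr p)"
    by (rule LIMSEQ_le_const[OF tendsto_mult_left[OF lim]]) (use step in auto)
  also have "(LBINT x. \<bar>F x \<bullet> h\<bar> powr p) \<le> (LBINT x. norm h powr p * norm (F x) powr p)"
  proof (rule integral_mono')
    show "integrable lborel (\<lambda>x. norm h powr p * norm (F x) powr p)"
      using iF by simp
    show "\<bar>F x \<bullet> h\<bar> powr p \<le> norm h powr p * norm (F x) powr p" for x
      using Cauchy_Schwarz_ineq2[of "F x" h] p
      by (subst powr_mult[symmetric]) (auto intro!: powr_mono2 simp: mult.commute)
  qed simp
  finally show ?thesis by (simp add: mult.assoc)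
qed

text \<open>
Translate by a vector \<open>h\<close> longer than the diameter of \<open>K\<close>: then \<open>f\<close> and its translate have disjoint
supports, so \<open>2 \<integral> \<bar>f\<bar>\<^sup>p = \<integral> \<bar>f(x + h) - f(x)\<bar>\<^sup>p dx\<close>.
\<close>
theorem Poincare_C1:
  assumes K: "compact (K :: (real^'n) set)" and p: "1 \<le> p"
  obtains C where "0 < C" "\<And>f F. C1_supported K f F \<Longrightarrow>
    (LBINT x. \<bar>f x\<bar> powr p) \<le> C * (LBINT x. norm (F x) powr p)"
proof -
  obtain R where R: "0 < R" "\<And>x. x \<in> K \<Longrightarrow> norm x \<le> R"
    using compact_imp_bounded[OF K] by (auto simp: bounded_pos)
  obtain h :: "real^'n" where h: "norm h = 2 * R + 1"
    using vector_choose_size[of "2 * R + 1"] R by auto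
  have "(LBINT x. \<bar>f x\<bar> powr p) \<le> (2 powr p * norm h powr p) * (LBINT x. norm (F x) powr p)"
    if C: "C1_supported K f F" for f F
  proof -
    note [measurable] = C1_supported_measurable[OF C]
    have i: "integrable lborel (\<lambda>x. \<bar>f x\<bar> powr p)"
      using C1_supported_powr_integrable(1)[OF C] p by simp
    have ih: "integrable lborel (\<lambda>x. \<bar>f (x + h)\<bar> powr p)"
      using i by (subst lborel_integral_translation(2)[where f="\<lambda>x. \<bar>f x\<bar> powr p"]) auto
    have disj: "\<bar>f (x + h) - f x\<bar> powr p = \<bar>f (x + h)\<bar> powr p + \<bar>f x\<bar> powr p" for x
    proof -
      have "x \<notin> K \<or> x + h \<notin> K"
      proof (rule ccontr)
        assume "\<not> ?thesis"
        then have "norm x \<le> R" "norm (x + h) \<le> R" using R by auto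
        then show False
          using norm_triangle_ineq4[of "x + h" x] h by simp
      qed
      then show ?thesis using C1_supported_zero[OF C] p by auto
    qed
    have "(LBINT x. \<bar>f (x + h) - f x\<bar> powr p) = (LBINT x. \<bar>f (x + h)\<bar> powr p) + (LBINT x. \<bar>f x\<bar> powr p)"
      unfolding disj using i ih by simp
    also have "(LBINT x. \<bar>f (x + h)\<bar> powr p) = (LBINT x. \<bar>f x\<bar> powr p)"
      by (rule lborel_integral_translation(1)[where f="\<lambda>x. \<bar>f x\<bar> powr p"]) measurable
    finally have "(LBINT x. \<bar>f x\<bar> powr p) \<le> (LBINT x. \<bar>f (x + h) - f x\<bar> powr p)"
      by simp
    then show ?thesis
      using translation_estimate[OF C p, of h] by simp
  qed
  moreover have "0 < 2 powr p * norm h powr p"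
    using h R by auto
  ultimately show ?thesis using that by blast
qed

section \<open>Rellich compactness for continuously differentiable functions\<close>

text \<open>
Divided by the volume of the ball this is the mean of \<open>f\<close> over the ball around \<open>x\<close>. Leaving the factor out
keeps the bounds below independent of the radius.
\<close>
definition ball_integral :: "real \<Rightarrow> ('a::euclidean_space \<Rightarrow> real) \<Rightarrow> 'a \<Rightarrow> real" where
  "ball_integral e f x = (LBINT y. indicator (cball 0 e) y * f (x + y))"

lemma ball_integral_integrable:
  assumes "continuous_on UNIV f"
  shows "integrable lborel (\<lambda>y. indicator (cball 0 e) y * f (x + y :: 'a::euclidean_space) :: real)"
proof -
  have "continuous_on (cball 0 e) (\<lambda>y. f (x + y))"
    by (rule continuous_on_compose2[OF assms]) (auto intro: continuous_intros)
  from borel_integrable_compact[OF compact_cball this] show ?thesis by simp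
qed

lemma ball_integral_diff:
  assumes "continuous_on UNIV f" "continuous_on UNIV g"
  shows "ball_integral e (\<lambda>x. f x - g x) x = ball_integral e f x - ball_integral e g x"
  unfolding ball_integral_def
  using ball_integral_integrable[OF assms(1)] ball_integral_integrable[OF assms(2)]
  by (simp add: right_diff_distrib)

lemma ball_integral_bound:
  assumes C: "C1_supported K f F"
  shows "\<bar>ball_integral e f x\<bar> \<le> (LBINT x. \<bar>f x\<bar>)"
proof -
  note [measurable] = C1_supported_measurable[OF C]
  have i: "integrable lborel (\<lambda>y. \<bar>f (y + x)\<bar>)"
    using C1_supported_integrable(1)[OF C]
    by (subst lborel_integral_translation(2)[where f="\<lambda>y. \<bar>f y\<bar>"]) auto
  have "\<bar>ball_integral e f x\<bar> \<le> (LBINT y. \<bar>f (y + x)\<bar>)"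
    unfolding ball_integral_def
    by (intro integral_abs_bound[THEN order_trans] integral_mono'[OF i])
       (auto simp: indicator_def add.commute)
  also have "\<dots> = (LBINT x. \<bar>f x\<bar>)"
    by (rule lborel_integral_translation(1)[where f="\<lambda>y. \<bar>f y\<bar>"]) measurable
  finally show ?thesis .
qed

text \<open>
The difference is at most \<open>\<integral> \<bar>f(y + x - z) - f(y)\<bar> dy\<close>, the case \<open>p = 1\<close> of the translation estimate.
\<close>
lemma ball_integral_Lipschitz:
  assumes C: "C1_supported K f F"
  shows "\<bar>ball_integral e f x - ball_integral e f z\<bar> \<le> 2 * norm (x - z) * (LBINT x. norm (F x))"
proof -
  note [measurable] = C1_supported_measurable[OF C]
  have cf: "continuous_on UNIV f" by (rule C1_supported_continuous[OF C])
  define d where "d y = \<bar>f (y + (x - z)) - f y\<bar>" for y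
  have [measurable]: "d \<in> borel_measurable borel" unfolding d_def by measurable
  have di: "integrable lborel d"
    using integrable_difference_powr[OF C, of 1 "x - z" 0] by (simp add: d_def[abs_def])
  have i: "integrable lborel (\<lambda>y. d (y + z))"
    using di by (subst lborel_integral_translation(2)) auto
  have "ball_integral e f x - ball_integral e f z =
      (LBINT y. indicator (cball 0 e) y * f (x + y) - indicator (cball 0 e) y * f (z + y))"
    unfolding ball_integral_def using ball_integral_integrable[OF cf] by simp
  also have "\<bar>\<dots>\<bar> \<le> (LBINT y. d (y + z))"
    by (intro integral_abs_bound[THEN order_trans] integral_mono'[OF i])
       (auto simp: indicator_def d_def algebra_simps)
  also have "\<dots> = (LBINT y. d y)"
    by (rule lborel_integral_translation(1)) measurable
  also have "\<dots> \<le> 2 * norm (x - z) * (LBINT x. norm (F x))"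
    using translation_estimate[OF C order.refl, of "x - z"] by (simp add: d_def[abs_def])
  finally show ?thesis .
qed

lemma ball_integral_continuous:
  assumes C: "C1_supported K f F"
  shows "continuous_on UNIV (ball_integral e f)"
proof -
  have "(2 * (LBINT x. norm (F x)))-lipschitz_on UNIV (ball_integral e f)"
    by (rule lipschitz_onI) (use ball_integral_Lipschitz[OF C] in \<open>auto simp: dist_norm mult_ac\<close>)
  then show ?thesis by (rule lipschitz_on_continuous_on)
qed

lemma ball_integral_supported:
  assumes C: "C1_supported K f F" and x: "x \<notin> thicken K e"
  shows "ball_integral e f x = 0"
proof -
  have "indicator (cball 0 e) y * f (x + y) = 0" for y
    using not_in_thicken[OF x, of y] C1_supported_zero[OF C, of "x + y"] by (auto simp: indicator_def)
  then show ?thesis unfolding ball_integral_def by (simp only: integral_zero)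
qed

text \<open>
Averaging over translations by vectors of length at most \<open>e\<close> moves \<open>f\<close> in \<open>L\<^sup>p\<close>, up to a constant,
no further than the worst of these translations does: the power mean inequality in the ball variable, then Fubini, then the
translation estimate.
\<close>
lemma mollification_error:
  assumes C: "C1_supported K f F" and p: "1 \<le> p" and e: "0 < e"
  defines "V \<equiv> measure lborel (cball (0::real^'n) e)"
  shows "(LBINT x. \<bar>f x - ball_integral e f (x::real^'n) / V\<bar> powr p) \<le>
         4 powr p * e powr p * (LBINT x. norm (F x) powr p)"
proof -
  let ?B = "cball (0::real^'n) e"
  note [measurable] = C1_supported_measurable[OF C]
  have cf: "continuous_on UNIV f" by (rule C1_supported_continuous[OF C])
  have V: "0 < V" using e by (simp add: V_def content_cball_pos)
  define I where "I = (LBINT x. norm (F x) powr p)"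
  define g where "g x y = indicator ?B y * \<bar>f x - f (x + y)\<bar> powr p" for x y
  \<comment> \<open>The integrand on the product space is continuous on this compact set and zero off it, hence integrable, and Fubini applies.\<close>
  define S where "S = thicken K e \<times> ?B"
  have S: "compact S"
    unfolding S_def by (intro compact_Times compact_thicken C1_supported_compact[OF C] compact_cball)
  have gS: "case_prod g = (\<lambda>z. indicator S z *\<^sub>R \<bar>f (fst z) - f (fst z + snd z)\<bar> powr p)"
  proof
    fix z :: "(real^'n) \<times> (real^'n)"
    obtain x y where z: "z = (x, y)" by (cases z)
    show "case_prod g z = indicator S z *\<^sub>R \<bar>f (fst z) - f (fst z + snd z)\<bar> powr p"
    proof (cases "y \<in> ?B \<and> x \<notin> thicken K e")
      case True
      then have "x \<notin> K" "x + y \<notin> K"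
        using not_in_thicken[of x K e 0] not_in_thicken[of x K e y] e by auto
      then show ?thesis
        using True C1_supported_zero[OF C] p by (simp add: z g_def)
    qed (auto simp: z g_def S_def indicator_def)
  qed
  have cg: "continuous_on UNIV (\<lambda>z. \<bar>f (fst z) - f (fst z + snd z)\<bar> powr p)"
    using p by (intro continuous_on_powr' continuous_on_rabs continuous_on_diff continuous_on_const
        continuous_on_compose2[OF cf]) (auto intro!: continuous_intros)
  have ig: "integrable (lborel \<Otimes>\<^sub>M lborel) (case_prod g)"
    unfolding gS lborel_prod by (rule borel_integrable_compact[OF S continuous_on_subset[OF cg]]) simp
  have igy: "integrable lborel (\<lambda>y. g x y)" for x
    unfolding g_def using ball_integral_integrable[of "\<lambda>z. \<bar>f x - f z\<bar> powr p" e x]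
      continuous_on_norm_powr[of UNIV "\<lambda>z. f x - f z" p] continuous_on_diff[OF continuous_on_const cf] p
    by simp
  have pw: "\<bar>f x - ball_integral e f x / V\<bar> powr p \<le> (2 powr p / V) * (LBINT y. g x y)" for x
  proof -
    let ?M = "restrict_space lborel ?B"
    have iI: "integrable ?M h \<longleftrightarrow> integrable lborel (\<lambda>y. indicator ?B y *\<^sub>R h y)"
      "(\<integral>y. h y \<partial>?M) = (LBINT y. indicator ?B y *\<^sub>R h y)" for h :: "real^'n \<Rightarrow> real"
      by (simp_all add: integrable_restrict_space integral_restrict_space)
    have mV: "measure ?M (space ?M) = V"
      by (simp add: measure_restrict_space V_def)
    have fin: "finite_measure ?M"
      using emeasure_compact_finite[OF compact_cball, of "0::real^'n" e]
      by (intro finite_measureI) (auto simp: emeasure_restrict_space space_restrict_space)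
    have i2: "integrable lborel (\<lambda>y. indicator ?B y * \<bar>f x - f (x + y)\<bar>)"
      by (rule ball_integral_integrable[OF continuous_on_rabs[OF continuous_on_diff[OF continuous_on_const cf]]])
    have "V * (f x - ball_integral e f x / V) = V * f x - ball_integral e f x"
      using V by (simp add: field_simps)
    also have "V * f x = (LBINT y. indicator ?B y * f x)"
      using emeasure_compact_finite[OF compact_cball, of "0::real^'n" e] by (simp add: V_def)
    also have "\<dots> - ball_integral e f x = (LBINT y. indicator ?B y * (f x - f (x + y)))"
      unfolding ball_integral_def right_diff_distrib
      using ball_integral_integrable[OF cf, of e x] ball_integral_integrable[of "\<lambda>z. f x" e x]
      by (intro Bochner_Integration.integral_diff[symmetric]) auto
    finally have "V * \<bar>f x - ball_integral e f x / V\<bar> = \<bar>LBINT y. indicator ?B y * (f x - f (x + y))\<bar>"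
      using V by (metis abs_mult abs_of_pos)
    also have "\<dots> \<le> (LBINT y. indicator ?B y * \<bar>f x - f (x + y)\<bar>)"
      by (intro integral_abs_bound[THEN order_trans] integral_mono'[OF i2]) (auto simp: indicator_def)
    finally have "(V * \<bar>f x - ball_integral e f x / V\<bar>) powr p \<le>
        (LBINT y. indicator ?B y * \<bar>f x - f (x + y)\<bar>) powr p"
      using V p by (intro powr_mono2) auto
    also have "\<dots> \<le> 2 powr p * V powr (p - 1) * (LBINT y. g x y)"
      using power_mean_le[OF p fin, of "\<lambda>y. \<bar>f x - f (x + y)\<bar>"] V i2 igy[of x]
      unfolding mV iI by (simp add: g_def)
    finally have "V powr p * \<bar>f x - ball_integral e f x / V\<bar> powr p \<le> V powr p * ((2 powr p / V) * (LBINT y. g x y))"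
      using V by (simp add: powr_mult powr_diff mult_ac)
    then show ?thesis
      by (rule mult_left_le_imp_le) (use V in simp)
  qed
  have "(LBINT x. \<bar>f x - ball_integral e f x / V\<bar> powr p) \<le> (LBINT x. (2 powr p / V) * (LBINT y. g x y))"
  proof (rule integral_mono')
    show "integrable lborel (\<lambda>x. (2 powr p / V) * (LBINT y. g x y))"
      using lborel_pair.integrable_fst[OF ig] by simp
  qed (use pw order_trans[OF powr_ge_zero pw] in auto)
  also have "\<dots> = (2 powr p / V) * (LBINT y. (LBINT x. g x y))"
    using lborel_pair.Fubini_integral[OF ig] by simp
  also have "\<dots> \<le> (2 powr p / V) * (LBINT y. indicator ?B y * (2 powr p * e powr p * I))"
  proof (rule mult_left_mono, rule integral_mono')
    show "integrable lborel (\<lambda>y. indicator ?B y * (2 powr p * e powr p * I))"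
      using ball_integral_integrable[of "\<lambda>_. 2 powr p * e powr p * I" e] by simp
    show "(LBINT x. g x y) \<le> indicator ?B y * (2 powr p * e powr p * I)" for y
    proof (cases "y \<in> ?B")
      case True
      have "(LBINT x. g x y) = (LBINT x. \<bar>f (x + y) - f x\<bar> powr p)"
        using True by (simp add: g_def abs_minus_commute)
      also have "\<dots> \<le> 2 powr p * norm y powr p * I"
        unfolding I_def by (rule translation_estimate[OF C p])
      also have "\<dots> \<le> 2 powr p * e powr p * I"
        using True p by (intro mult_right_mono mult_left_mono powr_mono2) (auto simp: I_def)
      finally show ?thesis using True by simp
    qed (simp add: g_def)
  qed (use V in \<open>simp_all add: I_def\<close>)
  also have "(LBINT y. indicator ?B y * (2 powr p * e powr p * I)) = V * (2 powr p * e powr p * I)"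
    using emeasure_compact_finite[OF compact_cball, of "0::real^'n" e] by (simp add: V_def)
  finally have "(LBINT x. \<bar>f x - ball_integral e f x / V\<bar> powr p) \<le> 2 powr p / V * (V * (2 powr p * e powr p * I))"
    .
  also have "\<dots> = 4 powr p * e powr p * I"
    using V powr_mult[of 2 2 p] by simp
  finally show ?thesis by (simp add: I_def)
qed

lemma integral_le_measure_plus_powr:
  assumes C: "C1_supported K f F" and p: "1 \<le> p"
  shows "(LBINT x. norm (F x)) \<le> measure lborel K + (LBINT x. norm (F x) powr p)"
proof -
  have K: "K \<in> sets lborel" "emeasure lborel K < \<infinity>"
    using C1_supported_compact[OF C] emeasure_compact_finite by (auto simp: borel_compact)
  have iF: "integrable lborel (\<lambda>x. norm (F x) powr p)"
    using C1_supported_powr_integrable[OF C] p by simp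
  have iK: "integrable lborel (indicator K :: _ \<Rightarrow> real)"
    using K by (intro integrable_real_indicator) auto
  have "(LBINT x. norm (F x)) \<le> (LBINT x. indicator K x + norm (F x) powr p)"
  proof (rule integral_mono')
    show "integrable lborel (\<lambda>x. indicator K x + norm (F x) powr p)"
      using iF iK by simp
    show "norm (F x) \<le> indicator K x + norm (F x) powr p" for x
    proof (cases "x \<in> K \<and> 1 < norm (F x)")
      case True
      then show ?thesis using powr_mono[of 1 p "norm (F x)"] p by simp
    next
      case False
      then consider "x \<notin> K" | "x \<in> K" "norm (F x) \<le> 1" by linarith
      then show ?thesis
        by cases (use C1_supported_grad_zero[OF C] in \<open>auto intro: add_increasing2\<close>)
    qed
  qed auto
  also have "\<dots> = measure lborel K + (LBINT x. norm (F x) powr p)"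
    using iF iK K by simp
  finally show ?thesis .
qed

lemma equi_Lipschitz_convergent:
  fixes f :: "nat \<Rightarrow> 'a::real_normed_vector \<Rightarrow> real"
  assumes L: "\<And>n x z. \<bar>f n x - f n z\<bar> \<le> L * norm (x - z)" and "0 \<le> L"
    and D: "\<And>x. x \<in> D \<Longrightarrow> convergent (\<lambda>n. f n x)" and dense: "closure D = UNIV"
  shows "convergent (\<lambda>n. f n x)"
proof -
  have "Cauchy (\<lambda>n. f n x)"
  proof (rule metric_CauchyI)
    fix e :: real assume e: "0 < e"
    define d where "d = e / (3 * (L + 1))"
    have d: "0 < d" using e \<open>0 \<le> L\<close> by (simp add: d_def)
    obtain y where y: "y \<in> D" "dist y x < d"
      using dense closure_approachable[of x D] d by auto
    have Ld: "L * norm (x - y) \<le> e / 3"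
    proof -
      have "L * norm (x - y) \<le> (L + 1) * d"
        using y(2) \<open>0 \<le> L\<close> d by (intro mult_mono) (auto simp: dist_norm norm_minus_commute)
      also have "\<dots> = e / 3" using \<open>0 \<le> L\<close> by (simp add: d_def field_simps)
      finally show ?thesis .
    qed
    have "Cauchy (\<lambda>n. f n y)" using D[OF y(1)] by (rule convergent_Cauchy)
    then obtain N where N: "\<And>m n. m \<ge> N \<Longrightarrow> n \<ge> N \<Longrightarrow> dist (f m y) (f n y) < e / 3"
      using e metric_CauchyD[of "\<lambda>n. f n y" "e/3"] by auto
    show "\<exists>M. \<forall>m\<ge>M. \<forall>n\<ge>M. dist (f m x) (f n x) < e"
    proof (intro exI allI impI)
      fix m n assume "N \<le> m" "N \<le> n"
      then have "\<bar>f m y - f n y\<bar> < e / 3" using N by (simp add: dist_real_def)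
      moreover have "\<bar>f m x - f m y\<bar> \<le> e / 3" "\<bar>f n x - f n y\<bar> \<le> e / 3"
        using L[of m x y] L[of n x y] Ld by linarith+
      ultimately show "dist (f m x) (f n x) < e"
        unfolding dist_real_def by linarith
    qed
  qed
  then show ?thesis by (simp add: Cauchy_convergent_iff)
qed

text \<open>
For each radius \<open>1/(m+1)\<close> the ball integrals are uniformly bounded and equi-Lipschitz. A diagonal
subsequence makes them converge at all points of a countable dense set for all \<open>m\<close> simultaneously, hence everywhere, and
by dominated convergence in \<open>L\<^sup>p\<close>. Since means over small balls are uniformly close to the functions in
\<open>L\<^sup>p\<close> (\<open>mollification_error\<close>), the subsequence itself is Cauchy.
\<close>
theorem Rellich_C1:
  fixes f :: "nat \<Rightarrow> real^'n \<Rightarrow> real"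
  assumes p: "1 \<le> p" and C: "\<And>n. C1_supported K (f n) (F n)"
    and bound: "\<And>n. (LBINT x. norm (F n x) powr p) \<le> E"
  obtains r :: "nat \<Rightarrow> nat" where "strict_mono r"
    "\<And>e. 0 < e \<Longrightarrow> \<exists>N. \<forall>m\<ge>N. \<forall>n\<ge>N. (LBINT x. \<bar>f (r m) x - f (r n) x\<bar> powr p) < e"
proof -
  have K: "compact K" by (rule C1_supported_compact[OF C])
  define L where "L = measure lborel K + E"
  have L: "(LBINT x. norm (F n x)) \<le> L" for n
    using integral_le_measure_plus_powr[OF C[of n] p] bound[of n] by (simp add: L_def)
  have L0: "0 \<le> L"
    using L[of 0] by (rule order_trans[rotated]) simp
  obtain c where c: "0 < c" "\<And>n. (LBINT x. \<bar>f n x\<bar>) \<le> c * (LBINT x. norm (F n x))"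
    using Poincare_C1[OF K order.refl] C by (metis (no_types, lifting) Bochner_Integration.integral_cong abs_ge_zero norm_ge_zero powr_one)
  define J where "J n x m = ball_integral (1 / real (Suc m)) (f n) x" for n x m
  have Jb: "\<bar>J n x m\<bar> \<le> c * L" for n x m
    unfolding J_def using ball_integral_bound[OF C[of n]] c(2)[of n] mult_left_mono[OF L[of n], of c] c(1)
    by (meson order_trans less_imp_le)
  have JL: "\<bar>J n x m - J n z m\<bar> \<le> 2 * L * norm (x - z)" for n x z m
  proof -
    have "\<bar>J n x m - J n z m\<bar> \<le> 2 * norm (x - z) * (LBINT x. norm (F n x))"
      unfolding J_def by (rule ball_integral_Lipschitz[OF C])
    also have "\<dots> \<le> 2 * norm (x - z) * L"
      by (intro mult_left_mono L) auto
    finally show ?thesis by (simp add: mult_ac)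
  qed
  obtain D :: "(real^'n) set" where D: "countable D" "closure D = UNIV"
  proof -
    obtain D where "countable D" "D \<subseteq> (UNIV::(real^'n) set)" "UNIV \<subseteq> closure D"
      using separable[of "UNIV::(real^'n) set"] by blast
    then show ?thesis using that[of D] by blast
  qed
  obtain r where r: "strict_mono r"
    and rD: "\<And>z. z \<in> D \<times> UNIV \<Longrightarrow> \<exists>l. (\<lambda>n. J (r n) (fst z) (snd z)) \<longlonglongrightarrow> l"
    using function_convergent_subsequence[of "D \<times> (UNIV::nat set)" "\<lambda>n z. J n (fst z) (snd z)" "c * L"]
      D(1) Jb by auto
  have conv: "convergent (\<lambda>n. J (r n) x m)" for x m
  proof (rule equi_Lipschitz_convergent[where D=D and L="2 * L" and f="\<lambda>n x. J (r n) x m"])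
    show "convergent (\<lambda>n. J (r n) x m)" if "x \<in> D" for x
      using rD[of "(x, m)"] that by (auto simp: convergent_def)
  qed (use JL L0 D(2) in auto)
  have JC: "\<exists>N. \<forall>k\<ge>N. \<forall>n\<ge>N. (LBINT x. \<bar>J (r k) x m - J (r n) x m\<bar> powr p) < e" if e: "0 < e" for m e
  proof -
    define T where "T = thicken K (1 / real (Suc m))"
    have T: "compact T" unfolding T_def by (rule compact_thicken[OF K])
    define l where "l x = lim (\<lambda>n. J (r n) x m)" for x
    have lim: "(\<lambda>n. J (r n) x m) \<longlonglongrightarrow> l x" for x
      unfolding l_def using conv by (simp add: convergent_LIMSEQ_iff)
    have [measurable]: "(\<lambda>x. J n x m) \<in> borel_measurable borel" for n
      unfolding J_def using ball_integral_continuous[OF C] by (intro borel_measurable_continuous_onI)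
    have [measurable]: "l \<in> borel_measurable borel"
      by (rule borel_measurable_LIMSEQ_real[OF lim]) measurable
    have Jp: "integrable lborel (\<lambda>x. \<bar>J n x m\<bar> powr p)" for n
      using integrable_norm_powr_supported[OF T, of "\<lambda>x. J n x m" p] ball_integral_continuous[OF C]
        ball_integral_supported[OF C] p by (auto simp: J_def T_def)
    have Jb': "\<bar>J n x m\<bar> \<le> c * L * indicator T x" for n x
      using Jb[of n x m] ball_integral_supported[OF C, of x "1 / real (Suc m)" n]
      by (cases "x \<in> T") (auto simp: J_def T_def)
    then have lb: "\<bar>l x\<bar> \<le> c * L * indicator T x" for x
      by (intro LIMSEQ_le_const2[OF tendsto_rabs[OF lim]]) auto
    have pi: "integrable lborel (\<lambda>x. (2 * (c * L)) powr p * indicator T x)"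
      by (rule integrable_indicator_compact[OF T])
    have db: "\<bar>J n x m - l x\<bar> powr p \<le> (2 * (c * L)) powr p * indicator T x" for n x
    proof -
      have "\<bar>J n x m - l x\<bar> \<le> 2 * (c * L) * indicator T x"
        using Jb'[of n x] lb[of x] by linarith
      then have "\<bar>J n x m - l x\<bar> powr p \<le> (2 * (c * L) * indicator T x) powr p"
        using p by (intro powr_mono2) auto
      also have "\<dots> = (2 * (c * L)) powr p * indicator T x"
        using p by (auto simp: indicator_def)
      finally show ?thesis .
    qed
    have "(\<lambda>n. LBINT x. \<bar>J (r n) x m - l x\<bar> powr p) \<longlonglongrightarrow> (\<integral>x. 0 \<partial>(lborel::(real^'n) measure))"
    proof (rule integral_dominated_convergence[OF _ _ pi])
      show "AE x in lborel. (\<lambda>n. \<bar>J (r n) x m - l x\<bar> powr p) \<longlonglongrightarrow> 0"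
      proof (rule AE_I2)
        fix x
        have "(\<lambda>n. \<bar>J (r n) x m - l x\<bar>) \<longlonglongrightarrow> 0"
          using lim[of x] by (simp add: LIM_zero_iff tendsto_rabs_zero_iff)
        then show "(\<lambda>n. \<bar>J (r n) x m - l x\<bar> powr p) \<longlonglongrightarrow> 0"
          using tendsto_powr'[OF _ tendsto_const[of p], of "\<lambda>n. \<bar>J (r n) x m - l x\<bar>" 0 sequentially] p by simp
      qed
    qed (use db in auto)
    then have "eventually (\<lambda>n. (LBINT x. \<bar>J (r n) x m - l x\<bar> powr p) < e / (2 * 2 powr p)) sequentially"
      using e by (intro order_tendstoD(2)) auto
    then obtain N where N: "\<And>n. n \<ge> N \<Longrightarrow> (LBINT x. \<bar>J (r n) x m - l x\<bar> powr p) < e / (2 * 2 powr p)"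
      by (auto simp: eventually_sequentially)
    have li: "p_integrable lborel p l" "p_integrable lborel p (\<lambda>x. J n x m)" for n
    proof -
      show 1: "p_integrable lborel p (\<lambda>x. J n x m)" for n
        using Jp by (simp add: p_integrable_def)
      have "p_integrable lborel p (\<lambda>x. J 0 x m - l x)"
        unfolding p_integrable_def
        by (auto intro!: Bochner_Integration.integrable_bound[OF pi] simp: db)
      from p_integrable_diff[OF 1[of 0] this] show "p_integrable lborel p l" using p by simp
    qed
    show ?thesis
    proof (intro exI allI impI)
      fix k n assume "N \<le> k" "N \<le> n"
      have "(LBINT x. \<bar>J (r k) x m - J (r n) x m\<bar> powr p) \<le> 2 powr p * 
         ((LBINT x. \<bar>J (r k) x m - l x\<bar> powr p) + (LBINT x. \<bar>l x - J (r n) x m\<bar> powr p))"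
        using p_integral_triangle[OF li(2)[of "r k"] li(1) li(2)[of "r n"]] p by simp
      also have "\<dots> < 2 powr p * (e / (2 * 2 powr p) + e / (2 * 2 powr p))"
        using N[OF \<open>N \<le> k\<close>] N[OF \<open>N \<le> n\<close>] by (intro mult_strict_left_mono add_strict_mono) (auto simp: abs_minus_commute)
      also have "\<dots> = e" by (simp add: field_simps)
      finally show "(LBINT x. \<bar>J (r k) x m - J (r n) x m\<bar> powr p) < e" .
    qed
  qed
  have E0: "0 \<le> E" using bound[of 0] by (rule order_trans[rotated]) simp
  have main: "\<exists>N. \<forall>k\<ge>N. \<forall>n\<ge>N. (LBINT x. \<bar>f (r k) x - f (r n) x\<bar> powr p) < e" if e: "0 < e" for e
  proof -
    \<comment> \<open>\<open>M * d powr p\<close> bounds the part of \<open>\<integral> \<bar>w\<bar>\<^sup>p\<close> that comes from replacing \<open>w = f (r k) - f (r n)\<close> by its means over balls of radius \<open>d\<close>; the factor \<open>2 powr p * (2 * E)\<close> bounds the gradient of \<open>w\<close>.\<close>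
    define M where "M = 2 powr p * (4 powr p * (2 powr p * (2 * E)))"
    have M: "0 \<le> M" using E0 by (simp add: M_def)
    have "(\<lambda>m. M * inverse (real (Suc m)) powr p) \<longlonglongrightarrow> M * 0 powr p"
      using p by (intro tendsto_mult tendsto_const tendsto_powr' LIMSEQ_inverse_real_of_nat) auto
    then have "eventually (\<lambda>m. M * inverse (real (Suc m)) powr p < e / 2) sequentially"
      using e p by (intro order_tendstoD(2)) auto
    then obtain m where m: "M * inverse (real (Suc m)) powr p < e / 2"
      by (auto simp: eventually_sequentially)
    define d where "d = 1 / real (Suc m)"
    have d: "0 < d" "M * d powr p < e / 2" using m by (auto simp: d_def inverse_eq_divide)
    define V where "V = measure lborel (cball (0::real^'n) d)"
    have V: "0 < V" using d by (simp add: V_def content_cball_pos)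
    obtain N where N: "\<And>k n. k \<ge> N \<Longrightarrow> n \<ge> N \<Longrightarrow>
        (LBINT x. \<bar>J (r k) x m - J (r n) x m\<bar> powr p) < V powr p * (e / (2 * 2 powr p))"
      using JC[of "V powr p * (e / (2 * 2 powr p))" m] V e by auto
    show ?thesis
    proof (intro exI allI impI)
      fix k n assume kn: "N \<le> k" "N \<le> n"
      define w where "w x = f (r k) x - f (r n) x" for x
      define W where "W x = F (r k) x - F (r n) x" for x
      have Cw: "C1_supported K w W"
        unfolding w_def[abs_def] W_def[abs_def] by (rule C1_supported_diff[OF C C])
      have wi: "p_integrable lborel p w"
        using C1_supported_powr_integrable(1)[OF Cw] C1_supported_measurable(1)[OF Cw] p
        by (simp add: p_integrable_def)
      have Fi: "p_integrable lborel p (F j)" for j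
        using C1_supported_powr_integrable(2)[OF C] C1_supported_measurable(2)[OF C] p
        by (simp add: p_integrable_def)
      have Bi: "p_integrable lborel p (\<lambda>x. ball_integral d w x / V)"
      proof -
        have "p_integrable lborel p (ball_integral d w)"
          unfolding p_integrable_def
          using borel_measurable_continuous_onI[OF ball_integral_continuous[OF Cw]] p
            integrable_norm_powr_supported[OF compact_thicken[OF K, of d] ball_integral_continuous[OF Cw, of d]
              ball_integral_supported[OF Cw, of _ d], of p]
          by simp
        from p_integrable_scaleR[OF this, of "1 / V"] show ?thesis by simp
      qed
      have "(LBINT x. norm (W x) powr p) \<le> 2 powr p * ((LBINT x. norm (F (r k) x) powr p) + (LBINT x. norm (F (r n) x) powr p))"
        using p_integral_add_le[OF Fi[of "r k"] p_integrable_scaleR[OF Fi[of "r n"], of "-1"]] p by (simp add: W_def)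
      also have "\<dots> \<le> 2 powr p * (2 * E)"
        using bound[of "r k"] bound[of "r n"] by simp
      finally have WE: "(LBINT x. norm (W x) powr p) \<le> 2 powr p * (2 * E)" .
      have 1: "(LBINT x. \<bar>w x - ball_integral d w x / V\<bar> powr p) \<le> 4 powr p * d powr p * (2 powr p * (2 * E))"
      proof -
        have "(LBINT x. \<bar>w x - ball_integral d w x / V\<bar> powr p) \<le> 4 powr p * d powr p * (LBINT x. norm (W x) powr p)"
          unfolding V_def by (rule mollification_error[OF Cw p d(1)])
        also have "\<dots> \<le> 4 powr p * d powr p * (2 powr p * (2 * E))"
          by (intro mult_left_mono WE) auto
        finally show ?thesis .
      qed
      have "ball_integral d w x = J (r k) x m - J (r n) x m" for x
        unfolding w_def[abs_def] J_def d_def by (rule ball_integral_diff[OF C1_supported_continuous[OF C] C1_supported_continuous[OF C]])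
      then have "(LBINT x. \<bar>ball_integral d w x / V\<bar> powr p) = (LBINT x. \<bar>J (r k) x m - J (r n) x m\<bar> powr p) / V powr p"
        using V by (simp add: powr_divide)
      also have "\<dots> < e / (2 * 2 powr p)"
        using N[OF kn] V by (simp add: divide_less_eq mult.commute)
      finally have 2: "(LBINT x. \<bar>ball_integral d w x / V\<bar> powr p) < e / (2 * 2 powr p)" .
      have "(LBINT x. \<bar>w x\<bar> powr p) \<le> 2 powr p * ((LBINT x. \<bar>w x - ball_integral d w x / V\<bar> powr p) + (LBINT x. \<bar>ball_integral d w x / V\<bar> powr p))"
        using p_integral_add_le[OF p_integrable_diff[OF wi Bi] Bi] p by simp
      also have "\<dots> < 2 powr p * (4 powr p * d powr p * (2 powr p * (2 * E)) + e / (2 * 2 powr p))"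
        using 1 2 by (intro mult_strict_left_mono add_le_less_mono) auto
      also have "\<dots> = M * d powr p + e / 2"
        by (simp add: M_def field_simps)
      also have "\<dots> < e" using d by simp
      finally show "(LBINT x. \<bar>f (r k) x - f (r n) x\<bar> powr p) < e"
        by (simp add: w_def)
    qed
  qed
  show ?thesis by (rule that[OF r]) (rule main)
qed

section \<open>Sobolev functions with zero boundary values\<close>

lemma test_functionsI:
  assumes \<phi>: "\<phi> \<in> test_functions \<Omega>" and "smooth f" and sub: "{x. f x \<noteq> 0} \<subseteq> closure {x. \<phi> x \<noteq> 0}"
  shows "f \<in> test_functions \<Omega>"
proof -
  have c: "closure {x. f x \<noteq> 0} \<subseteq> closure {x. \<phi> x \<noteq> 0}"
    using sub by (simp add: closure_minimal)
  then have "compact (closure {x. f x \<noteq> 0})"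
    using \<phi> compact_Int_closed[of "closure {x. \<phi> x \<noteq> 0}" "closure {x. f x \<noteq> 0}"]
    by (simp add: test_functions_def Int_absorb1)
  then show ?thesis
    using c \<phi> \<open>smooth f\<close> by (auto simp: test_functions_def)
qed

lemma partial_deriv_test_function:
  assumes "\<phi> \<in> test_functions \<Omega>"
  shows "partial_deriv i \<phi> \<in> test_functions \<Omega>"
proof -
  have sm: "iter_partial js \<phi> differentiable (at x)" for js x
    using assms by (auto simp: test_functions_def smooth_def)
  have "smooth (partial_deriv i \<phi>)"
    unfolding smooth_def using sm[of "_ @ [i]"] by (simp add: iter_partial_snoc)
  moreover have "{x. partial_deriv i \<phi> x \<noteq> 0} \<subseteq> closure {x. \<phi> x \<noteq> 0}"
    using C1_supported_grad_zero[OF test_functions_C1_supported[OF assms]]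
    by (metis (mono_tags, lifting) grad_nth mem_Collect_eq subsetI zero_index)
  ultimately show ?thesis
    by (rule test_functionsI[OF assms])
qed

lemma borel_measurable_lebesgue_on_AE:
  fixes f g :: "'a::euclidean_space \<Rightarrow> 'b::euclidean_space"
  assumes S: "S \<in> sets lebesgue" and f: "f \<in> borel_measurable (lebesgue_on S)"
    and ae: "AE x in lebesgue_on S. f x = g x"
  shows "g \<in> borel_measurable (lebesgue_on S)"
proof -
  have "AE x in lebesgue. (if x \<in> S then f x else 0) = (if x \<in> S then g x else 0)"
    using ae S by (simp add: AE_restrict_space_iff)
  from borel_measurable_AE[OF borel_measurable_if_I[OF f S] this]
  show ?thesis by (rule borel_measurable_if_D)
qed

lemma p_integrable_cong_AE:
  fixes f g :: "'a::euclidean_space \<Rightarrow> 'b::euclidean_space"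
  assumes S: "S \<in> sets lebesgue" and f: "p_integrable (lebesgue_on S) p f" and p: "0 \<le> p"
    and ae: "AE x in lebesgue_on S. f x = g x"
  shows "p_integrable (lebesgue_on S) p g"
  by (rule p_integrable_dominated[OF f borel_measurable_lebesgue_on_AE[OF S p_integrable_measurable[OF f] ae] _ p])
     (use ae in \<open>auto elim: eventually_mono\<close>)

locale bounded_open_domain =
  fixes \<Omega> :: "(real^'n) set" and p :: real
  assumes open_domain: "open \<Omega>" and bounded_domain: "bounded \<Omega>" and p_gt_1: "1 < p"
begin

abbreviation "M \<equiv> lebesgue_on \<Omega>"

abbreviation Lp_mass :: "(real^'n \<Rightarrow> 'b::euclidean_space) \<Rightarrow> real" where
  "Lp_mass f \<equiv> \<integral>x. norm (f x) powr p \<partial>M"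

abbreviation Lp_gap :: "(real^'n \<Rightarrow> 'b::euclidean_space) \<Rightarrow> (real^'n \<Rightarrow> 'b) \<Rightarrow> real" where
  "Lp_gap f g \<equiv> \<integral>x. norm (f x - g x) powr p \<partial>M"

lemma domain_sets: "\<Omega> \<in> sets lebesgue"
  using open_domain by (simp add: borel_open)

lemma finite_measure_domain: "finite_measure M"
  by (rule finite_measure_lebesgue_on[OF lmeasurable_open[OF bounded_domain open_domain]])

lemma Lp_iff: "f \<in> Lp p \<Omega> \<longleftrightarrow> p_integrable M p f"
  by (simp add: Lp_def p_integrable_def)

lemma p_integrable_imp_integrable:
  assumes "p_integrable M p f"
  shows "integrable M f"
proof (rule Bochner_Integration.integrable_bound)
  interpret finite_measure M by (rule finite_measure_domain)
  show "integrable M (\<lambda>x. 1 + norm (f x) powr p)"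
    using p_integrable_integrable[OF assms] by simp
  show "f \<in> borel_measurable M" by (rule p_integrable_measurable[OF assms])
  show "AE x in M. norm (f x) \<le> norm (1 + norm (f x) powr p)"
  proof (rule AE_I2)
    fix x
    show "norm (f x) \<le> norm (1 + norm (f x) powr p)"
      using powr_mono[of 1 p "norm (f x)"] p_gt_1 by (cases "1 \<le> norm (f x)") (auto simp: add_increasing2)
  qed
qed

lemma integrable_imp_locally_integrable:
  fixes f :: "real^'n \<Rightarrow> 'b::euclidean_space"
  assumes "integrable M f"
  shows "locally_integrable \<Omega> f"
  unfolding locally_integrable_def
proof (intro allI impI)
  fix K assume K: "compact K \<and> K \<subseteq> \<Omega>"
  then have Ks: "K \<in> sets lebesgue" by (simp add: borel_compact)
  have "integrable lebesgue (\<lambda>x. indicator K x *\<^sub>R (indicator \<Omega> x *\<^sub>R f x))"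
    using assms domain_sets by (intro integrable_mult_indicator[OF Ks]) (simp add: integrable_restrict_space)
  moreover have "(\<lambda>x. indicator K x *\<^sub>R (indicator \<Omega> x *\<^sub>R f x)) = (\<lambda>x. indicator K x *\<^sub>R f x)"
    using K by (auto simp: indicator_def fun_eq_iff)
  ultimately show "integrable (lebesgue_on K) f"
    using Ks by (simp add: integrable_restrict_space)
qed

lemma test_outside:
  assumes "\<phi> \<in> test_functions \<Omega>" "x \<notin> \<Omega>"
  shows "\<phi> x = 0" "grad \<phi> x = 0"
proof -
  have "x \<notin> closure {x. \<phi> x \<noteq> 0}"
    using assms by (auto simp: test_functions_def)
  then show "\<phi> x = 0" "grad \<phi> x = 0"
    using C1_supported_zero C1_supported_grad_zero test_functions_C1_supported[OF assms(1)] by blast+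
qed

lemma test_p_integrals:
  assumes \<phi>: "\<phi> \<in> test_functions \<Omega>"
  shows "p_integrable M p \<phi>" "p_integrable M p (grad \<phi>)"
    "Lp_mass \<phi> = (LBINT x. \<bar>\<phi> x\<bar> powr p)"
    "Lp_mass (grad \<phi>) = (LBINT x. norm (grad \<phi> x) powr p)"
proof -
  note C = test_functions_C1_supported[OF \<phi>]
  note [measurable] = C1_supported_measurable[OF C]
  have i: "integrable lborel (\<lambda>x. \<bar>\<phi> x\<bar> powr p)" "integrable lborel (\<lambda>x. norm (grad \<phi> x) powr p)"
    using C1_supported_powr_integrable[OF C] p_gt_1 by auto
  have m: "f \<in> borel_measurable M" if "f \<in> borel_measurable borel" for f :: "real^'n \<Rightarrow> 'b::euclidean_space"
    using that by (intro measurable_restrict_space1 measurable_completion) simp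
  have 1: "integrable M (\<lambda>x. \<bar>\<phi> x\<bar> powr p) \<longleftrightarrow> integrable lborel (\<lambda>x. \<bar>\<phi> x\<bar> powr p)"
    "(\<integral>x. \<bar>\<phi> x\<bar> powr p \<partial>M) = (LBINT x. \<bar>\<phi> x\<bar> powr p)"
    using test_outside[OF \<phi>] by (intro lebesgue_on_integral_eq_lborel domain_sets; simp)+
  have 2: "integrable M (\<lambda>x. norm (grad \<phi> x) powr p) \<longleftrightarrow> integrable lborel (\<lambda>x. norm (grad \<phi> x) powr p)"
    "Lp_mass (grad \<phi>) = (LBINT x. norm (grad \<phi> x) powr p)"
    using test_outside[OF \<phi>] by (intro lebesgue_on_integral_eq_lborel domain_sets; simp)+
  show "p_integrable M p \<phi>" "p_integrable M p (grad \<phi>)"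
    using 1(1) 2(1) i m[of \<phi>] m[of "grad \<phi>"] by (auto simp: p_integrable_def)
  show "Lp_mass \<phi> = (LBINT x. \<bar>\<phi> x\<bar> powr p)"
    "Lp_mass (grad \<phi>) = (LBINT x. norm (grad \<phi> x) powr p)"
    using 1(2) 2(2) by simp_all
qed

text \<open>
Integration by parts: the gradient of \<open>\<phi> \<psi>\<close> has integral zero.
\<close>
lemma test_function_weak_gradient:
  assumes \<phi>: "\<phi> \<in> test_functions \<Omega>"
  shows "has_weak_gradient \<Omega> \<phi> (grad \<phi>)"
  unfolding has_weak_gradient_def
proof (intro conjI allI ballI)
  show "locally_integrable \<Omega> \<phi>" "locally_integrable \<Omega> (grad \<phi>)"
    using test_p_integrals[OF \<phi>] p_integrable_imp_integrable integrable_imp_locally_integrable by blast+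
  fix i \<psi> assume \<psi>: "\<psi> \<in> test_functions \<Omega>"
  note C = test_functions_C1_supported[OF \<phi>] note D = test_functions_C1_supported[OF \<psi>]
  note C' = test_functions_C1_supported[OF partial_deriv_test_function[OF \<phi>, of i]]
  note D' = test_functions_C1_supported[OF partial_deriv_test_function[OF \<psi>, of i]]
  note m = C1_supported_measurable(1)[OF C] C1_supported_measurable(1)[OF D]
    C1_supported_measurable(1)[OF C'] C1_supported_measurable(1)[OF D']
  have 1: "(\<integral>x. \<phi> x * partial_deriv i \<psi> x \<partial>M) = (LBINT x. \<phi> x * partial_deriv i \<psi> x)"
    using m test_outside[OF \<phi>] by (intro lebesgue_on_integral_eq_lborel domain_sets) auto
  have 2: "(\<integral>x. grad \<phi> x $ i * \<psi> x \<partial>M) = (LBINT x. partial_deriv i \<phi> x * \<psi> x)"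
    using m test_outside[OF \<psi>] by (subst lebesgue_on_integral_eq_lborel(2)) (auto simp: domain_sets)
  have "(LBINT x. (\<phi> x *\<^sub>R grad \<psi> x + \<psi> x *\<^sub>R grad \<phi> x) \<bullet> axis i 1) = 0"
    by (rule C1_supported_integral_grad[OF C1_supported_mult[OF C D]])
  then have "(LBINT x. \<phi> x * partial_deriv i \<psi> x + partial_deriv i \<phi> x * \<psi> x) = 0"
    by (simp add: inner_axis mult.commute)
  moreover have "integrable lborel (\<lambda>x. \<phi> x * partial_deriv i \<psi> x)"
    using C1_supported_integrable(1)[OF C1_supported_mult[OF C D']] .
  moreover have "integrable lborel (\<lambda>x. partial_deriv i \<phi> x * \<psi> x)"
    using C1_supported_integrable(1)[OF C1_supported_mult[OF C' D]] .
  ultimately show "(\<integral>x. \<phi> x * partial_deriv i \<psi> x \<partial>M) = - (\<integral>x. grad \<phi> x $ i * \<psi> x \<partial>M)"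
    unfolding 1 2 by simp
qed

lemma has_weak_gradient_diff:
  assumes u: "has_weak_gradient \<Omega> u G" and v: "has_weak_gradient \<Omega> v H"
  shows "has_weak_gradient \<Omega> (\<lambda>x. u x - v x) (\<lambda>x. G x - H x)"
  unfolding has_weak_gradient_def
proof (intro conjI allI ballI)
  have l: "locally_integrable \<Omega> u" "locally_integrable \<Omega> v" "locally_integrable \<Omega> G" "locally_integrable \<Omega> H"
    using u v by (auto simp: has_weak_gradient_def)
  then show "locally_integrable \<Omega> (\<lambda>x. u x - v x)" "locally_integrable \<Omega> (\<lambda>x. G x - H x)"
    by (auto simp: locally_integrable_def)
  fix i \<phi> assume \<phi>: "\<phi> \<in> test_functions \<Omega>"
  note t = locally_integrable_test_integrable[OF _ \<phi> open_domain]
  note t' = locally_integrable_test_integrable[OF _ partial_deriv_test_function[OF \<phi>, of i] open_domain]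
  show "(\<integral>x. (u x - v x) * partial_deriv i \<phi> x \<partial>M) = - (\<integral>x. (G x - H x) $ i * \<phi> x \<partial>M)"
    using u v \<phi> t'[OF l(1)] t'[OF l(2)] t[OF locally_integrable_component[OF l(3)], of i]
      t[OF locally_integrable_component[OF l(4)], of i]
    by (simp add: left_diff_distrib has_weak_gradient_def)
qed

text \<open>
On a finite measure space, from \<open>\<bar>t\<bar> \<le> d + d\<^sup>1\<^sup>-\<^sup>p \<bar>t\<bar>\<^sup>p\<close> with small \<open>d\<close>.
\<close>
lemma L1_tendsto_of_Lp:
  fixes f :: "nat \<Rightarrow> real^'n \<Rightarrow> 'b::euclidean_space"
  assumes f: "\<And>k. p_integrable M p (f k)" and lim: "(\<lambda>k. Lp_mass (f k)) \<longlonglongrightarrow> 0"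
  shows "(\<lambda>k. \<integral>x. norm (f k x) \<partial>M) \<longlonglongrightarrow> 0"
proof (rule tendstoI)
  interpret finite_measure M by (rule finite_measure_domain)
  fix e :: real assume e: "0 < e"
  define m where "m = measure M (space M)"
  define d where "d = e / (2 * (m + 1))"
  have m: "0 \<le> m" by (simp add: m_def)
  have d: "0 < d" using e m by (simp add: d_def)
  have dm: "d * m < e / 2"
    using e m by (simp add: d_def field_simps)
  have "eventually (\<lambda>k. Lp_mass (f k) < e / 2 / d powr (1 - p)) sequentially"
    using e d by (intro order_tendstoD(2)[OF lim]) auto
  then show "eventually (\<lambda>k. dist (\<integral>x. norm (f k x) \<partial>M) 0 < e) sequentially"
  proof eventually_elim
    case (elim k)
    have "(\<integral>x. norm (f k x) \<partial>M) \<le> (\<integral>x. d + d powr (1 - p) * norm (f k x) powr p \<partial>M)"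
      using p_integrable_imp_integrable[OF f] p_integrable_integrable[OF f] d p_gt_1
        Young_powr_eps[of 1 "norm (f k x)" d p for x]
      by (intro integral_mono) auto
    also have "\<dots> = d * m + d powr (1 - p) * Lp_mass (f k)"
      using p_integrable_integrable[OF f] by (simp add: m_def)
    also have "d powr (1 - p) * Lp_mass (f k) < e / 2"
      using elim d by (simp add: field_simps)
    finally have "(\<integral>x. norm (f k x) \<partial>M) < e" using dm by simp
    then show ?case by simp
  qed
qed

lemma test_pairing_tendsto:
  fixes f :: "nat \<Rightarrow> real^'n \<Rightarrow> real"
  assumes f: "\<And>k. p_integrable M p (f k)" and g: "p_integrable M p g"
    and lim: "(\<lambda>k. Lp_gap (f k) g) \<longlonglongrightarrow> 0" and \<phi>: "\<phi> \<in> test_functions \<Omega>"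
  shows "(\<lambda>k. \<integral>x. f k x * \<phi> x \<partial>M) \<longlonglongrightarrow> (\<integral>x. g x * \<phi> x \<partial>M)"
proof -
  note C = test_functions_C1_supported[OF \<phi>]
  obtain B where B: "0 < B" "\<And>x. norm (\<phi> x) \<le> B"
    using continuous_supported_bounded[OF C1_supported_compact[OF C] C1_supported_continuous[OF C] C1_supported_zero[OF C]]
    by blast
  have d: "p_integrable M p (\<lambda>x. f k x - g x)" for k
    using p_integrable_diff[OF f g] p_gt_1 by simp
  have i: "integrable M (\<lambda>x. h x * \<phi> x)" if "p_integrable M p h" for h
    by (intro locally_integrable_test_integrable[OF _ \<phi> open_domain] integrable_imp_locally_integrable
        p_integrable_imp_integrable that)
  have "(\<lambda>k. (\<integral>x. f k x * \<phi> x \<partial>M) - (\<integral>x. g x * \<phi> x \<partial>M)) \<longlonglongrightarrow> 0"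
  proof (rule Lim_null_comparison)
    show "(\<lambda>k. B * (\<integral>x. norm (f k x - g x) \<partial>M)) \<longlonglongrightarrow> 0"
      using tendsto_mult_right_zero[OF L1_tendsto_of_Lp[OF d lim]] .
    show "eventually (\<lambda>k. norm ((\<integral>x. f k x * \<phi> x \<partial>M) - (\<integral>x. g x * \<phi> x \<partial>M)) \<le> B * (\<integral>x. norm (f k x - g x) \<partial>M)) sequentially"
    proof (intro always_eventually allI)
      fix k
      have "(\<integral>x. f k x * \<phi> x \<partial>M) - (\<integral>x. g x * \<phi> x \<partial>M) = (\<integral>x. (f k x - g x) * \<phi> x \<partial>M)"
        using i[OF f] i[OF g] by (simp add: left_diff_distrib)
      also have "norm \<dots> \<le> (\<integral>x. B * norm (f k x - g x) \<partial>M)"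
      proof (rule integral_norm_bound[THEN order_trans], rule integral_mono)
        show "integrable M (\<lambda>x. norm ((f k x - g x) * \<phi> x))" using i[OF d] by (rule integrable_norm)
        show "integrable M (\<lambda>x. B * norm (f k x - g x))" using p_integrable_imp_integrable[OF d] by simp
        show "norm ((f k x - g x) * \<phi> x) \<le> B * norm (f k x - g x)" for x
          using B(2)[of x] by (simp add: abs_mult mult.commute[of B] mult_left_mono)
      qed
      also have "\<dots> = B * (\<integral>x. norm (f k x - g x) \<partial>M)" by simp
      finally show "norm ((\<integral>x. f k x * \<phi> x \<partial>M) - (\<integral>x. g x * \<phi> x \<partial>M)) \<le> B * (\<integral>x. norm (f k x - g x) \<partial>M)" .
    qed
  qed
  then show ?thesis by (simp add: LIM_zero_iff)
qed

text \<open>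
Working with pairs keeps the unspecified choice made by \<open>wgrad\<close> out of the estimates: limits and multiples of
pairs are formed componentwise, and only \<open>W1p_0_imp_W0_pair\<close> and \<open>W0_pair_imp_W1p_0\<close> relate them to \<open>W1p_0\<close>.
\<close>
definition W0_pair :: "(real^'n \<Rightarrow> real) \<Rightarrow> (real^'n \<Rightarrow> real^'n) \<Rightarrow> bool" where
  "W0_pair u G \<longleftrightarrow> p_integrable M p u \<and> p_integrable M p G \<and>
     (\<exists>\<phi>. (\<forall>k::nat. \<phi> k \<in> test_functions \<Omega>) \<and>
        (\<lambda>k. Lp_gap (\<phi> k) u) \<longlonglongrightarrow> 0 \<and>
        (\<lambda>k. Lp_gap (grad (\<phi> k)) G) \<longlonglongrightarrow> 0)"

lemma W0_pair_p_integrable: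
  assumes "W0_pair u G"
  shows "p_integrable M p u" "p_integrable M p G"
  using assms by (auto simp: W0_pair_def)

text \<open>
The defining identity of a weak gradient holds for the approximating test functions and is stable under \<open>L\<^sup>p\<close> limits.
\<close>
lemma W0_pair_weak_gradient:
  assumes "W0_pair u G"
  shows "has_weak_gradient \<Omega> u G"
  unfolding has_weak_gradient_def
proof (intro conjI allI ballI)
  obtain \<phi> where u: "p_integrable M p u" "p_integrable M p G"
    and \<phi>: "\<And>k. \<phi> k \<in> test_functions \<Omega>"
    and lim: "(\<lambda>k. Lp_gap (\<phi> k) u) \<longlonglongrightarrow> 0"
      "(\<lambda>k. Lp_gap (grad (\<phi> k)) G) \<longlonglongrightarrow> 0"
    using assms unfolding W0_pair_def by blast
  show "locally_integrable \<Omega> u" "locally_integrable \<Omega> G"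
    using u p_integrable_imp_integrable integrable_imp_locally_integrable by blast+
  fix i \<psi> assume \<psi>: "\<psi> \<in> test_functions \<Omega>"
  have comp: "p_integrable M p (\<lambda>x. H x $ i)" if "p_integrable M p H" for H :: "real^'n \<Rightarrow> real^'n"
  proof (rule p_integrable_dominated[OF that])
    have [measurable]: "H \<in> borel_measurable M" using that by (rule p_integrable_measurable)
    have "(\<lambda>x. H x \<bullet> axis i 1) \<in> borel_measurable M" by measurable
    then show "(\<lambda>x. H x $ i) \<in> borel_measurable M" by (simp add: inner_axis)
  qed (use p_gt_1 component_le_norm_cart in auto)
  have "(\<lambda>k. \<integral>x. \<phi> k x * partial_deriv i \<psi> x \<partial>M) \<longlonglongrightarrow> (\<integral>x. u x * partial_deriv i \<psi> x \<partial>M)"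
    by (rule test_pairing_tendsto[OF test_p_integrals(1)[OF \<phi>] u(1) lim(1) partial_deriv_test_function[OF \<psi>]])
  moreover have "(\<integral>x. \<phi> k x * partial_deriv i \<psi> x \<partial>M) = - (\<integral>x. grad (\<phi> k) x $ i * \<psi> x \<partial>M)" for k
    using test_function_weak_gradient[OF \<phi>] \<psi> by (simp add: has_weak_gradient_def)
  moreover have "(\<lambda>k. - (\<integral>x. grad (\<phi> k) x $ i * \<psi> x \<partial>M)) \<longlonglongrightarrow> - (\<integral>x. G x $ i * \<psi> x \<partial>M)"
  proof (intro tendsto_minus test_pairing_tendsto[OF comp comp _ \<psi>])
    show "p_integrable M p (grad (\<phi> k))" for k by (rule test_p_integrals(2)[OF \<phi>])
    show "p_integrable M p G" by (rule u(2))
    have d: "p_integrable M p (\<lambda>x. grad (\<phi> k) x - G x)" for k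
      using p_integrable_diff[OF test_p_integrals(2)[OF \<phi>] u(2)] p_gt_1 by simp
    show "(\<lambda>k. \<integral>x. norm (grad (\<phi> k) x $ i - G x $ i) powr p \<partial>M) \<longlonglongrightarrow> 0"
    proof (rule Lim_null_comparison[OF _ lim(2)], intro always_eventually allI)
      fix k
      have "(\<integral>x. norm (grad (\<phi> k) x $ i - G x $ i) powr p \<partial>M) \<le> Lp_gap (grad (\<phi> k)) G"
      proof (rule integral_mono')
        show "norm (grad (\<phi> k) x $ i - G x $ i) powr p \<le> norm (grad (\<phi> k) x - G x) powr p" for x
          using component_le_norm_cart[of "grad (\<phi> k) x - G x" i] p_gt_1 by (intro powr_mono2) auto
      qed (use p_integrable_integrable[OF d] in auto)
      then show "norm (\<integral>x. norm (grad (\<phi> k) x $ i - G x $ i) powr p \<partial>M) \<le> Lp_gap (grad (\<phi> k)) G"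
        by simp
    qed
  qed
  ultimately show "(\<integral>x. u x * partial_deriv i \<psi> x \<partial>M) = - (\<integral>x. G x $ i * \<psi> x \<partial>M)"
    by (metis (no_types, lifting) LIMSEQ_unique ext)
qed

text \<open>
The representative picked by \<open>wgrad\<close> is irrelevant, because weak gradients are unique almost everywhere.
\<close>
lemma wgrad_AE_eq:
  assumes "has_weak_gradient \<Omega> u G"
  shows "AE x in M. wgrad \<Omega> u x = G x"
proof -
  have "has_weak_gradient \<Omega> u (wgrad \<Omega> u)"
    using someI[of "has_weak_gradient \<Omega> u", OF assms] by (simp add: wgrad_def)
  from has_weak_gradient_unique[OF open_domain this assms] show ?thesis .
qed

lemma W1p_norm_test_diff:
  assumes \<phi>: "\<phi> \<in> test_functions \<Omega>" and u: "p_integrable M p u" and G: "p_integrable M p G"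
    and uG: "has_weak_gradient \<Omega> u G"
  shows "W1p_norm p \<Omega> (\<lambda>x. \<phi> x - u x) powr p =
    Lp_gap \<phi> u + Lp_gap (grad \<phi>) G"
proof -
  have Gd: "p_integrable M p (\<lambda>x. grad \<phi> x - G x)"
    using p_integrable_diff[OF test_p_integrals(2)[OF \<phi>] G] p_gt_1 by simp
  have ae: "AE x in M. wgrad \<Omega> (\<lambda>x. \<phi> x - u x) x = grad \<phi> x - G x"
    by (rule wgrad_AE_eq[OF has_weak_gradient_diff[OF test_function_weak_gradient[OF \<phi>] uG]])
  have wd: "p_integrable M p (wgrad \<Omega> (\<lambda>x. \<phi> x - u x))"
    by (rule p_integrable_cong_AE[OF domain_sets Gd]) (use ae p_gt_1 in \<open>auto elim: eventually_mono\<close>)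
  have "(\<integral>x. norm (wgrad \<Omega> (\<lambda>x. \<phi> x - u x) x) powr p \<partial>M) = Lp_gap (grad \<phi>) G"
    by (intro integral_cong_AE borel_measurable_integrable p_integrable_integrable[OF wd] p_integrable_integrable[OF Gd])
       (use ae in \<open>auto elim: eventually_mono\<close>)
  then show ?thesis
    unfolding W1p_norm_def using p_gt_1 by (simp add: powr_powr)
qed

lemma tendsto_0_powr_iff:
  fixes f :: "nat \<Rightarrow> real"
  assumes "\<And>k. 0 \<le> f k" "0 < p"
  shows "f \<longlonglongrightarrow> 0 \<longleftrightarrow> (\<lambda>k. f k powr p) \<longlonglongrightarrow> 0"
proof
  show "(\<lambda>k. f k powr p) \<longlonglongrightarrow> 0" if "f \<longlonglongrightarrow> 0"
    using tendsto_powr'[OF that tendsto_const[of p]] assms by simp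
  show "f \<longlonglongrightarrow> 0" if "(\<lambda>k. f k powr p) \<longlonglongrightarrow> 0"
    using tendsto_powr'[OF that tendsto_const[of "1/p"]] assms by (simp add: powr_powr)
qed

lemma W1p_0_imp_W0_pair:
  assumes "u \<in> W1p_0 p \<Omega>"
  shows "W0_pair u (wgrad \<Omega> u)"
proof -
  obtain G \<phi> where u: "p_integrable M p u" and G: "p_integrable M p G" and uG: "has_weak_gradient \<Omega> u G"
    and \<phi>: "\<And>k. \<phi> k \<in> test_functions \<Omega>" and lim: "(\<lambda>k. W1p_norm p \<Omega> (\<lambda>x. \<phi> k x - u x)) \<longlonglongrightarrow> 0"
    using assms unfolding W1p_0_def W1p_def mem_Collect_eq Bex_def Lp_iff by blast
  have ae: "AE x in M. wgrad \<Omega> u x = G x" by (rule wgrad_AE_eq[OF uG])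
  have wg: "p_integrable M p (wgrad \<Omega> u)"
    by (rule p_integrable_cong_AE[OF domain_sets G]) (use ae p_gt_1 in \<open>auto elim: eventually_mono\<close>)
  have uw: "has_weak_gradient \<Omega> u (wgrad \<Omega> u)"
    using someI[of "has_weak_gradient \<Omega> u", OF uG] by (simp add: wgrad_def)
  define a where "a k = Lp_gap (\<phi> k) u" for k
  define b where "b k = Lp_gap (grad (\<phi> k)) (wgrad \<Omega> u)" for k
  have "(\<lambda>k. W1p_norm p \<Omega> (\<lambda>x. \<phi> k x - u x) powr p) \<longlonglongrightarrow> 0"
    using lim p_gt_1 tendsto_0_powr_iff[of "\<lambda>k. W1p_norm p \<Omega> (\<lambda>x. \<phi> k x - u x)"] by (simp add: W1p_norm_def)
  then have ab: "(\<lambda>k. a k + b k) \<longlonglongrightarrow> 0"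
    using W1p_norm_test_diff[OF \<phi> u wg uw] by (simp add: a_def b_def)
  have a0: "0 \<le> a k" and b0: "0 \<le> b k" for k by (simp_all add: a_def b_def)
  have "a \<longlonglongrightarrow> 0" "b \<longlonglongrightarrow> 0"
    by (rule Lim_null_comparison[OF _ ab], use a0 b0 in simp)+
  then show ?thesis
    unfolding W0_pair_def a_def[abs_def] b_def[abs_def] using u wg \<phi> by blast
qed

lemma W0_pair_imp_W1p_0:
  assumes "W0_pair u G"
  shows "u \<in> W1p_0 p \<Omega>"
proof -
  obtain \<phi> where u: "p_integrable M p u" and G: "p_integrable M p G"
    and \<phi>: "\<And>k. \<phi> k \<in> test_functions \<Omega>"
    and lim: "(\<lambda>k. Lp_gap (\<phi> k) u) \<longlonglongrightarrow> 0"
      "(\<lambda>k. Lp_gap (grad (\<phi> k)) G) \<longlonglongrightarrow> 0"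
    using assms unfolding W0_pair_def by blast
  note uG = W0_pair_weak_gradient[OF assms]
  have "(\<lambda>k. W1p_norm p \<Omega> (\<lambda>x. \<phi> k x - u x) powr p) \<longlonglongrightarrow> 0"
    unfolding W1p_norm_test_diff[OF \<phi> u G uG] using tendsto_add[OF lim] by simp
  then have "(\<lambda>k. W1p_norm p \<Omega> (\<lambda>x. \<phi> k x - u x)) \<longlonglongrightarrow> 0"
    using p_gt_1 tendsto_0_powr_iff[of "\<lambda>k. W1p_norm p \<Omega> (\<lambda>x. \<phi> k x - u x)"] by (simp add: W1p_norm_def)
  then show ?thesis
    using u G uG \<phi> unfolding W1p_0_def W1p_def by (auto simp: Lp_iff)
qed

lemma W0_pair_scale:
  assumes "W0_pair u G"
  shows "W0_pair (\<lambda>x. t * u x) (\<lambda>x. t *\<^sub>R G x)"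
proof -
  obtain \<phi> where u: "p_integrable M p u" and G: "p_integrable M p G"
    and \<phi>: "\<And>k. \<phi> k \<in> test_functions \<Omega>"
    and lim: "(\<lambda>k. Lp_gap (\<phi> k) u) \<longlonglongrightarrow> 0"
      "(\<lambda>k. Lp_gap (grad (\<phi> k)) G) \<longlonglongrightarrow> 0"
    using assms unfolding W0_pair_def by blast
  have g: "grad (\<lambda>x. t * \<phi> k x) x = t *\<^sub>R grad (\<phi> k) x" for k x
  proof (rule vec_eq_iff[THEN iffD2], rule allI)
    fix i
    have "((\<lambda>x. t * \<phi> k x) has_derivative (\<lambda>h. t * (grad (\<phi> k) x \<bullet> h))) (at x)"
      by (intro has_derivative_mult_right C1_supported_deriv[OF test_functions_C1_supported[OF \<phi>]])
    from partial_deriv_eq[OF this, of i] show "grad (\<lambda>x. t * \<phi> k x) x $ i = (t *\<^sub>R grad (\<phi> k) x) $ i"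
      by (simp add: inner_axis)
  qed
  have test: "(\<lambda>x. t * \<phi> k x) \<in> test_functions \<Omega>" for k
  proof -
    have "smooth (\<phi> k)" using \<phi>[of k] by (simp add: test_functions_def)
    then have sm: "smooth (\<lambda>x. t * \<phi> k x)"
      by (intro smooth_mult) (auto simp: smooth_iff k_times_differentiable_const)
    have "{x. t * \<phi> k x \<noteq> 0} \<subseteq> closure {x. \<phi> k x \<noteq> 0}"
      using closure_subset[of "{x. \<phi> k x \<noteq> 0}"] by auto
    then show ?thesis
      by (rule test_functionsI[OF \<phi> sm])
  qed
  have "(\<lambda>k. \<integral>x. norm (t * \<phi> k x - t * u x) powr p \<partial>M) \<longlonglongrightarrow> 0"
    using tendsto_mult_right_zero[OF lim(1), of "\<bar>t\<bar> powr p"]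
    by (simp add: right_diff_distrib[symmetric] abs_mult powr_mult)
  moreover have "(\<lambda>k. \<integral>x. norm (grad (\<lambda>x. t * \<phi> k x) x - t *\<^sub>R G x) powr p \<partial>M) \<longlonglongrightarrow> 0"
    unfolding g using tendsto_mult_right_zero[OF lim(2), of "\<bar>t\<bar> powr p"]
    by (simp add: scaleR_diff_right[symmetric] powr_mult)
  ultimately show ?thesis
    unfolding W0_pair_def using test p_integrable_scaleR[OF u, of t] p_integrable_scaleR[OF G, of t]
    by (auto intro!: exI[of _ "\<lambda>k x. t * \<phi> k x"])
qed

lemma W0_pair_approx:
  assumes "W0_pair u G" and e: "0 < e"
  obtains \<phi> where "\<phi> \<in> test_functions \<Omega>" "Lp_gap \<phi> u < e"
    "Lp_gap (grad \<phi>) G < e"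
proof -
  obtain \<phi> where \<phi>: "\<And>k. \<phi> k \<in> test_functions \<Omega>"
    and lim: "(\<lambda>k. Lp_gap (\<phi> k) u) \<longlonglongrightarrow> 0"
      "(\<lambda>k. Lp_gap (grad (\<phi> k)) G) \<longlonglongrightarrow> 0"
    using assms unfolding W0_pair_def by blast
  have "eventually (\<lambda>k. Lp_gap (\<phi> k) u < e \<and> Lp_gap (grad (\<phi> k)) G < e) sequentially"
    using order_tendstoD(2)[OF lim(1) e] order_tendstoD(2)[OF lim(2) e] by (rule eventually_conj)
  then obtain k where "Lp_gap (\<phi> k) u < e" "Lp_gap (grad (\<phi> k)) G < e"
    by (auto simp: eventually_sequentially)
  with \<phi> that show ?thesis by blast
qed

lemma W0_pair_approx_sequence:
  assumes "\<And>n. W0_pair (u n) (G n)"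
  obtains \<phi> where "\<And>n::nat. \<phi> n \<in> test_functions \<Omega>"
    "\<And>n. Lp_gap (\<phi> n) (u n) < inverse (real (Suc n))"
    "\<And>n. Lp_gap (grad (\<phi> n)) (G n) < inverse (real (Suc n))"
proof -
  have "\<exists>\<phi>. \<phi> \<in> test_functions \<Omega> \<and> Lp_gap \<phi> (u n) < inverse (real (Suc n)) \<and>
    Lp_gap (grad \<phi>) (G n) < inverse (real (Suc n))" for n
    by (rule W0_pair_approx[OF assms[of n], of "inverse (real (Suc n))"]) auto
  then have "\<forall>n. \<exists>\<phi>. \<phi> \<in> test_functions \<Omega> \<and> Lp_gap \<phi> (u n) < inverse (real (Suc n)) \<and>
    Lp_gap (grad \<phi>) (G n) < inverse (real (Suc n))"
    by (rule allI)
  from choice[OF this] obtain \<phi> where "\<forall>n. \<phi> n \<in> test_functions \<Omega> \<and>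
    Lp_gap (\<phi> n) (u n) < inverse (real (Suc n)) \<and>
    Lp_gap (grad (\<phi> n)) (G n) < inverse (real (Suc n))" ..
  then show ?thesis by (intro that[of \<phi>]) auto
qed

text \<open>
A diagonal argument: approximate the \<open>k\<close>-th pair by a test function up to \<open>1/(k+1)\<close>.
\<close>
lemma W0_pair_limit:
  assumes W: "\<And>k. W0_pair (u k) (G k)" and v: "p_integrable M p v" and H: "p_integrable M p H"
    and lim: "(\<lambda>k. Lp_gap (u k) v) \<longlonglongrightarrow> 0"
      "(\<lambda>k. Lp_gap (G k) H) \<longlonglongrightarrow> 0"
  shows "W0_pair v H"
proof -
  obtain \<phi> where \<phi>: "\<And>n. \<phi> n \<in> test_functions \<Omega>"
    "\<And>n. Lp_gap (\<phi> n) (u n) < inverse (real (Suc n))"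
    "\<And>n. Lp_gap (grad (\<phi> n)) (G n) < inverse (real (Suc n))"
    by (rule W0_pair_approx_sequence[of u G, OF W]) (rule that)
  have p: "0 \<le> p" using p_gt_1 by simp
  have l1: "(\<lambda>k. 2 powr p * (inverse (real (Suc k)) + Lp_gap (u k) v)) \<longlonglongrightarrow> 0"
    using tendsto_mult_right_zero[OF tendsto_add_zero[OF LIMSEQ_inverse_real_of_nat lim(1)]] .
  have l2: "(\<lambda>k. 2 powr p * (inverse (real (Suc k)) + Lp_gap (G k) H)) \<longlonglongrightarrow> 0"
    using tendsto_mult_right_zero[OF tendsto_add_zero[OF LIMSEQ_inverse_real_of_nat lim(2)]] .
  have b1: "Lp_gap (\<phi> k) v \<le> 2 powr p * (inverse (real (Suc k)) + Lp_gap (u k) v)" for k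
    by (rule order_trans[OF p_integral_triangle[OF test_p_integrals(1)[OF \<phi>(1)] W0_pair_p_integrable(1)[OF W[of k]] v p]])
       (intro mult_left_mono add_right_mono less_imp_le[OF \<phi>(2)] powr_ge_zero)
  have b2: "Lp_gap (grad (\<phi> k)) H \<le> 2 powr p * (inverse (real (Suc k)) + Lp_gap (G k) H)" for k
    by (rule order_trans[OF p_integral_triangle[OF test_p_integrals(2)[OF \<phi>(1)] W0_pair_p_integrable(2)[OF W[of k]] H p]])
       (intro mult_left_mono add_right_mono less_imp_le[OF \<phi>(3)] powr_ge_zero)
  have "(\<lambda>k. Lp_gap (\<phi> k) v) \<longlonglongrightarrow> 0"
    by (rule Lim_null_comparison[OF _ l1]) (use b1 in auto)
  moreover have "(\<lambda>k. Lp_gap (grad (\<phi> k)) H) \<longlonglongrightarrow> 0"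
    by (rule Lim_null_comparison[OF _ l2]) (use b2 in auto)
  ultimately show ?thesis
    unfolding W0_pair_def using v H \<phi>(1) by blast
qed

lemma test_C1_closure:
  assumes "\<phi> \<in> test_functions \<Omega>"
  shows "C1_supported (closure \<Omega>) \<phi> (grad \<phi>)"
proof (rule C1_supported_mono[OF test_functions_C1_supported[OF assms]])
  show "closure {x. \<phi> x \<noteq> 0} \<subseteq> closure \<Omega>"
    using assms closure_subset[of \<Omega>] by (auto simp: test_functions_def)
  show "compact (closure \<Omega>)" using bounded_domain by simp
qed

theorem Poincare:
  obtains C where "0 < C" "\<And>u G. W0_pair u G \<Longrightarrow>
    Lp_mass u \<le> C * Lp_mass G"
proof -
  have p: "0 \<le> p" "1 \<le> p" using p_gt_1 by auto
  have "compact (closure \<Omega>)" using bounded_domain by simp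
  then obtain C where C: "0 < C" "\<And>f F. C1_supported (closure \<Omega>) f F \<Longrightarrow>
    (LBINT x. \<bar>f x\<bar> powr p) \<le> C * (LBINT x. norm (F x) powr p)"
    using Poincare_C1[OF _ p(2)] by metis
  have "Lp_mass u \<le> (2 powr p * (C * 2 powr p)) * Lp_mass G" if W: "W0_pair u G" for u G
  proof -
    obtain \<phi> where u: "p_integrable M p u" and G: "p_integrable M p G"
      and \<phi>: "\<And>k. \<phi> k \<in> test_functions \<Omega>"
      and lim: "(\<lambda>k. Lp_gap (\<phi> k) u) \<longlonglongrightarrow> 0"
        "(\<lambda>k. Lp_gap (grad (\<phi> k)) G) \<longlonglongrightarrow> 0"
      using W unfolding W0_pair_def by blast
    have bnd: "Lp_mass u \<le> 2 powr p * (Lp_gap (\<phi> k) u +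
       C * (2 powr p * (Lp_gap (grad (\<phi> k)) G + Lp_mass G)))" for k
    proof -
      have "Lp_mass u \<le> 2 powr p * (Lp_gap (\<phi> k) u + Lp_mass (\<phi> k))"
        using p_integral_add_le[OF p_integrable_diff[OF u test_p_integrals(1)[OF \<phi>[of k]] p(1)] test_p_integrals(1)[OF \<phi>[of k]] p(1)]
        by (simp add: norm_minus_commute abs_minus_commute)
      also have "\<dots> \<le> 2 powr p * (Lp_gap (\<phi> k) u + C * Lp_mass (grad (\<phi> k)))"
        using C(2)[OF test_C1_closure[OF \<phi>[of k]]] by (simp add: test_p_integrals(3,4)[OF \<phi>[of k], simplified])
      also have "\<dots> \<le> 2 powr p * (Lp_gap (\<phi> k) u +
       C * (2 powr p * (Lp_gap (grad (\<phi> k)) G + Lp_mass G)))"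
        using p_integral_add_le[OF p_integrable_diff[OF test_p_integrals(2)[OF \<phi>[of k]] G p(1)] G p(1)] C(1)
        by (intro mult_left_mono add_left_mono) auto
      finally show ?thesis .
    qed
    have lims: "(\<lambda>k. 2 powr p * (Lp_gap (\<phi> k) u +
       C * (2 powr p * (Lp_gap (grad (\<phi> k)) G + Lp_mass G))))
       \<longlonglongrightarrow> 2 powr p * (0 + C * (2 powr p * (0 + Lp_mass G)))"
      by (intro tendsto_intros lim)
    have "Lp_mass u \<le> 2 powr p * (0 + C * (2 powr p * (0 + Lp_mass G)))"
      by (rule LIMSEQ_le_const[OF lims]) (intro exI allI impI bnd)
    then show ?thesis by (simp add: mult_ac)
  qed
  moreover have "0 < 2 powr p * (C * 2 powr p)" using C(1) by simp
  ultimately show ?thesis using that by blast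
qed

text \<open>
The sequence inherits the compactness of test functions within \<open>1/(n+1)\<close> of it.
\<close>
theorem Rellich:
  assumes W: "\<And>n. W0_pair (u n) (G n)" and bound: "\<And>n. Lp_mass (G n) \<le> E"
  obtains r :: "nat \<Rightarrow> nat" where "strict_mono r"
    "\<And>e. 0 < e \<Longrightarrow> \<exists>N. \<forall>m\<ge>N. \<forall>n\<ge>N. Lp_gap (u (r m)) (u (r n)) < e"
proof -
  have p: "0 \<le> p" "1 \<le> p" using p_gt_1 by auto
  obtain \<phi> where \<phi>: "\<And>n. \<phi> n \<in> test_functions \<Omega>"
    "\<And>n. Lp_gap (\<phi> n) (u n) < inverse (real (Suc n))"
    "\<And>n. Lp_gap (grad (\<phi> n)) (G n) < inverse (real (Suc n))"
    by (rule W0_pair_approx_sequence[of u G, OF W]) (rule that)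
  note ui = W0_pair_p_integrable(1)[OF W] note Gi = W0_pair_p_integrable(2)[OF W]
  note ti = test_p_integrals[OF \<phi>(1)]
  have inv1: "inverse (real (Suc n)) \<le> 1" for n by (simp add: inverse_le_1_iff)
  have gb: "(LBINT x. norm (grad (\<phi> n) x) powr p) \<le> 2 powr p * (1 + E)" for n
  proof -
    have "Lp_mass (grad (\<phi> n)) \<le> 2 powr p * (Lp_gap (grad (\<phi> n)) (G n) + Lp_mass (G n))"
      using p_integral_add_le[OF p_integrable_diff[OF ti(2)[of n] Gi[of n] p(1)] Gi[of n] p(1)] by simp
    also have "\<dots> \<le> 2 powr p * (1 + E)"
      using \<phi>(3)[of n] inv1[of n] bound[of n] by (intro mult_left_mono add_mono) auto
    finally show ?thesis using ti(4)[of n] by simp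
  qed
  obtain r :: "nat \<Rightarrow> nat" where r: "strict_mono r"
    and rC: "\<And>e. 0 < e \<Longrightarrow> \<exists>N. \<forall>m\<ge>N. \<forall>n\<ge>N. (LBINT x. \<bar>\<phi> (r m) x - \<phi> (r n) x\<bar> powr p) < e"
    by (rule Rellich_C1[of p "closure \<Omega>" \<phi> "\<lambda>n. grad (\<phi> n)", OF p(2) test_C1_closure[OF \<phi>(1)] gb]) (rule that)
  have main: "\<exists>N. \<forall>m\<ge>N. \<forall>n\<ge>N. Lp_gap (u (r m)) (u (r n)) < e" if e: "0 < e" for e
  proof -
    define d where "d = e / (2 powr p * (1 + 2 * 2 powr p))"
    have d: "0 < d" using e by (simp add: d_def add_pos_pos)
    obtain N1 where N1: "\<And>m n. m \<ge> N1 \<Longrightarrow> n \<ge> N1 \<Longrightarrow> (LBINT x. \<bar>\<phi> (r m) x - \<phi> (r n) x\<bar> powr p) < d"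
      using rC[OF d] by blast
    have "eventually (\<lambda>n. inverse (real (Suc n)) < d) sequentially"
      by (rule order_tendstoD(2)[OF LIMSEQ_inverse_real_of_nat d])
    then obtain N2 where N2: "\<And>n. n \<ge> N2 \<Longrightarrow> inverse (real (Suc n)) < d"
      by (auto simp: eventually_sequentially)
    show ?thesis
    proof (intro exI allI impI)
      fix m n assume mn: "max N1 N2 \<le> m" "max N1 N2 \<le> n"
      have "r m \<ge> m" "r n \<ge> n" using r by (simp_all add: seq_suble)
      then have rd: "inverse (real (Suc (r m))) < d" "inverse (real (Suc (r n))) < d"
        using N2 mn by auto
      have eq: "Lp_gap (\<phi> (r m)) (\<phi> (r n)) = (LBINT x. \<bar>\<phi> (r m) x - \<phi> (r n) x\<bar> powr p)"
      proof -
        have [measurable]: "\<phi> k \<in> borel_measurable borel" for k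
          by (rule C1_supported_measurable(1)[OF test_C1_closure[OF \<phi>(1)]])
        show ?thesis
          using test_outside(1)[OF \<phi>(1)] by (subst lebesgue_on_integral_eq_lborel(2)) (auto simp: domain_sets)
      qed
      have A: "Lp_gap (u (r m)) (\<phi> (r m)) < d" "Lp_gap (\<phi> (r n)) (u (r n)) < d"
        using \<phi>(2)[of "r m"] \<phi>(2)[of "r n"] rd by (auto simp: norm_minus_commute abs_minus_commute)
      have B: "Lp_gap (\<phi> (r m)) (\<phi> (r n)) < d"
        using N1[of m n] mn eq by simp
      have T1: "Lp_gap (\<phi> (r m)) (u (r n)) \<le> 2 powr p * (d + d)"
        by (rule order_trans[OF p_integral_triangle[OF ti(1)[of "r m"] ti(1)[of "r n"] ui[of "r n"] p(1)]])
           (intro mult_left_mono add_mono less_imp_le[OF B] less_imp_le[OF A(2)] powr_ge_zero)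
      have "Lp_gap (u (r m)) (u (r n)) < 2 powr p * (d + 2 powr p * (d + d))"
        by (rule le_less_trans[OF p_integral_triangle[OF ui[of "r m"] ti(1)[of "r m"] ui[of "r n"] p(1)]])
           (intro mult_strict_left_mono add_less_le_mono A(1) T1, simp)
      also have "\<dots> = (2 powr p * (1 + 2 * 2 powr p)) * d" by (simp add: algebra_simps)
      also have "\<dots> = e" unfolding d_def by (simp add: add_pos_pos less_imp_neq[symmetric])
      finally show "Lp_gap (u (r m)) (u (r n)) < e" .
    qed
  qed
  show ?thesis by (rule that[OF r]) (rule main)
qed

end

section \<open>The quasilinear operator and positivity of the eigenvalues\<close>

text \<open>
The structure conditions on \<open>a\<close> hold for each \<open>\<xi>\<close> outside a null set depending on \<open>\<xi>\<close>. Closed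
conditions can be imposed on a countable dense set of \<open>\<xi>\<close> and then hold for all \<open>\<xi>\<close> outside one null set.
\<close>
lemma AE_all_of_dense:
  fixes P :: "'a \<Rightarrow> 'b::second_countable_topology \<Rightarrow> bool"
  assumes closed: "AE x in M. closed {\<xi>. P x \<xi>}" and P: "\<And>\<xi>. AE x in M. P x \<xi>"
  shows "AE x in M. \<forall>\<xi>. P x \<xi>"
proof -
  obtain D :: "'b set" where D: "countable D" "\<And>X. open X \<Longrightarrow> X \<noteq> {} \<Longrightarrow> \<exists>d\<in>D. d \<in> X"
    by (rule countable_dense_setE) (rule that)
  have "AE x in M. \<forall>\<xi>\<in>D. P x \<xi>"
    using P by (simp add: AE_ball_countable[OF D(1)])
  with closed show ?thesis
  proof eventually_elim
    case (elim x)
    show ?case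
    proof (rule ccontr)
      assume "\<not> (\<forall>\<xi>. P x \<xi>)"
      then have "- {\<xi>. P x \<xi>} \<noteq> {}" by auto
      moreover have "open (- {\<xi>. P x \<xi>})" using elim by (simp add: open_Compl)
      ultimately show False using D(2) elim(2) by blast
    qed
  qed
qed

text \<open>
Approximate \<open>G\<close> by simple functions, for which the composition is measurable piece by piece; by continuity
the compositions converge almost everywhere, which suffices because Lebesgue measure is complete.
\<close>
lemma Caratheodory_measurable:
  fixes a :: "'a::euclidean_space \<Rightarrow> 'b::euclidean_space \<Rightarrow> 'c::euclidean_space"
  assumes S: "S \<in> sets lebesgue"
    and cont: "AE x in lebesgue_on S. continuous_on UNIV (a x)"
    and meas: "\<And>\<xi>. (\<lambda>x. a x \<xi>) \<in> borel_measurable (lebesgue_on S)"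
    and G: "G \<in> borel_measurable (lebesgue_on S)"
  shows "(\<lambda>x. a x (G x)) \<in> borel_measurable (lebesgue_on S)"
proof -
  let ?M = "lebesgue_on S"
  obtain F where F: "\<And>i. simple_function ?M (F i)" "\<And>x. x \<in> space ?M \<Longrightarrow> (\<lambda>i. F i x) \<longlonglongrightarrow> G x"
    using borel_measurable_implies_sequence_metric[OF G, of 0] by blast
  have [measurable]: "(\<lambda>x. a x (F i x)) \<in> borel_measurable ?M" for i
  proof (rule measurable_compose_countable'[where f="\<lambda>\<xi> x. a x \<xi>" and g="F i" and I="F i ` space ?M"])
    show "F i \<in> measurable ?M (count_space (F i ` space ?M))"
      using simple_functionD[OF F(1)[of i]] by (subst measurable_count_space_eq2) auto
    show "countable (F i ` space ?M)"
      using simple_functionD(1)[OF F(1)[of i]] by (rule countable_finite)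
  qed (rule meas)
  have m: "(\<lambda>x. lim (\<lambda>i. a x (F i x))) \<in> borel_measurable ?M"
    by (rule borel_measurable_lim_metric) measurable
  have "AE x in ?M. lim (\<lambda>i. a x (F i x)) = a x (G x)"
    using cont AE_space
  proof eventually_elim
    case (elim x)
    have "(\<lambda>i. a x (F i x)) \<longlonglongrightarrow> a x (G x)"
      by (rule continuous_on_tendsto_compose[OF elim(1) F(2)[OF elim(2)]]) auto
    then show ?case by (rule limI)
  qed
  then show ?thesis
    by (rule borel_measurable_lebesgue_on_AE[OF S m])
qed

text \<open>
The nonlinearity \<open>\<bar>t\<bar>\<^sup>p\<^sup>-\<^sup>2 t\<close>, which extends continuously by \<open>0\<close> to \<open>t = 0\<close> when \<open>p > 1\<close>.
\<close>
definition signed_powr :: "real \<Rightarrow> real \<Rightarrow> real" where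
  "signed_powr p t = \<bar>t\<bar> powr (p - 2) * t"

lemma abs_signed_powr: "\<bar>signed_powr p t\<bar> = \<bar>t\<bar> powr (p - 1)"
proof (cases "t = 0")
  case False
  then have "\<bar>t\<bar> powr (p - 2) * \<bar>t\<bar> powr 1 = \<bar>t\<bar> powr (p - 1)"
    by (subst powr_add[symmetric]) (simp add: algebra_simps)
  with False show ?thesis by (simp add: signed_powr_def abs_mult)
qed (simp add: signed_powr_def)

lemma signed_powr_mult_self: "signed_powr p t * t = \<bar>t\<bar> powr p"
proof (cases "t = 0")
  case False
  then have "\<bar>t\<bar> powr (p - 2) * \<bar>t\<bar> powr 2 = \<bar>t\<bar> powr p"
    by (subst powr_add[symmetric]) simp
  moreover have "\<bar>t\<bar> powr 2 = t * t"
    using False by (simp add: power2_eq_square)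
  ultimately show ?thesis by (simp add: signed_powr_def mult.assoc)
qed (simp add: signed_powr_def)

lemma signed_powr_scale:
  assumes "0 < s"
  shows "signed_powr p (s * t) = s powr (p - 1) * signed_powr p t"
proof -
  have "s powr (p - 2) * s powr 1 = s powr (p - 1)"
    by (subst powr_add[symmetric]) (simp add: algebra_simps)
  with assms show ?thesis
    by (simp add: signed_powr_def abs_mult powr_mult mult_ac)
qed

lemma tendsto_signed_powr:
  assumes "(f \<longlongrightarrow> t) F" "1 < p"
  shows "((\<lambda>x. signed_powr p (f x)) \<longlongrightarrow> signed_powr p t) F"
proof (cases "t = 0")
  case True
  have "((\<lambda>x. \<bar>f x\<bar> powr (p - 1)) \<longlongrightarrow> \<bar>t\<bar> powr (p - 1)) F"
    using assms by (intro tendsto_powr' tendsto_rabs tendsto_const) auto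
  then have "((\<lambda>x. \<bar>signed_powr p (f x)\<bar>) \<longlongrightarrow> 0) F"
    using True by (simp add: abs_signed_powr)
  then show ?thesis
    using True by (simp add: tendsto_rabs_zero_iff signed_powr_def)
next
  case False
  then show ?thesis
    unfolding signed_powr_def using assms by (intro tendsto_mult tendsto_powr tendsto_rabs tendsto_const) auto
qed

text \<open>
This turns the degenerate strong monotonicity into a linear bound that can be integrated at once. Either
\<open>d\<^sup>p \<le> e Psi\<close>, or \<open>Psi\<close> is at most \<open>d\<^sup>p / e\<close>; as the exponent \<open>1 - max 2 p / p\<close> is not positive, inserting the
latter in the hypothesis leaves a multiple of \<open>d\<^sup>p\<close> on its left side. The cases \<open>p < 2\<close> and \<open>p \<ge> 2\<close> need no distinction.
\<close>
lemma monotonicity_gap: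
  fixes \<alpha> d Psi D p e :: real
  assumes p: "1 < p" and \<alpha>: "0 < \<alpha>" and e: "0 < e" and d: "0 \<le> d" and Psi: "0 < Psi"
    and H: "\<alpha> * d powr (max 2 p) * Psi powr (1 - max 2 p / p) \<le> D"
  shows "d powr p \<le> e * Psi + (e powr (1 - max 2 p / p) / \<alpha>) * D"
proof -
  define \<gamma> where "\<gamma> = max 2 p"
  define q where "q = 1 - \<gamma> / p"
  have q: "q \<le> 0" using p by (simp add: q_def \<gamma>_def)
  have D0: "0 \<le> D"
    by (rule order_trans[OF _ H]) (use \<alpha> in simp)
  show ?thesis
  proof (cases "d powr p \<le> e * Psi")
    case True
    have "0 \<le> (e powr q / \<alpha>) * D" using \<alpha> D0 by simp
    with True show ?thesis by (simp add: q_def \<gamma>_def)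
  next
    case False
    then have lt: "Psi \<le> d powr p / e" using e by (simp add: field_simps)
    have "d powr p = d powr \<gamma> * d powr (p * q)"
      using p by (subst powr_add[symmetric]) (simp add: q_def right_diff_distrib)
    also have "\<dots> = e powr q * (d powr \<gamma> * (d powr p / e) powr q)"
      using e by (simp add: powr_divide powr_powr)
    also have "\<dots> \<le> e powr q * (d powr \<gamma> * Psi powr q)"
      using powr_mono2'[OF q Psi lt] by (intro mult_left_mono) auto
    also have "\<dots> \<le> e powr q * (D / \<alpha>)"
      using H \<alpha> by (intro mult_left_mono) (auto simp: \<gamma>_def q_def field_simps)
    also have "\<dots> \<le> e * Psi + (e powr q / \<alpha>) * D"
      using e Psi by simp
    finally show ?thesis by (simp add: q_def \<gamma>_def)
  qed
qed

locale quasilinear_eigenproblem = bounded_open_domain \<Omega> p for \<Omega> :: "(real^'n) set" and p :: real +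
  fixes a :: "real^'n \<Rightarrow> real^'n \<Rightarrow> real^'n" and \<rho> :: "real^'n \<Rightarrow> real" and \<alpha> \<beta> \<rho>minus \<rho>plus :: real
  assumes rho_meas: "\<rho> \<in> borel_measurable (lebesgue_on \<Omega>)"
    and rho_pos: "0 < \<rho>minus"
    and rho_bounds: "AE x in lebesgue_on \<Omega>. \<rho>minus \<le> \<rho> x \<and> \<rho> x \<le> \<rho>plus"
    and alpha_pos: "0 < \<alpha>" and beta_pos: "0 < \<beta>"
    and a_continuous: "AE x in lebesgue_on \<Omega>. continuous_on UNIV (a x)"
    and a_measurable: "\<And>\<xi>. (\<lambda>x. a x \<xi>) \<in> borel_measurable (lebesgue_on \<Omega>)"
    and a_coercive_each: "\<And>\<xi>. AE x in lebesgue_on \<Omega>. \<alpha> * norm \<xi> powr p \<le> a x \<xi> \<bullet> \<xi>"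
    and a_growth_each: "\<And>\<xi>. AE x in lebesgue_on \<Omega>. norm (a x \<xi>) \<le> \<beta> * norm \<xi> powr (p - 1)"
    and a_homogeneous_each: "\<And>t \<xi>. 0 < t \<Longrightarrow>
               AE x in lebesgue_on \<Omega>. a x (t *\<^sub>R \<xi>) = t powr (p - 1) *\<^sub>R a x \<xi>"
    and a_strongly_monotone_each: "\<And>\<xi>1 \<xi>2. (\<xi>1, \<xi>2) \<noteq> (0, 0) \<Longrightarrow> AE x in lebesgue_on \<Omega>.
               \<alpha> * norm (\<xi>1 - \<xi>2) powr (max 2 p) * Psi a x \<xi>1 \<xi>2 powr (1 - max 2 p / p)
                   \<le> (a x \<xi>1 - a x \<xi>2) \<bullet> (\<xi>1 - \<xi>2)"
begin

abbreviation a_form :: "(real^'n \<Rightarrow> real^'n) \<Rightarrow> (real^'n \<Rightarrow> real^'n) \<Rightarrow> real" where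
  "a_form G H \<equiv> \<integral>x. a x (G x) \<bullet> H x \<partial>M"

abbreviation rho_form :: "(real^'n \<Rightarrow> real) \<Rightarrow> (real^'n \<Rightarrow> real) \<Rightarrow> real" where
  "rho_form u v \<equiv> \<integral>x. \<rho> x * signed_powr p (u x) * v x \<partial>M"

lemma norm_powr_continuous: "0 < q \<Longrightarrow> continuous_on UNIV (\<lambda>\<xi>::real^'n. norm \<xi> powr q)"
  by (intro continuous_on_powr' continuous_intros) auto

lemma a_coercive: "AE x in M. \<forall>\<xi>. \<alpha> * norm \<xi> powr p \<le> a x \<xi> \<bullet> \<xi>"
proof (rule AE_all_of_dense[OF _ a_coercive_each])
  show "AE x in M. closed {\<xi>. \<alpha> * norm \<xi> powr p \<le> a x \<xi> \<bullet> \<xi>}"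
    using a_continuous
    by eventually_elim (use p_gt_1 in \<open>intro closed_Collect_le continuous_intros norm_powr_continuous; simp\<close>)
qed

lemma a_growth: "AE x in M. \<forall>\<xi>. norm (a x \<xi>) \<le> \<beta> * norm \<xi> powr (p - 1)"
proof (rule AE_all_of_dense[OF _ a_growth_each])
  show "AE x in M. closed {\<xi>. norm (a x \<xi>) \<le> \<beta> * norm \<xi> powr (p - 1)}"
    using a_continuous
    by eventually_elim (use p_gt_1 in \<open>intro closed_Collect_le continuous_intros norm_powr_continuous; simp\<close>)
qed

lemma a_homogeneous:
  assumes "0 < t"
  shows "AE x in M. \<forall>\<xi>. a x (t *\<^sub>R \<xi>) = t powr (p - 1) *\<^sub>R a x \<xi>"
proof (rule AE_all_of_dense[OF _ a_homogeneous_each[OF assms]])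
  show "AE x in M. closed {\<xi>. a x (t *\<^sub>R \<xi>) = t powr (p - 1) *\<^sub>R a x \<xi>}"
    using a_continuous
  proof eventually_elim
    case (elim x)
    have "continuous_on UNIV (\<lambda>\<xi>. a x (t *\<^sub>R \<xi>))"
      by (rule continuous_on_compose2[OF elim]) (auto intro: continuous_intros)
    then show ?case
      using elim by (intro closed_Collect_eq continuous_on_scaleR continuous_on_const)
  qed
qed

text \<open>
Unlike strong monotonicity itself, whose power of \<open>Psi\<close> may be singular at the origin, the integrated form is a closed
condition on pairs of vectors, so it holds for all of them off one null set. At the origin both sides vanish.
\<close>
lemma a_monotonicity_gap:
  assumes e: "0 < e"
  shows "AE x in M. \<forall>z. norm (fst z - snd z) powr p \<le> e * Psi a x (fst z) (snd z) +
    (e powr (1 - max 2 p / p) / \<alpha>) * ((a x (fst z) - a x (snd z)) \<bullet> (fst z - snd z))"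
proof (rule AE_all_of_dense)
  show "AE x in M. closed {z. norm (fst z - snd z) powr p \<le> e * Psi a x (fst z) (snd z) +
    (e powr (1 - max 2 p / p) / \<alpha>) * ((a x (fst z) - a x (snd z)) \<bullet> (fst z - snd z))}"
    using a_continuous
  proof eventually_elim
    case (elim x)
    have 1: "continuous_on UNIV (\<lambda>z :: (real^'n) \<times> (real^'n). a x (fst z))"
      by (rule continuous_on_compose2[OF elim]) (auto intro: continuous_intros)
    have 2: "continuous_on UNIV (\<lambda>z :: (real^'n) \<times> (real^'n). a x (snd z))"
      by (rule continuous_on_compose2[OF elim]) (auto intro: continuous_intros)
    have 3: "continuous_on UNIV (\<lambda>z :: (real^'n) \<times> (real^'n). norm (fst z - snd z) powr p)"
      using p_gt_1 by (intro continuous_on_norm_powr continuous_intros) auto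
    show ?case
      unfolding Psi_def by (intro closed_Collect_le continuous_intros 1 2 3)
  qed
  fix z :: "(real^'n) \<times> (real^'n)"
  obtain \<xi>1 \<xi>2 where z: "z = (\<xi>1, \<xi>2)" by (cases z)
  show "AE x in M. norm (fst z - snd z) powr p \<le> e * Psi a x (fst z) (snd z) +
    (e powr (1 - max 2 p / p) / \<alpha>) * ((a x (fst z) - a x (snd z)) \<bullet> (fst z - snd z))"
  proof (cases "(\<xi>1, \<xi>2) = (0, 0)")
    case True
    then show ?thesis by (simp add: z Psi_def)
  next
    case False
    show ?thesis
      using a_strongly_monotone_each[OF False] a_coercive
    proof eventually_elim
      case (elim x)
      have "0 < \<alpha> * norm \<xi>1 powr p + \<alpha> * norm \<xi>2 powr p"
        using False alpha_pos by (cases "\<xi>1 = 0") (auto intro: add_pos_nonneg)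
      also have "\<dots> \<le> Psi a x \<xi>1 \<xi>2"
        using elim(2) unfolding Psi_def by (intro add_mono) auto
      finally have "0 < Psi a x \<xi>1 \<xi>2" .
      from monotonicity_gap[OF p_gt_1 alpha_pos e norm_ge_zero this elim(1)]
      show ?case by (simp add: z)
    qed
  qed
qed

lemma a_comp_measurable:
  "p_integrable M p G \<Longrightarrow> (\<lambda>x. a x (G x)) \<in> borel_measurable M"
  by (rule Caratheodory_measurable[OF domain_sets a_continuous a_measurable p_integrable_measurable])

lemma a_pairing_bound:
  "AE x in M. \<forall>\<xi> \<eta>. \<bar>a x \<xi> \<bullet> \<eta>\<bar> \<le> \<beta> * (norm \<xi> powr p + norm \<eta> powr p)"
  using a_growth
proof eventually_elim
  case (elim x)
  show ?case
  proof (intro allI)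
    fix \<xi> \<eta> :: "real^'n"
    have "\<bar>a x \<xi> \<bullet> \<eta>\<bar> \<le> norm (a x \<xi>) * norm \<eta>" by (rule Cauchy_Schwarz_ineq2)
    also have "\<dots> \<le> (\<beta> * norm \<xi> powr (p - 1)) * norm \<eta>"
      using elim by (intro mult_right_mono) auto
    also have "\<dots> = \<beta> * (norm \<xi> powr (p - 1) * norm \<eta>)" by simp
    also have "\<dots> \<le> \<beta> * (norm \<xi> powr p + norm \<eta> powr p)"
      using beta_pos p_gt_1 by (intro mult_left_mono Young_powr) auto
    finally show "\<bar>a x \<xi> \<bullet> \<eta>\<bar> \<le> \<beta> * (norm \<xi> powr p + norm \<eta> powr p)" .
  qed
qed

lemma a_pairing_integrable:
  assumes G: "p_integrable M p G" and H: "p_integrable M p H"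
  shows "integrable M (\<lambda>x. a x (G x) \<bullet> H x)"
proof (rule Bochner_Integration.integrable_bound)
  show "integrable M (\<lambda>x. \<beta> * (norm (G x) powr p + norm (H x) powr p))"
    using p_integrable_integrable[OF G] p_integrable_integrable[OF H] by simp
  show "(\<lambda>x. a x (G x) \<bullet> H x) \<in> borel_measurable M"
    using a_comp_measurable[OF G] p_integrable_measurable[OF H] by (rule borel_measurable_inner)
  show "AE x in M. norm (a x (G x) \<bullet> H x) \<le> norm (\<beta> * (norm (G x) powr p + norm (H x) powr p))"
    using a_pairing_bound by eventually_elim (use beta_pos in simp)
qed

lemma signed_powr_measurable [measurable]: "signed_powr p \<in> borel_measurable borel"
  unfolding signed_powr_def[abs_def] by measurable

lemma rho_abs: "AE x in M. \<bar>\<rho> x\<bar> \<le> \<rho>plus"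
  using rho_bounds by eventually_elim (use rho_pos in auto)

lemma weight_bound:
  "AE x in M. \<forall>s t. \<bar>\<rho> x * signed_powr p s * t\<bar> \<le> \<rho>plus * (\<bar>s\<bar> powr p + \<bar>t\<bar> powr p)"
  using rho_abs
proof eventually_elim
  case (elim x)
  show ?case
  proof (intro allI)
    fix s t
    have "\<bar>\<rho> x * signed_powr p s * t\<bar> = \<bar>\<rho> x\<bar> * (\<bar>s\<bar> powr (p - 1) * \<bar>t\<bar>)"
      by (simp add: abs_mult abs_signed_powr)
    also have "\<dots> \<le> \<rho>plus * (\<bar>s\<bar> powr p + \<bar>t\<bar> powr p)"
      using elim p_gt_1 by (intro mult_mono Young_powr) auto
    finally show "\<bar>\<rho> x * signed_powr p s * t\<bar> \<le> \<rho>plus * (\<bar>s\<bar> powr p + \<bar>t\<bar> powr p)" .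
  qed
qed

lemma weight_measurable:
  assumes u: "p_integrable M p u" and v: "p_integrable M p v"
  shows "(\<lambda>x. \<rho> x * signed_powr p (u x) * v x) \<in> borel_measurable M"
proof -
  have [measurable]: "u \<in> borel_measurable M" "v \<in> borel_measurable M" "\<rho> \<in> borel_measurable M"
    using u v rho_meas by (auto simp: p_integrable_def)
  show ?thesis by measurable
qed

lemma weight_integrable:
  assumes u: "p_integrable M p u" and v: "p_integrable M p v"
  shows "integrable M (\<lambda>x. \<rho> x * signed_powr p (u x) * v x)"
proof (rule Bochner_Integration.integrable_bound[OF _ weight_measurable[OF u v]])
  show "integrable M (\<lambda>x. \<rho>plus * (\<bar>u x\<bar> powr p + \<bar>v x\<bar> powr p))"
    using p_integrable_integrable[OF u] p_integrable_integrable[OF v] by simp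
  show "AE x in M. norm (\<rho> x * signed_powr p (u x) * v x) \<le> norm (\<rho>plus * (\<bar>u x\<bar> powr p + \<bar>v x\<bar> powr p))"
    using weight_bound by eventually_elim (smt (verit) real_norm_def)
qed

text \<open>
Weak solutions expressed through pairs; by \<open>weak_solution_iff\<close> the choice of \<open>G\<close> is immaterial.
\<close>
definition weak_form :: "real \<Rightarrow> (real^'n \<Rightarrow> real) \<Rightarrow> (real^'n \<Rightarrow> real^'n) \<Rightarrow> bool" where
  "weak_form l u G \<longleftrightarrow> (\<forall>v H. W0_pair v H \<longrightarrow>
     a_form G H = l * rho_form u v)"

lemma weak_solution_iff:
  assumes W: "W0_pair u G"
  shows "weak_solution p \<Omega> a \<rho> l u \<longleftrightarrow> weak_form l u G"
proof -
  have wu: "p_integrable M p (wgrad \<Omega> u)"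
    by (rule W0_pair_p_integrable(2)[OF W1p_0_imp_W0_pair[OF W0_pair_imp_W1p_0[OF W]]])
  have eq: "a_form (wgrad \<Omega> u) (wgrad \<Omega> v) = a_form G H" if V: "W0_pair v H" for v H
  proof (intro integral_cong_AE borel_measurable_integrable a_pairing_integrable wu)
    show "p_integrable M p G" "p_integrable M p H"
      using W0_pair_p_integrable W V by blast+
    show "p_integrable M p (wgrad \<Omega> v)"
      by (rule W0_pair_p_integrable(2)[OF W1p_0_imp_W0_pair[OF W0_pair_imp_W1p_0[OF V]]])
    show "AE x in M. a x (wgrad \<Omega> u x) \<bullet> wgrad \<Omega> v x = a x (G x) \<bullet> H x"
      using wgrad_AE_eq[OF W0_pair_weak_gradient[OF W]] wgrad_AE_eq[OF W0_pair_weak_gradient[OF V]]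
      by eventually_elim simp
  qed
  have r: "(\<lambda>x. \<rho> x * \<bar>u x\<bar> powr (p - 2) * u x * v x) = (\<lambda>x. \<rho> x * signed_powr p (u x) * v x)" for v
    by (simp add: signed_powr_def mult.assoc)
  show ?thesis
  proof
    assume L: "weak_solution p \<Omega> a \<rho> l u"
    show "weak_form l u G"
      unfolding weak_form_def
    proof (intro allI impI)
      fix v H assume V: "W0_pair v H"
      show "a_form G H = l * rho_form u v"
        using L W0_pair_imp_W1p_0[OF V] unfolding weak_solution_def r eq[OF V, symmetric] by blast
    qed
  next
    assume R: "weak_form l u G"
    have "a_form (wgrad \<Omega> u) (wgrad \<Omega> v) = l * rho_form u v"
      if v: "v \<in> W1p_0 p \<Omega>" for v
      using R W1p_0_imp_W0_pair[OF v] eq[OF W1p_0_imp_W0_pair[OF v]] by (simp add: weak_form_def)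
    then show "weak_solution p \<Omega> a \<rho> l u"
      unfolding weak_solution_def r using W0_pair_imp_W1p_0[OF W] by blast
  qed
qed

text \<open>
By homogeneity an eigenfunction can be multiplied by \<open>(\<integral> \<bar>u\<bar>\<^sup>p) powr (-1/p)\<close>. The normalisation replaces
the condition of being nonzero, which would not survive limits.
\<close>
lemma eigenvalues_iff:
  "l \<in> eigenvalues p \<Omega> a \<rho> \<longleftrightarrow> (\<exists>u G. W0_pair u G \<and> weak_form l u G \<and> Lp_mass u = 1)"
proof
  assume "l \<in> eigenvalues p \<Omega> a \<rho>"
  then obtain u where sol: "weak_solution p \<Omega> a \<rho> l u" and nz: "\<not> (AE x in M. u x = 0)"
    by (auto simp: eigenvalues_def)
  define G where "G = wgrad \<Omega> u"
  have W: "W0_pair u G"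
    using sol W1p_0_imp_W0_pair by (simp add: weak_solution_def G_def)
  have form: "weak_form l u G" using sol weak_solution_iff[OF W] by simp
  note up = W0_pair_p_integrable(1)[OF W]
  define s where "s = Lp_mass u"
  have "s \<noteq> 0"
  proof
    assume "s = 0"
    then have "AE x in M. norm (u x) powr p = 0"
      unfolding s_def using p_integrable_integrable[OF up]
      by (subst (asm) integral_nonneg_eq_0_iff_AE) auto
    then have "AE x in M. u x = 0" by eventually_elim simp
    with nz show False by simp
  qed
  moreover have "0 \<le> s" by (simp add: s_def)
  ultimately have s: "0 < s" by simp
  define t where "t = s powr (- 1 / p)"
  have t: "0 < t" using s by (simp add: t_def)
  have tp: "t powr p * s = 1"
  proof -
    have "t powr p = s powr (- 1)"
      unfolding t_def powr_powr using p_gt_1 by simp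
    then show ?thesis using s by (simp add: powr_minus)
  qed
  have "weak_form l (\<lambda>x. t * u x) (\<lambda>x. t *\<^sub>R G x)"
    unfolding weak_form_def
  proof (intro allI impI)
    fix v H assume V: "W0_pair v H"
    have i: "integrable M (\<lambda>x. a x (t *\<^sub>R G x) \<bullet> H x)"
      by (intro a_pairing_integrable p_integrable_scaleR W0_pair_p_integrable(2)[OF W] W0_pair_p_integrable(2)[OF V])
    have i': "integrable M (\<lambda>x. a x (G x) \<bullet> H x)"
      by (intro a_pairing_integrable W0_pair_p_integrable(2)[OF W] W0_pair_p_integrable(2)[OF V])
    have "(\<integral>x. a x (t *\<^sub>R G x) \<bullet> H x \<partial>M) = (\<integral>x. t powr (p - 1) * (a x (G x) \<bullet> H x) \<partial>M)"
    proof (rule integral_cong_AE)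
      show "AE x in M. a x (t *\<^sub>R G x) \<bullet> H x = t powr (p - 1) * (a x (G x) \<bullet> H x)"
        using a_homogeneous[OF t] by eventually_elim simp
    qed (use i i' in auto)
    also have "\<dots> = t powr (p - 1) * (l * rho_form u v)"
      using form V by (simp add: weak_form_def)
    also have "\<dots> = l * (\<integral>x. t powr (p - 1) * (\<rho> x * signed_powr p (u x) * v x) \<partial>M)"
      by simp
    also have "(\<lambda>x. t powr (p - 1) * (\<rho> x * signed_powr p (u x) * v x)) = (\<lambda>x. \<rho> x * signed_powr p (t * u x) * v x)"
      by (simp add: signed_powr_scale[OF t] mult_ac)
    finally show "(\<integral>x. a x (t *\<^sub>R G x) \<bullet> H x \<partial>M) = l * (\<integral>x. \<rho> x * signed_powr p (t * u x) * v x \<partial>M)" .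
  qed
  moreover have "(\<integral>x. norm (t * u x) powr p \<partial>M) = 1"
    using t tp by (simp add: abs_mult powr_mult s_def)
  ultimately show "\<exists>u G. W0_pair u G \<and> weak_form l u G \<and> Lp_mass u = 1"
    using W0_pair_scale[OF W, of t] by blast
next
  assume "\<exists>u G. W0_pair u G \<and> weak_form l u G \<and> Lp_mass u = 1"
  then obtain u G where W: "W0_pair u G" and form: "weak_form l u G" and 1: "Lp_mass u = 1"
    by blast
  have "\<not> (AE x in M. u x = 0)"
  proof
    assume "AE x in M. u x = 0"
    then have "AE x in M. norm (u x) powr p = 0" by eventually_elim simp
    then have "Lp_mass u = 0" by (rule integral_eq_zero_AE)
    with 1 show False by simp
  qed
  with weak_solution_iff[OF W] form show "l \<in> eigenvalues p \<Omega> a \<rho>"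
    by (auto simp: eigenvalues_def)
qed

lemma weight_self_bounds:
  assumes u: "p_integrable M p u"
  shows "\<rho>minus * Lp_mass u \<le> rho_form u u"
    and "rho_form u u \<le> \<rho>plus * Lp_mass u"
proof -
  have i: "integrable M (\<lambda>x. c * norm (u x) powr p)" for c
    using p_integrable_integrable[OF u] by simp
  have w: "\<rho> x * signed_powr p (u x) * u x = \<rho> x * norm (u x) powr p" for x
    by (simp add: mult.assoc signed_powr_mult_self)
  have "(\<integral>x. \<rho>minus * norm (u x) powr p \<partial>M) \<le> rho_form u u"
    by (rule integral_mono_AE[OF i weight_integrable[OF u u]], unfold w)
       (use rho_bounds in \<open>eventually_elim, auto intro: mult_right_mono\<close>)
  then show "\<rho>minus * Lp_mass u \<le> rho_form u u" by simp
  have "rho_form u u \<le> (\<integral>x. \<rho>plus * norm (u x) powr p \<partial>M)"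
    by (rule integral_mono_AE[OF weight_integrable[OF u u] i], unfold w)
       (use rho_bounds in \<open>eventually_elim, auto intro: mult_right_mono\<close>)
  then show "rho_form u u \<le> \<rho>plus * Lp_mass u" by simp
qed

lemma energy_bound:
  assumes W: "W0_pair u G" and form: "weak_form l u G"
  shows "\<alpha> * Lp_mass G \<le> l * rho_form u u"
proof -
  note G = W0_pair_p_integrable(2)[OF W]
  have "(\<integral>x. \<alpha> * norm (G x) powr p \<partial>M) \<le> a_form G G"
  proof (rule integral_mono_AE[OF _ a_pairing_integrable[OF G G]])
    show "AE x in M. \<alpha> * norm (G x) powr p \<le> a x (G x) \<bullet> G x"
      using a_coercive by eventually_elim simp
  qed (use p_integrable_integrable[OF G] in simp)
  also have "\<dots> = l * rho_form u u"
    using form W by (simp add: weak_form_def)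
  finally show ?thesis by simp
qed

text \<open>
By the Poincare inequality the energy of a normalised eigenfunction is positive, and by \<open>energy_bound\<close> it is
at most \<open>l\<close> times a positive number.
\<close>
theorem eigenvalues_positive:
  assumes "l \<in> eigenvalues p \<Omega> a \<rho>"
  shows "0 < l"
proof -
  obtain u G where W: "W0_pair u G" and form: "weak_form l u G" and 1: "Lp_mass u = 1"
    using assms eigenvalues_iff by blast
  obtain C where C: "0 < C" "Lp_mass u \<le> C * Lp_mass G"
    using Poincare W by metis
  have "0 < Lp_mass G"
    using C 1 by (metis less_le_trans zero_less_mult_pos zero_less_one)
  then have "0 < l * rho_form u u"
    using energy_bound[OF W form] alpha_pos by (meson less_le_trans mult_pos_pos)
  moreover have "0 < rho_form u u"
    using weight_self_bounds(1)[OF W0_pair_p_integrable(1)[OF W]] 1 rho_pos by simp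
  ultimately show ?thesis by (simp add: zero_less_mult_iff)
qed

section \<open>Limits of eigenvalues\<close>

lemma weight_difference_bound:
  assumes u: "p_integrable M p u" and v: "p_integrable M p v" and e: "0 < e"
  shows "\<bar>rho_form u v\<bar> \<le>
    \<rho>plus * (e * Lp_mass u + e powr (1 - p) * Lp_mass v)"
proof -
  note iu = p_integrable_integrable[OF u] and iv = p_integrable_integrable[OF v]
  let ?b = "\<lambda>x. \<rho>plus * (e * norm (u x) powr p + e powr (1 - p) * norm (v x) powr p)"
  have i: "integrable M ?b" using iu iv by simp
  have "\<bar>rho_form u v\<bar> \<le> (\<integral>x. \<bar>\<rho> x * signed_powr p (u x) * v x\<bar> \<partial>M)"
    by (rule integral_abs_bound)
  also have "\<dots> \<le> (\<integral>x. ?b x \<partial>M)"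
  proof (rule integral_mono_AE[OF integrable_abs[OF weight_integrable[OF u v]] i])
    show "AE x in M. \<bar>\<rho> x * signed_powr p (u x) * v x\<bar> \<le> ?b x"
      using rho_abs
    proof eventually_elim
      case (elim x)
      have "\<bar>\<rho> x * signed_powr p (u x) * v x\<bar> = \<bar>\<rho> x\<bar> * (\<bar>u x\<bar> powr (p - 1) * \<bar>v x\<bar>)"
        by (simp add: abs_mult abs_signed_powr)
      also have "\<dots> \<le> \<rho>plus * (e * \<bar>u x\<bar> powr p + e powr (1 - p) * \<bar>v x\<bar> powr p)"
        using elim p_gt_1 e by (intro mult_mono Young_powr_eps) auto
      finally show ?case by simp
    qed
  qed
  also have "\<dots> = \<rho>plus * (e * Lp_mass u + e powr (1 - p) * Lp_mass v)"
    using iu iv by simp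
  finally show ?thesis .
qed

text \<open>
Integrating \<open>a_monotonicity_gap\<close> bounds \<open>\<integral> \<bar>G - H\<bar>\<^sup>p\<close> by the energies, times \<open>e\<close>, plus a multiple of
\<open>\<integral> (a(x, G) - a(x, H)) \<bullet> (G - H)\<close>. The weak equations, tested with \<open>u\<close> and with \<open>v\<close>, express the latter as
\<open>l \<integral> \<rho> \<bar>u\<bar>\<^sup>p\<^sup>-\<^sup>2 u (u - v) - m \<integral> \<rho> \<bar>v\<bar>\<^sup>p\<^sup>-\<^sup>2 v (u - v)\<close>, which \<open>weight_difference_bound\<close> makes small with \<open>u - v\<close>.
\<close>
lemma gradient_difference_bound:
  assumes Wu: "W0_pair u G" and Wv: "W0_pair v H"
    and fu: "weak_form l u G" and fv: "weak_form m v H"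
    and nu: "Lp_mass u = 1" and nv: "Lp_mass v = 1"
    and L: "\<bar>l\<bar> \<le> L" "\<bar>m\<bar> \<le> L" and e: "0 < e" and d: "0 < d"
  defines "C \<equiv> e powr (1 - max 2 p / p) / \<alpha>"
  shows "Lp_gap G H \<le> e * (2 * L * \<rho>plus) +
    C * (2 * L * \<rho>plus * (d + d powr (1 - p) * Lp_gap u v))"
proof -
  note u = W0_pair_p_integrable(1)[OF Wu] and v = W0_pair_p_integrable(1)[OF Wv]
  note G = W0_pair_p_integrable(2)[OF Wu] and H = W0_pair_p_integrable(2)[OF Wv]
  have p0: "0 \<le> p" using p_gt_1 by simp
  have C: "0 \<le> C" using alpha_pos by (simp add: C_def)
  have L0: "0 \<le> L" using L(1) by linarith
  have uv: "p_integrable M p (\<lambda>x. u x - v x)" by (rule p_integrable_diff[OF u v p0])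
  define A where "A G' H' = a_form G' H'" for G' H' :: "real^'n \<Rightarrow> real^'n"
  define B where "B u' v' = rho_form u' v'" for u' v'
  have self: "0 \<le> B w w" "B w w \<le> \<rho>plus" if "p_integrable M p w" "Lp_mass w = 1" for w
    using weight_self_bounds[OF that(1)] that(2) rho_pos by (auto simp: B_def)
  have AB: "A G G = l * B u u" "A G H = l * B u v" "A H G = m * B v u" "A H H = m * B v v"
    using fu fv Wu Wv by (auto simp: weak_form_def A_def B_def)
  have gap: "Lp_gap G H \<le> e * (A G G + A H H) + C * (A G G - A G H - A H G + A H H)"
  proof -
    note i = a_pairing_integrable[OF G G] a_pairing_integrable[OF G H] a_pairing_integrable[OF H G] a_pairing_integrable[OF H H]
    have "Lp_gap G H \<le> (\<integral>x. e * (a x (G x) \<bullet> G x + a x (H x) \<bullet> H x) +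
        C * (a x (G x) \<bullet> G x - a x (G x) \<bullet> H x - a x (H x) \<bullet> G x + a x (H x) \<bullet> H x) \<partial>M)"
    proof (rule integral_mono_AE[OF p_integrable_integrable[OF p_integrable_diff[OF G H p0]]])
      show "AE x in M. norm (G x - H x) powr p \<le> e * (a x (G x) \<bullet> G x + a x (H x) \<bullet> H x) +
        C * (a x (G x) \<bullet> G x - a x (G x) \<bullet> H x - a x (H x) \<bullet> G x + a x (H x) \<bullet> H x)"
        using a_monotonicity_gap[OF e]
      proof eventually_elim
        case (elim x)
        have "(a x (G x) - a x (H x)) \<bullet> (G x - H x) =
            a x (G x) \<bullet> G x - a x (G x) \<bullet> H x - a x (H x) \<bullet> G x + a x (H x) \<bullet> H x"
          by (simp add: inner_diff_left inner_diff_right)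
        then show ?case
          using elim[rule_format, of "(G x, H x)"] by (simp add: Psi_def C_def)
      qed
    qed (use i in simp)
    also have "\<dots> = e * (A G G + A H H) + C * (A G G - A G H - A H G + A H H)"
      unfolding A_def using i by simp
    finally show ?thesis .
  qed
  have "A G G \<le> L * \<rho>plus" "A H H \<le> L * \<rho>plus"
    unfolding AB using self[OF u nu] self[OF v nv] L L0 by (auto intro!: mult_mono)
  then have 1: "e * (A G G + A H H) \<le> e * (2 * L * \<rho>plus)"
    using e by (intro mult_left_mono) auto
  define T where "T = \<rho>plus * (d + d powr (1 - p) * Lp_gap u v)"
  have Bu: "B u u - B u v = (\<integral>x. \<rho> x * signed_powr p (u x) * (u x - v x) \<partial>M)"
    unfolding B_def right_diff_distrib using weight_integrable[OF u u] weight_integrable[OF u v] by simp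
  have Bv: "B v u - B v v = (\<integral>x. \<rho> x * signed_powr p (v x) * (u x - v x) \<partial>M)"
    unfolding B_def right_diff_distrib using weight_integrable[OF v u] weight_integrable[OF v v] by simp
  have T: "\<bar>B u u - B u v\<bar> \<le> T" "\<bar>B v u - B v v\<bar> \<le> T"
    using weight_difference_bound[OF u uv d] weight_difference_bound[OF v uv d] nu nv
    unfolding Bu Bv T_def by simp_all
  have "A G G - A G H - A H G + A H H = l * (B u u - B u v) - m * (B v u - B v v)"
    unfolding AB by (simp add: algebra_simps)
  also have "\<dots> \<le> \<bar>l\<bar> * \<bar>B u u - B u v\<bar> + \<bar>m\<bar> * \<bar>B v u - B v v\<bar>"
    unfolding abs_mult[symmetric] by linarith
  also have "\<dots> \<le> L * T + L * T"
    using L T L0 by (intro add_mono mult_mono) auto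
  finally have 2: "C * (A G G - A G H - A H G + A H H) \<le> C * (L * T + L * T)"
    using C by (rule mult_left_mono)
  have "C * (L * T + L * T) = C * (2 * L * \<rho>plus * (d + d powr (1 - p) * Lp_gap u v))"
    by (simp add: T_def)
  with gap 1 2 show ?thesis by linarith
qed

text \<open>
The parameters of \<open>gradient_difference_bound\<close> are chosen in the order \<open>s\<close>, \<open>d\<close>, \<open>q\<close>, so that each of the three terms is at most \<open>e / 3\<close>.
\<close>
lemma gradients_Cauchy:
  assumes W: "\<And>n. W0_pair (u n) (G n)" and form: "\<And>n. weak_form (l n) (u n) (G n)"
    and n1: "\<And>n. Lp_mass (u n) = 1" and L: "\<And>n. \<bar>l n\<bar> \<le> L"
    and Cauchy: "\<And>e. 0 < e \<Longrightarrow> \<exists>N. \<forall>m\<ge>N. \<forall>n\<ge>N. Lp_gap (u m) (u n) < e"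
    and e: "0 < e"
  shows "\<exists>N. \<forall>m\<ge>N. \<forall>n\<ge>N. Lp_gap (G m) (G n) < e"
proof -
  define K where "K = 2 * \<bar>L * \<rho>plus\<bar> + 1"
  have K: "0 < K" "2 * L * \<rho>plus \<le> K" by (auto simp: K_def)
  define s where "s = e / (3 * K)"
  have s: "0 < s" using e K by (simp add: s_def)
  define C where "C = s powr (1 - max 2 p / p) / \<alpha>"
  have C: "0 < C" using s alpha_pos by (simp add: C_def)
  define d where "d = e / (3 * K * C)"
  have d: "0 < d" using e K C by (simp add: d_def)
  define q where "q = e / (3 * K * C * d powr (1 - p))"
  have q: "0 < q" using e K C d by (simp add: q_def)
  obtain N where N: "\<And>m n. m \<ge> N \<Longrightarrow> n \<ge> N \<Longrightarrow> Lp_gap (u m) (u n) < q"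
    using Cauchy[OF q] by blast
  show ?thesis
  proof (intro exI allI impI)
    fix m n assume mn: "N \<le> m" "N \<le> n"
    define I where "I = Lp_gap (u m) (u n)"
    have I: "0 \<le> I" "I < q" using N[OF mn] by (auto simp: I_def)
    have D0: "0 \<le> d + d powr (1 - p) * I" using d I by (intro add_nonneg_nonneg) auto
    have "Lp_gap (G m) (G n) \<le> s * (2 * L * \<rho>plus) + C * (2 * L * \<rho>plus * (d + d powr (1 - p) * I))"
      unfolding I_def C_def by (rule gradient_difference_bound[OF W W form form n1 n1 L L s d])
    also have "\<dots> \<le> s * K + C * (K * (d + d powr (1 - p) * I))"
      using s C K(2) D0 by (intro add_mono mult_left_mono mult_right_mono) auto
    also have "\<dots> < s * K + C * (K * (d + d powr (1 - p) * q))"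
      using C K d I by (intro add_strict_left_mono mult_strict_left_mono) auto
    also have "\<dots> = e"
      using K C d by (simp add: s_def q_def d_def[symmetric] distrib_left) (simp add: d_def field_simps)
    finally show "Lp_gap (G m) (G n) < e" .
  qed
qed

text \<open>
Both sides pass to the limit by dominated convergence: the integrands are continuous in \<open>u\<close> and \<open>G\<close>, and the
growth bounds are integrable once \<open>u n\<close> and \<open>G n\<close> are replaced by the dominating functions.
\<close>
lemma weak_form_limit:
  assumes form: "\<And>n. weak_form (l n) (u n) (G n)" and l: "l \<longlonglongrightarrow> l'"
    and u: "\<And>n. p_integrable M p (u n)" and U: "p_integrable M p U" and g: "p_integrable M p (g :: real^'n \<Rightarrow> real)"
    and ulim: "AE x in M. (\<lambda>n. u n x) \<longlonglongrightarrow> U x" and ub: "AE x in M. \<forall>n. norm (u n x) \<le> g x"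
    and G: "\<And>n. p_integrable M p (G n)" and H: "p_integrable M p H" and h: "p_integrable M p (h :: real^'n \<Rightarrow> real)"
    and Glim: "AE x in M. (\<lambda>n. G n x) \<longlonglongrightarrow> H x" and Gb: "AE x in M. \<forall>n. norm (G n x) \<le> h x"
  shows "weak_form l' U H"
  unfolding weak_form_def
proof (intro allI impI)
  fix v V assume W: "W0_pair v V"
  note v = W0_pair_p_integrable(1)[OF W] and V = W0_pair_p_integrable(2)[OF W]
  have powr: "s powr p \<le> \<bar>t\<bar> powr p" if "0 \<le> s" "s \<le> t" for s t :: real
    using that p_gt_1 by (intro powr_mono2) auto
  have "(\<lambda>n. a_form (G n) V) \<longlonglongrightarrow> a_form H V"
  proof (rule integral_dominated_convergence)
    show "integrable M (\<lambda>x. \<beta> * (norm (h x) powr p + norm (V x) powr p))"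
      using p_integrable_integrable[OF h] p_integrable_integrable[OF V] by simp
    show "AE x in M. (\<lambda>n. a x (G n x) \<bullet> V x) \<longlonglongrightarrow> a x (H x) \<bullet> V x"
      using a_continuous Glim
    proof eventually_elim
      case (elim x)
      show ?case
        by (intro tendsto_inner tendsto_const continuous_on_tendsto_compose[OF elim]) auto
    qed
    show "AE x in M. norm (a x (G n x) \<bullet> V x) \<le> \<beta> * (norm (h x) powr p + norm (V x) powr p)" for n
      using a_pairing_bound Gb
    proof eventually_elim
      case (elim x)
      have "norm (a x (G n x) \<bullet> V x) \<le> \<beta> * (norm (G n x) powr p + norm (V x) powr p)"
        using elim(1) by simp
      also have "\<dots> \<le> \<beta> * (norm (h x) powr p + norm (V x) powr p)"
        using powr[OF norm_ge_zero elim(2)[rule_format, of n]] beta_pos by simp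
      finally show ?case .
    qed
  qed (use a_pairing_integrable[OF H V] a_pairing_integrable[OF G V] in auto)
  moreover have "(\<lambda>n. rho_form (u n) v) \<longlonglongrightarrow> rho_form U v"
  proof (rule integral_dominated_convergence)
    show "integrable M (\<lambda>x. \<rho>plus * (norm (g x) powr p + norm (v x) powr p))"
      using p_integrable_integrable[OF g] p_integrable_integrable[OF v] by simp
    show "AE x in M. (\<lambda>n. \<rho> x * signed_powr p (u n x) * v x) \<longlonglongrightarrow> \<rho> x * signed_powr p (U x) * v x"
      using ulim
    proof eventually_elim
      case (elim x)
      then show ?case
        by (intro tendsto_mult tendsto_const tendsto_signed_powr p_gt_1)
    qed
    show "AE x in M. norm (\<rho> x * signed_powr p (u n x) * v x) \<le> \<rho>plus * (norm (g x) powr p + norm (v x) powr p)" for n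
      using weight_bound ub rho_abs
    proof eventually_elim
      case (elim x)
      have "norm (\<rho> x * signed_powr p (u n x) * v x) \<le> \<rho>plus * (\<bar>u n x\<bar> powr p + \<bar>v x\<bar> powr p)"
        using elim(1) by simp
      also have "\<dots> \<le> \<rho>plus * (norm (g x) powr p + norm (v x) powr p)"
        using powr[OF norm_ge_zero elim(2)[rule_format, of n]] elim(3) by (intro mult_left_mono) auto
      finally show ?case .
    qed
  qed (use weight_integrable[OF U v] weight_integrable[OF u v] in auto)
  then have "(\<lambda>n. l n * rho_form (u n) v) \<longlonglongrightarrow> l' * rho_form U v"
    by (rule tendsto_mult[OF l])
  moreover have "(\<lambda>n. a_form (G n) V) = (\<lambda>n. l n * rho_form (u n) v)"
    using form W by (simp add: weak_form_def)
  ultimately show "a_form H V = l' * rho_form U v"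
    by (simp add: LIMSEQ_unique)
qed

text \<open>
Three successive subsequences: Rellich for the functions, then almost everywhere convergence with domination for
the functions, then the same for the gradients, which are Cauchy by \<open>gradients_Cauchy\<close>.
\<close>
theorem eigenvalues_limit:
  assumes eig: "\<And>n::nat. l n \<in> eigenvalues p \<Omega> a \<rho>" and lim: "l \<longlonglongrightarrow> l'"
  shows "l' \<in> eigenvalues p \<Omega> a \<rho>"
proof -
  have "\<forall>n. \<exists>z. W0_pair (fst z) (snd z) \<and> weak_form (l n) (fst z) (snd z) \<and> Lp_mass (fst z) = 1"
  proof
    fix n
    obtain u G where "W0_pair u G" "weak_form (l n) u G" "Lp_mass u = 1"
      using eig[of n] unfolding eigenvalues_iff by blast
    then show "\<exists>z. W0_pair (fst z) (snd z) \<and> weak_form (l n) (fst z) (snd z) \<and> Lp_mass (fst z) = 1"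
      by (intro exI[of _ "(u, G)"]) simp
  qed
  from choice[OF this] obtain z where z: "\<And>n. W0_pair (fst (z n)) (snd (z n))"
    "\<And>n. weak_form (l n) (fst (z n)) (snd (z n))" "\<And>n. Lp_mass (fst (z n)) = 1"
    by blast
  define u where "u n = fst (z n)" for n
  define G where "G n = snd (z n)" for n
  have W: "W0_pair (u n) (G n)" and form: "weak_form (l n) (u n) (G n)"
    and n1: "Lp_mass (u n) = 1" for n
    using z by (simp_all add: u_def G_def)
  obtain L where L: "\<And>n. \<bar>l n\<bar> \<le> L"
    using convergent_imp_Bseq[OF convergentI[OF lim]] by (auto simp: Bseq_def)
  have Gbound: "Lp_mass (G n) \<le> L * \<rho>plus / \<alpha>" for n
  proof -
    let ?B = "rho_form (u n) (u n)"
    have B: "0 \<le> ?B" "?B \<le> \<rho>plus"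
      using weight_self_bounds[OF W0_pair_p_integrable(1)[OF W[of n]]] n1[of n] rho_pos by auto
    have "\<alpha> * Lp_mass (G n) \<le> l n * ?B"
      by (rule energy_bound[OF W form])
    also have "\<dots> \<le> L * \<rho>plus"
      using L[of n] B by (intro mult_mono) auto
    finally show ?thesis using alpha_pos by (simp add: field_simps)
  qed
  obtain r1 where r1: "strict_mono (r1 :: nat \<Rightarrow> nat)"
    and C1: "\<And>e. 0 < e \<Longrightarrow> \<exists>N. \<forall>m\<ge>N. \<forall>n\<ge>N. Lp_gap (u (r1 m)) (u (r1 n)) < e"
    by (rule Rellich[of u G, OF W Gbound]) (rule that)
  obtain r2 U g where r2: "strict_mono r2" and U: "p_integrable M p U" and g: "p_integrable M p (g :: real^'n \<Rightarrow> real)"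
    and ulim: "AE x in M. (\<lambda>n. u (r1 (r2 n)) x) \<longlonglongrightarrow> U x"
    and ub: "AE x in M. \<forall>n. norm (u (r1 (r2 n)) x) \<le> g x"
    and uL: "(\<lambda>n. Lp_gap (u (r1 (r2 n))) U) \<longlonglongrightarrow> 0"
    by (rule Riesz_Fischer[of p M "\<lambda>n. u (r1 n)", OF p_gt_1 W0_pair_p_integrable(1)[OF W]]) (rule C1, assumption, rule that)
  have C2: "\<exists>N. \<forall>m\<ge>N. \<forall>n\<ge>N. Lp_gap (u (r1 (r2 m))) (u (r1 (r2 n))) < e" if e: "0 < e" for e
  proof -
    obtain N where N: "\<forall>m\<ge>N. \<forall>n\<ge>N. Lp_gap (u (r1 m)) (u (r1 n)) < e"
      using C1[OF e] by blast
    then show ?thesis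
      using seq_suble[OF r2] by (intro exI[of _ N]) (auto intro: order_trans)
  qed
  have C3: "\<exists>N. \<forall>m\<ge>N. \<forall>n\<ge>N. Lp_gap (G (r1 (r2 m))) (G (r1 (r2 n))) < e" if e: "0 < e" for e
    by (rule gradients_Cauchy[of "\<lambda>n. u (r1 (r2 n))" "\<lambda>n. G (r1 (r2 n))" "\<lambda>n. l (r1 (r2 n))" L, OF W form n1 L _ e]) (rule C2)
  obtain r3 H h where r3: "strict_mono r3" and H: "p_integrable M p H" and h: "p_integrable M p (h :: real^'n \<Rightarrow> real)"
    and Glim: "AE x in M. (\<lambda>n. G (r1 (r2 (r3 n))) x) \<longlonglongrightarrow> H x"
    and Gb: "AE x in M. \<forall>n. norm (G (r1 (r2 (r3 n))) x) \<le> h x"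
    and GL: "(\<lambda>n. Lp_gap (G (r1 (r2 (r3 n)))) H) \<longlonglongrightarrow> 0"
    by (rule Riesz_Fischer[of p M "\<lambda>n. G (r1 (r2 n))", OF p_gt_1 W0_pair_p_integrable(2)[OF W]]) (rule C3, assumption, rule that)
  define r where "r n = r1 (r2 (r3 n))" for n
  have r: "strict_mono r"
    using r1 r2 r3 by (auto simp: strict_mono_def r_def)
  have ulim': "AE x in M. (\<lambda>n. u (r n) x) \<longlonglongrightarrow> U x"
    using ulim by eventually_elim (use LIMSEQ_subseq_LIMSEQ[OF _ r3] in \<open>fastforce simp: o_def r_def\<close>)
  have ub': "AE x in M. \<forall>n. norm (u (r n) x) \<le> g x"
    using ub by eventually_elim (simp add: r_def)
  have uL': "(\<lambda>n. Lp_gap (u (r n)) U) \<longlonglongrightarrow> 0"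
    using LIMSEQ_subseq_LIMSEQ[OF uL r3] by (simp add: o_def r_def)
  have lim': "(\<lambda>n. l (r n)) \<longlonglongrightarrow> l'"
    using LIMSEQ_subseq_LIMSEQ[OF lim r] by (simp add: o_def)
  note up = W0_pair_p_integrable(1)[OF W] and Gp = W0_pair_p_integrable(2)[OF W]
  have WU: "W0_pair U H"
    by (rule W0_pair_limit[of "\<lambda>n. u (r n)" "\<lambda>n. G (r n)", OF W U H uL'])
       (use GL in \<open>simp add: r_def\<close>)
  have formU: "weak_form l' U H"
    by (rule weak_form_limit[of "\<lambda>n. l (r n)" "\<lambda>n. u (r n)" "\<lambda>n. G (r n)" l' U g H h,
          OF form lim' up U g ulim' ub' Gp H h])
       (use Glim Gb in \<open>simp_all add: r_def\<close>)
  have "(\<lambda>n. Lp_mass (u (r n))) \<longlonglongrightarrow> Lp_mass U"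
  proof (rule integral_dominated_convergence[OF _ _ p_integrable_integrable[OF g]])
    show "AE x in M. (\<lambda>n. norm (u (r n) x) powr p) \<longlonglongrightarrow> norm (U x) powr p"
      using ulim' by eventually_elim (use p_gt_1 in \<open>auto intro!: tendsto_powr' tendsto_rabs\<close>)
    show "AE x in M. norm (norm (u (r n) x) powr p) \<le> norm (g x) powr p" for n
      using ub'
    proof eventually_elim
      case (elim x)
      then have "norm (u (r n) x) \<le> norm (g x)" by (smt (verit) real_norm_def)
      then show ?case using p_gt_1 by (simp add: powr_mono2)
    qed
  qed (use p_integrable_integrable[OF U] p_integrable_integrable[OF up] in auto)
  then have "Lp_mass U = 1"
    unfolding n1 by (simp add: LIMSEQ_const_iff)
  then show ?thesis
    using eigenvalues_iff WU formU by blast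
qed

end

theorem proposition4p1:
  fixes \<Omega> :: "(real^'n) set"
    and p \<alpha> \<beta> c \<rho>minus \<rho>plus :: real
    and \<rho> :: "real^'n \<Rightarrow> real"
    and a :: "real^'n \<Rightarrow> real^'n \<Rightarrow> real^'n"
  assumes p: "1 < p"
    and domain: "open \<Omega>" "connected \<Omega>" "\<Omega> \<noteq> {}" "bounded \<Omega>"
    and rho_meas: "\<rho> \<in> borel_measurable (lebesgue_on \<Omega>)"
    and rho_pos: "0 < \<rho>minus"
    and rho_bounds: "AE x in lebesgue_on \<Omega>. \<rho>minus \<le> \<rho> x \<and> \<rho> x \<le> \<rho>plus"
    and pos: "0 < \<alpha>" "0 < \<beta>" "0 < c"
    and H0: "AE x in lebesgue_on \<Omega>. continuous_on UNIV (a x)"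
            "\<And>\<xi>. (\<lambda>x. a x \<xi>) \<in> borel_measurable (lebesgue_on \<Omega>)"
    and H1: "\<And>\<xi>1 \<xi>2. AE x in lebesgue_on \<Omega>. 0 \<le> (a x \<xi>1 - a x \<xi>2) \<bullet> (\<xi>1 - \<xi>2)"
    and H2: "\<And>\<xi>. AE x in lebesgue_on \<Omega>. \<alpha> * norm \<xi> powr p \<le> a x \<xi> \<bullet> \<xi>"
    and H3: "\<And>\<xi>. AE x in lebesgue_on \<Omega>. norm (a x \<xi>) \<le> \<beta> * norm \<xi> powr (p - 1)"
    and H4: "\<And>t \<xi>. 0 < t \<Longrightarrow>
               AE x in lebesgue_on \<Omega>. a x (t *\<^sub>R \<xi>) = t powr (p - 1) *\<^sub>R a x \<xi>"
    and H5: "\<And>\<xi>. AE x in lebesgue_on \<Omega>. a x (- \<xi>) = - a x \<xi>"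
    and H6: "\<And>\<xi>1 \<xi>2. AE x in lebesgue_on \<Omega>.
               (let \<delta> = min (p / 2) (p - 1) in
                 norm (a x \<xi>1 - a x \<xi>2) \<le>
                   c * Psi a x \<xi>1 \<xi>2 powr ((p - 1 - \<delta>) / p)
                     * ((a x \<xi>1 - a x \<xi>2) \<bullet> (\<xi>1 - \<xi>2)) powr (\<delta> / p))"
    and H7: "\<And>(k::nat) (\<xi> :: nat \<Rightarrow> real^'n). 1 \<le> k \<Longrightarrow> \<xi> (k + 1) = \<xi> 1 \<Longrightarrow>
               AE x in lebesgue_on \<Omega>. (\<Sum>i=1..k. a x (\<xi> i) \<bullet> (\<xi> (i + 1) - \<xi> i)) \<le> 0"
    and H8: "\<And>\<xi>1 \<xi>2. (\<xi>1, \<xi>2) \<noteq> (0, 0) \<Longrightarrow> AE x in lebesgue_on \<Omega>.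
               (let \<gamma> = max 2 p in
                 \<alpha> * norm (\<xi>1 - \<xi>2) powr \<gamma> * Psi a x \<xi>1 \<xi>2 powr (1 - \<gamma> / p)
                   \<le> (a x \<xi>1 - a x \<xi>2) \<bullet> (\<xi>1 - \<xi>2))"
  shows "closed (eigenvalues p \<Omega> a \<rho>) \<and> eigenvalues p \<Omega> a \<rho> \<subseteq> {0<..}"
proof -
  interpret quasilinear_eigenproblem \<Omega> p a \<rho> \<alpha> \<beta> \<rho>minus \<rho>plus
    using p domain rho_meas rho_pos rho_bounds pos H0 H2 H3 H4 H8
    by unfold_locales (simp_all add: Let_def)
  show ?thesis
  proof
    show "closed (eigenvalues p \<Omega> a \<rho>)"
      unfolding closed_sequential_limits using eigenvalues_limit by blast
    show "eigenvalues p \<Omega> a \<rho> \<subseteq> {0<..}"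
      using eigenvalues_positive by auto
  qed
qed

end
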